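(* Let $L$ be a language (a set of finite strings, equivalently a subset of $\mathbb{N}$). Then $L$ is recognizable by a Turing machine with the fast-growing level $2$ sequence oracle if and only if $L$ is many-one reducible to the $\Sigma^0_2$ game quantifier (equivalently, to the set of winning positions in a $\Sigma^0_2$ game on integers). The same equivalence holds for the nonlocal version of recognizability with the fast-growing level $2$ sequence oracle.
   Context: Recognizability. For $k\ge 1$, $L$ is recognizable by a Turing machine with the fast-growing level $k$ sequence oracle iff there are an oracle Turing machine $T$ and a function $f:\mathbb{N}^{\mathbb{N}}\to\mathbb{N}^{\mathbb{N}}$, with $f(A)(n)$ depending only on a finite (but dependent on $n$) segment of $A$ (i.e. for all $A,n$ there is $m$ such that $f(A')(n)=f(A)(n)$ for all $A'$ agreeing with $A$ below $m$), such that for all functions $A_1,\dots,A_k:\mathbb{N}\to\mathbb{N}$ with $A_{i+1}(n)>f(A_i)(n)$ for all $0\le i<k$ and all $n$ (where $A_0$ is the constant function $0$), and for every input $S$: $T$ with oracles $A_1,\dots,A_k$ halts on input $S$ iff $S\in L$. The nonlocal version is the same, except that $f:\mathbb{N}^{\mathbb{N}}\to\mathbb{N}^{\mathbb{N}}$ is arbitrary, i.e. $f(A)(n)$ may depend on the entirety of $A$. Games. A $\Sigma^0_2$ game on integers is a game in which two players alternately play integers for $\omega$ moves and the first player wins iff the resulting play lies in a fixed lightface $\Sigma^0_2$ set. The $\Sigma^0_2$ game quantifier is the set of codes (under a standard coding of $\Sigma^0_2$ payoff sets by natural numbers) of such games for which the first player has a winning strategy. A winning position is a finite sequence of moves from which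 the first player has a winning strategy. *)

theory Defs
  imports Main "HOL-Library.Nat_Bijection"
begin

section \<open>Oracle Turing machines\<close>

text \<open>
  Multi-tape machines in quadruple form. The alphabet is the natural numbers, with \<open>0\<close> the blank
  and \<open>1\<close> the stroke; a machine, being a finite list of instructions, mentions only finitely many
  symbols, states and tapes. A tape \<open>(l, r)\<close> has the scanned cell at the front of \<open>r\<close>,
  and \<open>l\<close> lists the cells to its left, nearest first; everything outside is blank.
\<close>

type_synonym tape = "nat list \<times> nat list"

fun scan :: "tape \<Rightarrow> nat" where
  "scan (l, []) = 0"
| "scan (l, a # r) = a"

fun move_left :: "tape \<Rightarrow> tape" where
  "move_left ([], r) = ([], 0 # r)"
| "move_left (a # l, r) = (l, a # r)"

fun move_right :: "tape \<Rightarrow> tape" where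
  "move_right (l, []) = (0 # l, [])"
| "move_right (l, a # r) = (a # l, r)"

fun write_symbol :: "nat \<Rightarrow> tape \<Rightarrow> tape" where
  "write_symbol b (l, r) = (l, b # tl r)"

definition unary_tape :: "nat \<Rightarrow> tape" where
  "unary_tape n = ([], replicate n 1)"

definition tape_number :: "tape \<Rightarrow> nat" where
  "tape_number tp = length (takeWhile (\<lambda>a. a = 1) (snd tp))"

datatype action = MoveLeft | MoveRight | Write nat | Query nat

text \<open>
  The instruction \<open>(q, t, a, act, q')\<close> applies in state \<open>q\<close> if the head on tape \<open>t\<close> scans \<open>a\<close>;
  it performs \<open>act\<close> on tape \<open>t\<close> and passes to state \<open>q'\<close>. The first applicable instruction in the
  list is executed, so machines are deterministic. The machine halts when no instruction applies.
\<close>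

type_synonym instruction = "nat \<times> nat \<times> nat \<times> action \<times> nat"
type_synonym machine = "instruction list"
type_synonym config = "nat \<times> (nat \<Rightarrow> tape)"

text \<open>
  \<open>Query i\<close> replaces the number \<open>n\<close> on the tape by the value at \<open>n\<close> of the \<open>i\<close>-th oracle
  (counting from \<open>0\<close>). Queries to an oracle that is not supplied are answered by \<open>0\<close>.
\<close>

fun perform :: "(nat \<Rightarrow> nat) list \<Rightarrow> action \<Rightarrow> tape \<Rightarrow> tape" where
  "perform Os MoveLeft tp = move_left tp"
| "perform Os MoveRight tp = move_right tp"
| "perform Os (Write b) tp = write_symbol b tp"
| "perform Os (Query i) tp =
     unary_tape (if i < length Os then (Os ! i) (tape_number tp) else 0)"

definition next_instruction :: "machine \<Rightarrow> config \<Rightarrow> instruction option" where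
  "next_instruction M c =
     find (\<lambda>(q, t, a, _, _). q = fst c \<and> a = scan (snd c t)) M"

definition halted :: "machine \<Rightarrow> config \<Rightarrow> bool" where
  "halted M c \<longleftrightarrow> next_instruction M c = None"

definition step :: "machine \<Rightarrow> (nat \<Rightarrow> nat) list \<Rightarrow> config \<Rightarrow> config" where
  "step M Os c =
     (case next_instruction M c of
        None \<Rightarrow> c
      | Some (_, t, _, act, q') \<Rightarrow> (q', (snd c)(t := perform Os act (snd c t))))"

definition initial_config :: "nat \<Rightarrow> config" where
  "initial_config n = (0, (\<lambda>_. ([], []))(0 := unary_tape n))"

definition run :: "machine \<Rightarrow> (nat \<Rightarrow> nat) list \<Rightarrow> nat \<Rightarrow> nat \<Rightarrow> config" where
  "run M Os n s = (step M Os ^^ s) (initial_config n)"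

definition halts :: "machine \<Rightarrow> (nat \<Rightarrow> nat) list \<Rightarrow> nat \<Rightarrow> bool" where
  "halts M Os n \<longleftrightarrow> (\<exists>s. halted M (run M Os n s))"

definition computable :: "(nat \<Rightarrow> nat) \<Rightarrow> bool" where
  "computable g \<longleftrightarrow>
     (\<exists>M. \<forall>n. \<exists>s. halted M (run M [] n s) \<and> tape_number (snd (run M [] n s) 0) = g n)"

definition many_one_reducible :: "nat set \<Rightarrow> nat set \<Rightarrow> bool" (infix "\<le>\<^sub>m" 50) where
  "A \<le>\<^sub>m B \<longleftrightarrow> (\<exists>g. computable g \<and> (\<forall>n. n \<in> A \<longleftrightarrow> g n \<in> B))"


section \<open>Codes of machines\<close>

fun action_decode :: "nat \<Rightarrow> action" where
  "action_decode 0 = MoveLeft"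
| "action_decode (Suc 0) = MoveRight"
| "action_decode (Suc (Suc n)) = (if even n then Write (n div 2) else Query (n div 2))"

definition instruction_decode :: "nat \<Rightarrow> instruction" where
  "instruction_decode e =
     (let (q, e1) = prod_decode e;
          (t, e2) = prod_decode e1;
          (a, e3) = prod_decode e2;
          (c, q') = prod_decode e3
      in (q, t, a, action_decode c, q'))"

definition machine_decode :: "nat \<Rightarrow> machine" where
  "machine_decode e = map instruction_decode (list_decode e)"

lemma surj_action_decode: "surj action_decode"
proof (rule surjI)
  fix act
  show "action_decode (case act of MoveLeft \<Rightarrow> 0 | MoveRight \<Rightarrow> 1
      | Write b \<Rightarrow> Suc (Suc (2 * b)) | Query i \<Rightarrow> Suc (Suc (2 * i + 1))) = act"
    by (cases act) auto
qed

lemma surj_instruction_decode: "surj instruction_decode"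
proof (rule surjI)
  fix ins :: instruction
  show "instruction_decode ((\<lambda>(q, t, a, act, q'). prod_encode (q, prod_encode (t,
      prod_encode (a, prod_encode (inv action_decode act, q'))))) ins) = ins"
    by (cases ins) (simp add: instruction_decode_def surj_f_inv_f[OF surj_action_decode])
qed

lemma surj_machine_decode: "surj machine_decode"
proof (rule surjI)
  fix M :: machine
  show "machine_decode (list_encode (map (inv instruction_decode) M)) = M"
    by (simp add: machine_decode_def comp_def surj_f_inv_f[OF surj_instruction_decode])
qed


section \<open>Fast-growing sequence oracles\<close>

definition local_functional :: "((nat \<Rightarrow> nat) \<Rightarrow> (nat \<Rightarrow> nat)) \<Rightarrow> bool" where
  "local_functional f \<longleftrightarrow>
     (\<forall>A n. \<exists>m. \<forall>A'. (\<forall>j<m. A' j = A j) \<longrightarrow> f A' n = f A n)"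

definition fast_growing_sequence ::
  "nat \<Rightarrow> ((nat \<Rightarrow> nat) \<Rightarrow> (nat \<Rightarrow> nat)) \<Rightarrow> (nat \<Rightarrow> nat \<Rightarrow> nat) \<Rightarrow> bool" where
  "fast_growing_sequence k f A \<longleftrightarrow>
     A 0 = (\<lambda>_. 0) \<and> (\<forall>i<k. \<forall>n. A (Suc i) n > f (A i) n)"

definition recognizes ::
  "nat \<Rightarrow> machine \<Rightarrow> ((nat \<Rightarrow> nat) \<Rightarrow> (nat \<Rightarrow> nat)) \<Rightarrow> nat set \<Rightarrow> bool" where
  "recognizes k T f L \<longleftrightarrow>
     (\<forall>A. fast_growing_sequence k f A \<longrightarrow>
        (\<forall>S. halts T (map A [1..<Suc k]) S \<longleftrightarrow> S \<in> L))"

definition recognizable :: "nat \<Rightarrow> nat set \<Rightarrow> bool" where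
  "recognizable k L \<longleftrightarrow> (\<exists>T f. local_functional f \<and> recognizes k T f L)"

definition nonlocally_recognizable :: "nat \<Rightarrow> nat set \<Rightarrow> bool" where
  "nonlocally_recognizable k L \<longleftrightarrow> (\<exists>T f. recognizes k T f L)"


section \<open>Games on integers with lightface $\Sigma^0_2$ payoff\<close>

text \<open>
  The code \<open>e\<close> denotes the set of plays \<open>x\<close> such that, for some \<open>i\<close>, machine \<open>e\<close> with oracle \<open>x\<close>
  never halts on input \<open>i\<close>. Whether it has halted after \<open>s\<close> steps is decidable in \<open>x\<close>, so this is
  the usual universal indexing of the lightface $\Sigma^0_2$ sets, by indices of the uniformly
  semirecursive complements of the $\Pi^0_1$ sections.
\<close>

definition Sigma02_set :: "nat \<Rightarrow> (nat \<Rightarrow> int) set" where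
  "Sigma02_set e =
     {x. \<exists>i. \<forall>s. \<not> halted (machine_decode e) (run (machine_decode e) [int_encode \<circ> x] i s)}"

definition lightface_Sigma02 :: "(nat \<Rightarrow> int) set \<Rightarrow> bool" where
  "lightface_Sigma02 W \<longleftrightarrow> (\<exists>e. W = Sigma02_set e)"

text \<open>
  The first player makes the moves \<open>x 0, x 2, \<dots>\<close>. A position may have either parity; a strategy is
  consulted only from the position on.
\<close>

definition winning_position :: "(nat \<Rightarrow> int) set \<Rightarrow> int list \<Rightarrow> bool" where
  "winning_position W p \<longleftrightarrow>
     (\<exists>\<sigma> :: int list \<Rightarrow> int. \<forall>x.
        map x [0..<length p] = p \<and>
        (\<forall>n\<ge>length p. even n \<longrightarrow> x n = \<sigma> (map x [0..<n])) \<longrightarrow> x \<in> W)"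

definition first_player_wins :: "(nat \<Rightarrow> int) set \<Rightarrow> bool" where
  "first_player_wins W \<longleftrightarrow> winning_position W []"

definition Sigma02_game_quantifier :: "nat set" where
  "Sigma02_game_quantifier = {e. first_player_wins (Sigma02_set e)}"

definition winning_position_codes :: "(nat \<Rightarrow> int) set \<Rightarrow> nat set" where
  "winning_position_codes W = {list_encode (map int_encode p) | p. winning_position W p}"

end

theory Submission imports Defs
begin

text \<open>
  From a game to a machine: let the first player move below \<open>A1\<close>, the second below \<open>A2\<close>, and let
  \<open>A2\<close> also set deadlines by which the play must have left each closed component of the
  $\Sigma^0_2$ set. A winning strategy of the first player is dominated by \<open>A1\<close>, so it still wins. A
  winning strategy of the second player against the finitely branching tree of moves below \<open>A1\<close>
  meets, by compactness, deadlines that depend locally on \<open>A1\<close>, so it still wins. By Koenig's lemma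
  a win of the first player in this bounded game is witnessed by a finite set of positions, for
  which a machine can search.

  From a machine to a game: whether all \<open>A2\<close> above some \<open>B\<close> keep the machine running is a closed
  condition on \<open>A1\<close> and \<open>B\<close>. The players produce \<open>A1\<close>, the first bidding lower bounds, while the
  second also announces the values of \<open>B\<close>, each after an arbitrary finite delay; that every value is
  announced is a $\Pi^0_2$ condition. Because of the delays the second player can fix in advance an
  \<open>A1\<close> that outbids a given strategy, and take \<open>B = f A1\<close> although \<open>f\<close> is not local. Determinacy
  of $\Sigma^0_2$ games gives the converse.
\<close>

section \<open>Register programs\<close>

text \<open>Local recognizability is a special case of the nonlocal one, which gives a reduction,
  which gives back a local functional; a nonlocal \<open>f\<close> is thus replaced by a local one
  only by way of the game. One \<open>f\<close> has to serve all inputs, hence all game codes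
  \<open>e\<close> at once: this is why the oracles are consulted at \<open>pair e r\<close> and why
  winning strategies for every \<open>e\<close> are chosen together. The local \<open>f\<close> need
  not be computable. It adds values of strategies, which do not depend on \<open>A\<close>, to
  deadlines, which depend on \<open>A\<close> only through the finitely many moves that
  \<open>A\<close> permits before the deadline. Machines are concrete lists of quadruples.
  Computability is therefore settled once for primitive recursive predicates followed by one
  unbounded search, with machine codes computable from a parameter. Infinite oracles enter such
  predicates through finite partial information.\<close>

datatype com = Inc nat | Dec nat | Ask nat nat | Seq com com | Cond nat com com | While nat com

definition answer :: "(nat \<Rightarrow> nat) list \<Rightarrow> nat \<Rightarrow> nat \<Rightarrow> nat" where
  "answer Os i n = (if i < length Os then (Os ! i) n else 0)"

inductive exec :: "(nat \<Rightarrow> nat) list \<Rightarrow> com \<Rightarrow> (nat \<Rightarrow> nat) \<Rightarrow> (nat \<Rightarrow> nat) \<Rightarrow> bool" for Os where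
  inc: "exec Os (Inc r) e (e(r := Suc (e r)))"
| dec: "exec Os (Dec r) e (e(r := e r - 1))"
| ask: "exec Os (Ask i r) e (e(r := answer Os i (e r)))"
| seq: "exec Os c e e1 \<Longrightarrow> exec Os d e1 e2 \<Longrightarrow> exec Os (Seq c d) e e2"
| cond1: "e r \<noteq> 0 \<Longrightarrow> exec Os c e e1 \<Longrightarrow> exec Os (Cond r c d) e e1"
| cond0: "e r = 0 \<Longrightarrow> exec Os d e e1 \<Longrightarrow> exec Os (Cond r c d) e e1"
| while0: "e r = 0 \<Longrightarrow> exec Os (While r c) e e"
| while1: "e r \<noteq> 0 \<Longrightarrow> exec Os c e e1 \<Longrightarrow> exec Os (While r c) e1 e2 \<Longrightarrow> exec Os (While r c) e e2"

section \<open>Compilation of register programs into quadruple machines\<close>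

fun len :: "com \<Rightarrow> nat" where
  "len (Inc r) = 2"
| "len (Dec r) = 2"
| "len (Ask i r) = 1"
| "len (Seq c d) = len c + len d"
| "len (Cond r c d) = len c + len d + 2"
| "len (While r c) = len c + 2"

text \<open>Writing back the scanned symbol leaves the register unchanged, so this is a conditional
  jump; with \<open>q0 = q1\<close> it is an unconditional one.\<close>

definition branch :: "nat \<Rightarrow> nat \<Rightarrow> nat \<Rightarrow> nat \<Rightarrow> machine" where
  "branch q r q0 q1 = [(q, r, 0, Write 0, q0), (q, r, 1, Write 1, q1)]"

text \<open>A register is a unary number on its own tape that grows and shrinks at its left end. The
  code is entered in state \<open>q\<close> and left in state \<open>q + len c\<close>, where it has
  no instruction itself.\<close>

fun compile :: "com \<Rightarrow> nat \<Rightarrow> machine" where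
  "compile (Inc r) q =
     [(q, r, 0, MoveLeft, q + 1), (q, r, 1, MoveLeft, q + 1), (q + 1, r, 0, Write 1, q + 2)]"
| "compile (Dec r) q =
     [(q, r, 0, Write 0, q + 2), (q, r, 1, Write 0, q + 1), (q + 1, r, 0, MoveRight, q + 2)]"
| "compile (Ask i r) q = [(q, r, 0, Query i, q + 1), (q, r, 1, Query i, q + 1)]"
| "compile (Seq c d) q = compile c q @ compile d (q + len c)"
| "compile (Cond r c d) q =
     branch q r (q + len c + 2) (q + 1) @ compile c (q + 1) @
     branch (q + 1 + len c) r (q + len c + len d + 2) (q + len c + len d + 2) @
     compile d (q + len c + 2)"
| "compile (While r c) q =
     branch q r (q + len c + 2) (q + 1) @ compile c (q + 1) @ branch (q + 1 + len c) r q q"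

lemma compile_states: "ins \<in> set (compile c q) \<Longrightarrow> q \<le> fst ins \<and> fst ins < q + len c"
  by (induction c arbitrary: q) (fastforce simp: branch_def)+

text \<open>Which instruction fires in state \<open>p\<close> depends only on the instructions of
  \<open>p\<close> and their order, so agreement of the filtered lists is enough, and it passes to a
  block whose neighbours use other states.\<close>

definition installed :: "machine \<Rightarrow> machine \<Rightarrow> nat \<Rightarrow> nat \<Rightarrow> bool" where
  "installed M C lo hi \<longleftrightarrow>
     (\<forall>p. lo \<le> p \<and> p < hi \<longrightarrow> filter (\<lambda>ins. fst ins = p) M = filter (\<lambda>ins. fst ins = p) C)"

lemma installed_sub:
  assumes "installed M (A @ C @ B) lo hi" "lo \<le> lo'" "hi' \<le> hi"
    and "\<And>ins. ins \<in> set A \<union> set B \<Longrightarrow> fst ins < lo' \<or> hi' \<le> fst ins"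
  shows "installed M C lo' hi'"
proof -
  have "filter (\<lambda>ins. fst ins = p) A = []" "filter (\<lambda>ins. fst ins = p) B = []"
    if "lo' \<le> p" "p < hi'" for p
    using assms(4) that by (fastforce simp: filter_empty_conv)+
  then show ?thesis
    using assms(1-3) unfolding installed_def by (auto simp del: filter_False)
qed

lemma installed_Seq:
  assumes "installed M (compile (Seq c d) q) q (q + len (Seq c d))"
  shows "installed M (compile c q) q (q + len c)"
    and "installed M (compile d (q + len c)) (q + len c) (q + len c + len d)"
proof -
  note * = installed_sub[of M _ _ _ q "q + len (Seq c d)"]
  show "installed M (compile c q) q (q + len c)"
    by (rule *[of "[]" _ "compile d (q + len c)"]) (use assms in \<open>auto dest: compile_states\<close>)
  show "installed M (compile d (q + len c)) (q + len c) (q + len c + len d)"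
    by (rule *[of "compile c q" _ "[]"]) (use assms in \<open>auto dest: compile_states\<close>)
qed

lemma installed_Cond:
  assumes "installed M (compile (Cond r c d) q) q (q + len (Cond r c d))"
  defines "E \<equiv> q + len c + len d + 2"
  shows "installed M (branch q r (q + len c + 2) (q + 1)) q (Suc q)"
    and "installed M (compile c (q + 1)) (q + 1) (q + 1 + len c)"
    and "installed M (branch (q + 1 + len c) r E E) (q + 1 + len c) (Suc (q + 1 + len c))"
    and "installed M (compile d (q + len c + 2)) (q + len c + 2) (q + len c + 2 + len d)"
proof -
  let ?pre = "branch q r (q + len c + 2) (q + 1)" and ?b = "branch (q + 1 + len c) r E E"
  let ?c = "compile c (q + 1)" and ?d = "compile d (q + len c + 2)"
  have b: "fst ins = q" if "ins \<in> set (branch q r x y)" for ins q x y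
    using that by (auto simp: branch_def)
  note * = installed_sub[of M _ _ _ q "q + len (Cond r c d)"]
  have a: "installed M (?pre @ ?c @ ?b @ ?d) q (q + len (Cond r c d))"
    using assms(1) by (simp add: E_def)
  show "installed M ?pre q (Suc q)"
    by (rule *[of "[]" _ "?c @ ?b @ ?d"]) (use a in \<open>auto dest!: compile_states b\<close>)
  show "installed M ?c (q + 1) (q + 1 + len c)"
    by (rule *[of ?pre _ "?b @ ?d"]) (use a in \<open>auto dest!: compile_states b\<close>)
  show "installed M ?b (q + 1 + len c) (Suc (q + 1 + len c))"
    by (rule *[of "?pre @ ?c" _ ?d]) (use a in \<open>auto dest!: compile_states b\<close>)
  show "installed M ?d (q + len c + 2) (q + len c + 2 + len d)"
    by (rule *[of "?pre @ ?c @ ?b" _ "[]"]) (use a in \<open>auto dest!: compile_states b\<close>)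
qed

lemma installed_While:
  assumes "installed M (compile (While r c) q) q (q + len (While r c))"
  shows "installed M (branch q r (q + len c + 2) (q + 1)) q (Suc q)"
    and "installed M (compile c (q + 1)) (q + 1) (q + 1 + len c)"
    and "installed M (branch (q + 1 + len c) r q q) (q + 1 + len c) (Suc (q + 1 + len c))"
proof -
  let ?pre = "branch q r (q + len c + 2) (q + 1)" and ?b = "branch (q + 1 + len c) r q q"
  let ?c = "compile c (q + 1)"
  have b: "fst ins = q" if "ins \<in> set (branch q r x y)" for ins q x y
    using that by (auto simp: branch_def)
  note * = installed_sub[of M _ _ _ q "q + len (While r c)"]
  have a: "installed M (?pre @ ?c @ ?b) q (q + len (While r c))"
    using assms(1) by simp
  show "installed M ?pre q (Suc q)"
    by (rule *[of "[]" _ "?c @ ?b"]) (use a in \<open>auto dest!: compile_states b\<close>)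
  show "installed M ?c (q + 1) (q + 1 + len c)"
    by (rule *[of ?pre _ "?b"]) (use a in \<open>auto dest!: compile_states b\<close>)
  show "installed M ?b (q + 1 + len c) (Suc (q + 1 + len c))"
    by (rule *[of "?pre @ ?c" _ "[]"]) (use a in \<open>auto dest!: compile_states b\<close>)
qed

lemma find_filter: "(\<And>x. P x \<Longrightarrow> Q x) \<Longrightarrow> find P (filter Q xs) = find P xs"
  by (induction xs) auto

lemma next_instruction_installed:
  assumes "installed M C lo hi" "lo \<le> q" "q < hi"
  shows "next_instruction M (q, T) = next_instruction C (q, T)"
proof -
  have *: "find P A = find P (filter (\<lambda>ins. fst ins = q) A)"
    if "P = (\<lambda>(q', t, a, _, _). q' = q \<and> a = scan (T t))" for P and A :: machine
    by (rule find_filter[symmetric]) (auto simp: that)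
  have "filter (\<lambda>ins. fst ins = q) M = filter (\<lambda>ins. fst ins = q) C"
    using assms by (simp add: installed_def)
  then show ?thesis
    unfolding next_instruction_def fst_conv snd_conv
    using *[OF refl, of M] *[OF refl, of C] by simp
qed

text \<open>\<open>Dec\<close> leaves blanks behind on the left, and writing on an empty right part
  makes a blank explicit; a register may therefore be padded with blanks on both sides.\<close>

definition holds :: "nat \<Rightarrow> tape \<Rightarrow> bool" where
  "holds n tp \<longleftrightarrow> (\<exists>k m. tp = (replicate k 0, replicate n 1 @ replicate m 0))"

definition represents :: "(nat \<Rightarrow> nat) \<Rightarrow> (nat \<Rightarrow> tape) \<Rightarrow> bool" where
  "represents e T \<longleftrightarrow> (\<forall>r. holds (e r) (T r))"

lemma holds_number: "holds n tp \<Longrightarrow> tape_number tp = n"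
  by (auto simp: holds_def tape_number_def takeWhile_append takeWhile_replicate)

lemma holds_unary: "holds n (unary_tape n)"
  unfolding holds_def unary_tape_def by (rule exI[of _ 0], rule exI[of _ 0]) simp

lemma scan_holds: "holds n tp \<Longrightarrow> scan tp = (if n = 0 then 0 else 1)"
  unfolding holds_def
  by (cases n) (auto, (metis replicate_empty scan.simps gr0_conv_Suc replicate_Suc neq0_conv)+)

lemma holds_write_scan: "holds n tp \<Longrightarrow> holds n (write_symbol (if n = 0 then 0 else 1) tp)"
proof -
  assume "holds n tp"
  then obtain k m where tp: "tp = (replicate k 0, replicate n 1 @ replicate m 0)"
    by (auto simp: holds_def)
  show ?thesis
  proof (cases n)
    case 0
    have "write_symbol 0 tp = (replicate k 0, replicate (Suc (m - 1)) 0)"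
      using 0 tp by (cases m) auto
    then show ?thesis using 0 unfolding holds_def by (metis append_Nil replicate_0)
  next
    case (Suc n')
    then have "write_symbol 1 tp = tp" using tp by simp
    then show ?thesis using Suc \<open>holds n tp\<close> by simp
  qed
qed

lemma holds_inc:
  assumes "holds n tp"
  shows "scan (move_left tp) = 0" "holds (Suc n) (write_symbol 1 (move_left tp))"
proof -
  obtain k m where tp: "tp = (replicate k 0, replicate n 1 @ replicate m 0)"
    using assms by (auto simp: holds_def)
  have ml: "move_left tp = (replicate (k - 1) 0, 0 # replicate n 1 @ replicate m 0)"
    using tp by (cases k) auto
  show "scan (move_left tp) = 0" by (simp add: ml)
  have "write_symbol 1 (move_left tp) = (replicate (k - 1) 0, replicate (Suc n) 1 @ replicate m 0)"
    by (simp add: ml)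
  then show "holds (Suc n) (write_symbol 1 (move_left tp))" unfolding holds_def by blast
qed

lemma holds_dec:
  assumes "holds (Suc n) tp"
  shows "scan (write_symbol 0 tp) = 0" "holds n (move_right (write_symbol 0 tp))"
proof -
  obtain k m where tp: "tp = (replicate k 0, replicate (Suc n) 1 @ replicate m 0)"
    using assms by (auto simp: holds_def)
  then show "scan (write_symbol 0 tp) = 0" by simp
  have "move_right (write_symbol 0 tp) = (replicate (Suc k) 0, replicate n 1 @ replicate m 0)"
    using tp by simp
  then show "holds n (move_right (write_symbol 0 tp))" unfolding holds_def by blast
qed

lemma represents_upd: "represents e T \<Longrightarrow> holds n tp \<Longrightarrow> represents (e(r := n)) (T(r := tp))"
  by (simp add: represents_def)

lemma represents_upd': "represents e T \<Longrightarrow> holds (e r) tp \<Longrightarrow> represents e (T(r := tp))"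
  by (simp add: represents_def)

lemma step_branch:
  assumes "installed M (branch q r q0 q1) q (Suc q)" "represents e T"
  obtains T' where "step M Os (q, T) = (if e r = 0 then q0 else q1, T')" "represents e T'"
    "next_instruction M (q, T) \<noteq> None"
proof -
  let ?a = "if e r = 0 then 0 else 1 :: nat"
  have h: "holds (e r) (T r)" using assms(2) by (simp add: represents_def)
  have n: "next_instruction M (q, T) = Some (q, r, ?a, Write ?a, if e r = 0 then q0 else q1)"
    using scan_holds[OF h] unfolding next_instruction_installed[OF assms(1) order_refl lessI]
    by (simp add: next_instruction_def branch_def)
  have "represents e (T(r := write_symbol ?a (T r)))"
    by (rule represents_upd'[OF assms(2) holds_write_scan[OF h]])
  then show ?thesis using n by (intro that[of "T(r := write_symbol ?a (T r))"]) (auto simp: step_def)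
qed

definition reaches :: "machine \<Rightarrow> (nat \<Rightarrow> nat) list \<Rightarrow> config \<Rightarrow> config \<Rightarrow> bool" where
  "reaches M Os c c' \<longleftrightarrow> (\<exists>s. (step M Os ^^ s) c = c')"

lemma reaches_trans: "reaches M Os a b \<Longrightarrow> reaches M Os b c \<Longrightarrow> reaches M Os a c"
  unfolding reaches_def by (metis funpow_add comp_apply)

lemma reaches_step: "step M Os a = b \<Longrightarrow> reaches M Os a b"
  unfolding reaches_def by (rule exI[of _ 1]) simp

lemma exec_compile:
  assumes "exec Os c e e'" "installed M (compile c q) q (q + len c)" "represents e T"
  shows "\<exists>T'. reaches M Os (q, T) (q + len c, T') \<and> represents e' T'"
  using assms
proof (induction arbitrary: q T rule: exec.induct)
  case (inc r e)
  have h: "holds (e r) (T r)" using inc by (simp add: represents_def)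
  let ?T1 = "T(r := move_left (T r))"
  let ?T2 = "T(r := write_symbol 1 (move_left (T r)))"
  have "next_instruction M (q, T) = Some (q, r, scan (T r), MoveLeft, q + 1)"
    using scan_holds[OF h] by (subst next_instruction_installed[OF inc(1)])
      (auto simp: next_instruction_def)
  then have 1: "step M Os (q, T) = (q + 1, ?T1)" by (simp add: step_def)
  have "next_instruction M (q + 1, ?T1) = Some (q + 1, r, 0, Write 1, q + 2)"
    using holds_inc(1)[OF h] by (subst next_instruction_installed[OF inc(1)])
      (auto simp: next_instruction_def)
  then have 2: "step M Os (q + 1, ?T1) = (q + 2, ?T2)" by (simp add: step_def)
  show ?case
    unfolding len.simps using reaches_trans[OF reaches_step[OF 1] reaches_step[OF 2]]
      represents_upd[OF inc(2) holds_inc(2)[OF h]] by blast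
next
  case (dec r e)
  have h: "holds (e r) (T r)" using dec by (simp add: represents_def)
  show ?case
  proof (cases "e r")
    case 0
    have "next_instruction M (q, T) = Some (q, r, 0, Write 0, q + 2)"
      using scan_holds[OF h] 0 by (subst next_instruction_installed[OF dec(1)])
        (auto simp: next_instruction_def)
    then have 1: "step M Os (q, T) = (q + 2, T(r := write_symbol 0 (T r)))" by (simp add: step_def)
    have "represents (e(r := e r - 1)) (T(r := write_symbol 0 (T r)))"
      using holds_write_scan[OF h] 0 by (intro represents_upd[OF dec(2)]) simp
    then show ?thesis unfolding len.simps using reaches_step[OF 1] by blast
  next
    case (Suc n)
    have h': "holds (Suc n) (T r)" using h Suc by simp
    let ?T1 = "T(r := write_symbol 0 (T r))"
    let ?T2 = "T(r := move_right (write_symbol 0 (T r)))"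
    have "next_instruction M (q, T) = Some (q, r, 1, Write 0, q + 1)"
      using scan_holds[OF h] Suc by (subst next_instruction_installed[OF dec(1)])
        (auto simp: next_instruction_def)
    then have 1: "step M Os (q, T) = (q + 1, ?T1)" by (simp add: step_def)
    have "next_instruction M (q + 1, ?T1) = Some (q + 1, r, 0, MoveRight, q + 2)"
      using holds_dec(1)[OF h'] by (subst next_instruction_installed[OF dec(1)])
        (auto simp: next_instruction_def)
    then have 2: "step M Os (q + 1, ?T1) = (q + 2, ?T2)" by (simp add: step_def)
    show ?thesis
      unfolding len.simps using reaches_trans[OF reaches_step[OF 1] reaches_step[OF 2]]
        represents_upd[OF dec(2) holds_dec(2)[OF h']] unfolding Suc diff_Suc_1 by blast
  qed
next
  case (ask i r e)
  have h: "holds (e r) (T r)" using ask by (simp add: represents_def)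
  have "next_instruction M (q, T) = Some (q, r, scan (T r), Query i, q + 1)"
    using scan_holds[OF h] by (subst next_instruction_installed[OF ask(1)])
      (auto simp: next_instruction_def)
  then have 1: "step M Os (q, T) = (q + 1, T(r := unary_tape (answer Os i (e r))))"
    using holds_number[OF h] by (simp add: step_def answer_def)
  show ?case
    unfolding len.simps using reaches_step[OF 1] represents_upd[OF ask(2) holds_unary] by blast
next
  case (seq c e e1 d e2)
  note i1 = installed_Seq(1)[OF seq.prems(1)] and i2 = installed_Seq(2)[OF seq.prems(1)]
  obtain T1 where 1: "reaches M Os (q, T) (q + len c, T1)" "represents e1 T1"
    using seq.IH(1)[OF i1 seq.prems(2)] by blast
  obtain T2 where 2: "reaches M Os (q + len c, T1) (q + len c + len d, T2)" "represents e2 T2"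
    using seq.IH(2)[OF i2 1(2)] by blast
  show ?case using reaches_trans[OF 1(1) 2(1)] 2(2) by (auto simp: add.assoc)
next
  case (cond1 e r c e1 d)
  note i0 = installed_Cond(1)[OF cond1.prems(1)] and i1 = installed_Cond(2)[OF cond1.prems(1)]
    and i2 = installed_Cond(3)[OF cond1.prems(1)]
  obtain T0 where 0: "step M Os (q, T) = (q + 1, T0)" "represents e T0"
    using step_branch[OF i0 cond1.prems(2), of Os] cond1.hyps(1) by auto
  obtain T1 where 1: "reaches M Os (q + 1, T0) (q + 1 + len c, T1)" "represents e1 T1"
    using cond1.IH[OF i1 0(2)] by blast
  obtain T2 where 2: "step M Os (q + 1 + len c, T1) = (q + len c + len d + 2, T2)" "represents e1 T2"
    using step_branch[OF i2 1(2), of Os] by auto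
  show ?case
    using reaches_trans[OF reaches_trans[OF reaches_step[OF 0(1)] 1(1)] reaches_step[OF 2(1)]] 2(2)
    by (auto simp: add.assoc)
next
  case (cond0 e r d e1 c)
  note i0 = installed_Cond(1)[OF cond0.prems(1)] and i1 = installed_Cond(4)[OF cond0.prems(1)]
  obtain T0 where 0: "step M Os (q, T) = (q + len c + 2, T0)" "represents e T0"
    using step_branch[OF i0 cond0.prems(2), of Os] cond0.hyps(1) by auto
  obtain T1 where 1: "reaches M Os (q + len c + 2, T0) (q + len c + 2 + len d, T1)" "represents e1 T1"
    using cond0.IH[OF i1 0(2)] by blast
  show ?case
    using reaches_trans[OF reaches_step[OF 0(1)] 1(1)] 1(2) by (auto simp: ac_simps)
next
  case (while0 e r c)
  note i0 = installed_While(1)[OF while0.prems(1)]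
  obtain T0 where 0: "step M Os (q, T) = (q + len c + 2, T0)" "represents e T0"
    using step_branch[OF i0 while0.prems(2), of Os] while0.hyps(1) by auto
  show ?case using reaches_step[OF 0(1)] 0(2) by auto
next
  case (while1 e r c e1 e2)
  note i0 = installed_While(1)[OF while1.prems(1)] and i1 = installed_While(2)[OF while1.prems(1)]
    and i2 = installed_While(3)[OF while1.prems(1)]
  obtain T0 where 0: "step M Os (q, T) = (q + 1, T0)" "represents e T0"
    using step_branch[OF i0 while1.prems(2), of Os] while1.hyps(1) by auto
  obtain T1 where 1: "reaches M Os (q + 1, T0) (q + 1 + len c, T1)" "represents e1 T1"
    using while1.IH(1)[OF i1 0(2)] by blast
  obtain T2 where 2: "step M Os (q + 1 + len c, T1) = (q, T2)" "represents e1 T2"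
    using step_branch[OF i2 1(2), of Os] by auto
  obtain T3 where 3: "reaches M Os (q, T2) (q + len (While r c), T3)" "represents e2 T3"
    using while1.IH(2)[OF while1.prems(1) 2(2)] by blast
  show ?case
    using reaches_trans[OF reaches_trans[OF reaches_trans[OF reaches_step[OF 0(1)] 1(1)]
      reaches_step[OF 2(1)]] 3(1)] 3(2) by blast
qed

text \<open>Big-step execution is silent on divergence. A halted configuration is a fixed point of
  \<open>step\<close>, so a run that keeps coming back to \<open>P\<close> after at least one step
  never meets one.\<close>

lemma never_halts:
  assumes "\<And>c. P c \<Longrightarrow> \<not> halted M c"
    and "\<And>c. P c \<Longrightarrow> \<exists>c'. reaches M Os (step M Os c) c' \<and> P c'"
    and "P c"
  shows "\<not> halted M ((step M Os ^^ s) c)"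
  using \<open>P c\<close>
proof (induction s arbitrary: c rule: less_induct)
  case (less s)
  obtain t where t: "P ((step M Os ^^ Suc t) c)"
    using assms(2)[OF less.prems] unfolding reaches_def funpow_Suc_right comp_apply by blast
  show ?case
  proof
    assume h: "halted M ((step M Os ^^ s) c)"
    have stay: "(step M Os ^^ k) d = d" if "halted M d" for k d
      using that by (induction k) (auto simp: step_def halted_def)
    show False
    proof (cases "s \<le> Suc t")
      case True
      then have "(step M Os ^^ Suc t) c = (step M Os ^^ (Suc t - s)) ((step M Os ^^ s) c)"
        by (metis funpow_add comp_apply le_add_diff_inverse2)
      then show False using stay[OF h] assms(1)[OF t] h by metis
    next
      case False
      then have "(step M Os ^^ s) c = (step M Os ^^ (s - Suc t)) ((step M Os ^^ Suc t) c)"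
        by (metis funpow_add comp_apply le_add_diff_inverse2 nat_le_linear)
      then show False using less.IH[OF _ t, of "s - Suc t"] False h by auto
    qed
  qed
qed

lemma while_diverges:
  assumes "installed M (compile (While r c) q) q (q + len (While r c))"
    and "\<And>e. I e \<Longrightarrow> e r \<noteq> 0 \<and> (\<exists>e'. exec Os c e e' \<and> I e')"
    and "I e" "represents e T"
  shows "\<not> halted M ((step M Os ^^ s) (q, T))"
proof -
  note i0 = installed_While(1)[OF assms(1)] and i1 = installed_While(2)[OF assms(1)]
    and i2 = installed_While(3)[OF assms(1)]
  let ?P = "\<lambda>d. \<exists>e T. d = (q, T) \<and> I e \<and> represents e T"
  show ?thesis
  proof (rule never_halts[of ?P])
    fix d assume "?P d"
    then obtain e T where d: "d = (q, T)" "I e" "represents e T" by blast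
    obtain T0 where T0: "step M Os (q, T) = (if e r = 0 then q + len c + 2 else q + 1, T0)"
      "represents e T0" "next_instruction M (q, T) \<noteq> None"
      using step_branch[OF i0 d(3)] by blast
    have 0: "step M Os (q, T) = (q + 1, T0)" "represents e T0" "\<not> halted M (q, T)"
      using T0 assms(2)[OF d(2)] by (simp_all add: halted_def)
    show "\<not> halted M d" using 0(3) by (simp add: d)
    obtain e1 where e1: "exec Os c e e1" "I e1" using assms(2)[OF d(2)] by blast
    obtain T1 where 1: "reaches M Os (q + 1, T0) (q + 1 + len c, T1)" "represents e1 T1"
      using exec_compile[OF e1(1) i1 0(2)] by blast
    obtain T2 where 2: "step M Os (q + 1 + len c, T1) = (q, T2)" "represents e1 T2"
      using step_branch[OF i2 1(2), of Os] by auto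
    show "\<exists>d'. reaches M Os (step M Os d) d' \<and> ?P d'"
      using reaches_trans[OF 1(1) reaches_step[OF 2(1)]] 2(2) e1(2) 0(1) d(1) by auto
  qed (use assms in blast)
qed

lemma exec_eq: "exec Os c e e' \<Longrightarrow> e' = e'' \<Longrightarrow> exec Os c e e''"
  by simp

lemma exec_while:
  assumes "\<And>i. i < n \<Longrightarrow> G i r \<noteq> 0 \<and> exec Os c (G i) (G (Suc i))" "G n r = 0"
  shows "exec Os (While r c) (G 0) (G n)"
  using assms
proof (induction n arbitrary: G)
  case 0
  then show ?case by (simp add: while0)
next
  case (Suc n)
  have "exec Os (While r c) (G (Suc 0)) (G (Suc n))"
    using Suc.IH[of "\<lambda>i. G (Suc i)"] Suc.prems by auto
  then show ?case using Suc.prems(1)[of 0] while1 by auto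
qed

lemma exec_while_from:
  assumes "G 0 = e" "\<And>i. i < n \<Longrightarrow> G i r \<noteq> 0 \<and> exec Os c (G i) (G (Suc i))" "G n r = 0"
    and "G n = e'"
  shows "exec Os (While r c) e e'"
  using exec_while[of n G, OF assms(2,3)] assms(1,4) by blast

section \<open>Register macros and the Cantor pairing\<close>

definition clear :: "nat \<Rightarrow> com" where
  "clear r = While r (Dec r)"

lemma exec_clear: "exec Os (clear r) e (e(r := 0))"
  unfolding clear_def
  by (rule exec_while_from[where G = "\<lambda>i. e(r := e r - i)" and n = "e r"])
    (auto intro!: exec_eq[OF dec])

definition move :: "nat \<Rightarrow> nat \<Rightarrow> com" where
  "move a b = While a (Seq (Dec a) (Inc b))"

lemma exec_move:
  assumes "a \<noteq> b"
  shows "exec Os (move a b) e (e(a := 0, b := e b + e a))"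
  unfolding move_def
  by (rule exec_while_from[where G = "\<lambda>i. e(a := e a - i, b := e b + i)" and n = "e a"])
    (use assms in \<open>auto intro!: exec_eq[OF seq[OF dec inc]]\<close>)

definition spread :: "nat \<Rightarrow> nat \<Rightarrow> nat \<Rightarrow> com" where
  "spread a b c = While a (Seq (Dec a) (Seq (Inc b) (Inc c)))"

lemma exec_spread:
  assumes "a \<noteq> b" "a \<noteq> c" "b \<noteq> c"
  shows "exec Os (spread a b c) e (e(a := 0, b := e b + e a, c := e c + e a))"
  unfolding spread_def
  by (rule exec_while_from[where G = "\<lambda>i. e(a := e a - i, b := e b + i, c := e c + i)" and n = "e a"])
    (use assms in \<open>auto intro!: exec_eq[OF seq[OF dec seq[OF inc inc]]]\<close>)

definition copy :: "nat \<Rightarrow> nat \<Rightarrow> nat \<Rightarrow> com" where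
  "copy a b t = Seq (spread a b t) (move t a)"

lemma exec_copy:
  assumes "a \<noteq> b" "a \<noteq> t" "b \<noteq> t" "e t = 0"
  shows "exec Os (copy a b t) e (e(b := e b + e a))"
  unfolding copy_def
  by (rule exec_eq[OF seq[OF exec_spread exec_move]]) (use assms in auto)

text \<open>\<open>prod_encode (a, b)\<close> is \<open>triangle (a + b) + a\<close>. With
  \<open>a\<close> in \<open>k + 2\<close> and \<open>b\<close> in \<open>k + 1\<close>,
  \<open>spread\<close> leaves \<open>a + b\<close> in \<open>k + 1\<close> and \<open>a\<close> in
  \<open>k\<close>; the loop adds \<open>a + b\<close>, \<open>a + b - 1\<close>, down to 1 to the
  latter.\<close>

definition pack :: "nat \<Rightarrow> com" where
  "pack k = Seq (spread (k + 2) (k + 1) k) (While (k + 1) (Seq (copy (k + 1) k (k + 2)) (Dec (k + 1))))"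

lemma exec_triangle:
  assumes "e (k + 2) = 0"
  shows "exec Os (While (k + 1) (Seq (copy (k + 1) k (k + 2)) (Dec (k + 1)))) e
    (e(k := e k + triangle (e (k + 1)), k + 1 := 0))"
  using assms
proof (induction "e (k + 1)" arbitrary: e)
  case 0
  then show ?case by (intro exec_eq[OF while0]) auto
next
  case (Suc n)
  let ?e = "e(k := e k + Suc n, k + 1 := n)"
  have "exec Os (Seq (copy (k + 1) k (k + 2)) (Dec (k + 1))) e ?e"
    by (rule exec_eq[OF seq[OF exec_copy dec]]) (use Suc(2)[symmetric] Suc(3) in auto)
  moreover have "exec Os (While (k + 1) (Seq (copy (k + 1) k (k + 2)) (Dec (k + 1)))) ?e
      (e(k := e k + triangle (e (k + 1)), k + 1 := 0))"
    by (rule exec_eq[OF Suc(1)[of ?e]]) (use Suc(2)[symmetric] Suc(3) in auto)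
  ultimately show ?case
    using Suc(2) by (intro while1[of e "k + 1"]) auto
qed

lemma exec_pack:
  assumes "e k = 0"
  shows "exec Os (pack k) e (e(k := prod_encode (e (k + 2), e (k + 1)), k + 1 := 0, k + 2 := 0))"
  unfolding pack_def
  by (rule exec_eq[OF seq[OF exec_spread exec_triangle]])
    (use assms in \<open>auto simp: prod_encode_def add.commute\<close>)

text \<open>Cantor's enumeration moves to the next point of the diagonal or to the start of the next
  diagonal. Counting up to \<open>n\<close> by this rule decodes \<open>n\<close>, which is what
  \<open>unpack\<close> does.\<close>

lemma prod_decode_Suc:
  "prod_decode (Suc n) = (if snd (prod_decode n) = 0 then (0, Suc (fst (prod_decode n)))
     else (Suc (fst (prod_decode n)), snd (prod_decode n) - 1))"
proof -
  obtain a b where ab: "prod_decode n = (a, b)" by fastforce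
  then have n: "n = prod_encode (a, b)" by (metis prod_decode_inverse)
  have "prod_encode (if b = 0 then (0, Suc a) else (Suc a, b - 1)) = Suc n"
    by (cases b) (auto simp: n prod_encode_def)
  then show ?thesis unfolding ab by (metis fst_conv snd_conv prod_encode_inverse)
qed

definition unpack :: "nat \<Rightarrow> com" where
  "unpack k = Seq (move k (k + 2)) (While (k + 2) (Seq (Dec (k + 2))
     (Cond (k + 1) (Seq (Dec (k + 1)) (Inc k)) (Seq (move k (k + 1)) (Inc (k + 1))))))"

lemma exec_unpack:
  assumes "e (k + 1) = 0" "e (k + 2) = 0"
  shows "exec Os (unpack k) e (e(k := fst (prod_decode (e k)), k + 1 := snd (prod_decode (e k))))"
proof -
  define G where "G i = e(k := fst (prod_decode i), k + 1 := snd (prod_decode i), k + 2 := e k - i)"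
    for i
  have pd0: "prod_decode 0 = (0, 0)"
    by (simp add: prod_decode_def prod_decode_aux.simps)
  have m: "exec Os (move k (k + 2)) e (G 0)"
    by (rule exec_eq[OF exec_move]) (use assms in \<open>auto simp: G_def pd0 fun_eq_iff\<close>)
  have w: "exec Os (While (k + 2) (Seq (Dec (k + 2))
     (Cond (k + 1) (Seq (Dec (k + 1)) (Inc k)) (Seq (move k (k + 1)) (Inc (k + 1)))))) (G 0) (G (e k))"
  proof (rule exec_while)
    fix i assume i: "i < e k"
    have "exec Os (Seq (Dec (k + 2))
     (Cond (k + 1) (Seq (Dec (k + 1)) (Inc k)) (Seq (move k (k + 1)) (Inc (k + 1))))) (G i) (G (Suc i))"
    proof (cases "snd (prod_decode i) = 0")
      case True
      show ?thesis
        by (rule exec_eq[OF seq[OF dec cond0[OF _ seq[OF exec_move inc]]]])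
          (use True i in \<open>auto simp: G_def prod_decode_Suc fun_eq_iff\<close>)
    next
      case False
      show ?thesis
        by (rule exec_eq[OF seq[OF dec cond1[OF _ seq[OF dec inc]]]])
          (use False i in \<open>auto simp: G_def prod_decode_Suc fun_eq_iff\<close>)
    qed
    then show "G i (k + 2) \<noteq> 0 \<and> exec Os (Seq (Dec (k + 2))
     (Cond (k + 1) (Seq (Dec (k + 1)) (Inc k)) (Seq (move k (k + 1)) (Inc (k + 1))))) (G i) (G (Suc i))"
      using i by (simp add: G_def)
  qed (simp add: G_def)
  show ?thesis unfolding unpack_def
    by (rule exec_eq[OF seq[OF m w]]) (use assms in \<open>auto simp: G_def fun_eq_iff\<close>)
qed

section \<open>Primitive recursive functionals\<close>

type_synonym functional = "(nat \<Rightarrow> nat) list \<Rightarrow> nat \<Rightarrow> nat"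

text \<open>Registers above \<open>k\<close> are scratch space and must be left empty again; those
  below \<open>k\<close> are untouched, so a composite program can keep intermediate values
  there.\<close>

definition implements :: "functional \<Rightarrow> com \<Rightarrow> nat \<Rightarrow> bool" where
  "implements F c k \<longleftrightarrow>
     (\<forall>Os e. (\<forall>j>k. e j = 0) \<longrightarrow> exec Os c e (e(k := F Os (e k))))"

definition pr :: "functional \<Rightarrow> bool" where
  "pr F \<longleftrightarrow> (\<forall>k. \<exists>c. implements F c k)"

definition pair :: "nat \<Rightarrow> nat \<Rightarrow> nat" where
  "pair a b = prod_encode (a, b)"

definition pfst :: "nat \<Rightarrow> nat" where
  "pfst n = fst (prod_decode n)"

definition psnd :: "nat \<Rightarrow> nat" where
  "psnd n = snd (prod_decode n)"

lemma pfst_pair [simp]: "pfst (pair a b) = a"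
  by (simp add: pfst_def pair_def)

lemma psnd_pair [simp]: "psnd (pair a b) = b"
  by (simp add: psnd_def pair_def)

lemma pair_inject [simp]: "pair a b = pair c d \<longleftrightarrow> a = c \<and> b = d"
  by (simp add: pair_def)

lemma pair_collapse [simp]: "pair (pfst n) (psnd n) = n"
  by (simp add: pfst_def psnd_def pair_def)

lemma prI: "(\<And>k. implements F (c k) k) \<Longrightarrow> pr F"
  unfolding pr_def by blast

lemma pr_id: "pr (\<lambda>Os x. x)"
proof (rule prI)
  fix k show "implements (\<lambda>Os x. x) (Seq (Inc k) (Dec k)) k"
    unfolding implements_def by (auto intro!: exec_eq[OF seq[OF inc dec]])
qed

lemma implementsD:
  "implements F c k \<Longrightarrow> (\<And>j. j > k \<Longrightarrow> e j = 0) \<Longrightarrow> e' = e(k := F Os (e k)) \<Longrightarrow> exec Os c e e'"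
  unfolding implements_def by blast

lemma pr_comp:
  assumes "pr f" "pr g"
  shows "pr (\<lambda>Os x. f Os (g Os x))"
  unfolding pr_def
proof
  fix k
  obtain c d where c: "implements f c k" and d: "implements g d k"
    using assms unfolding pr_def by metis
  have "implements (\<lambda>Os x. f Os (g Os x)) (Seq d c) k"
    unfolding implements_def
  proof (intro allI impI)
    fix Os and e :: "nat \<Rightarrow> nat"
    assume e: "\<forall>j>k. e j = 0"
    have "exec Os d e (e(k := g Os (e k)))" by (rule implementsD[OF d]) (use e in auto)
    moreover have "exec Os c (e(k := g Os (e k))) (e(k := f Os (g Os (e k))))"
      by (rule implementsD[OF c]) (use e in auto)
    ultimately show "exec Os (Seq d c) e (e(k := f Os (g Os (e k))))" by (rule seq)
  qed
  then show "\<exists>c. implements (\<lambda>Os x. f Os (g Os x)) c k" by blast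
qed

lemma pr_0: "pr (\<lambda>Os x. 0)"
  by (rule prI[of _ clear]) (simp add: implements_def exec_clear)

lemma pr_Suc:
  assumes "pr f"
  shows "pr (\<lambda>Os x. Suc (f Os x))"
proof -
  have "pr (\<lambda>Os. Suc)" by (rule prI[of _ Inc]) (simp add: implements_def inc)
  from pr_comp[OF this assms] show ?thesis .
qed

lemma pr_const: "pr (\<lambda>Os x. n)"
  by (induction n) (simp_all add: pr_0 pr_Suc)

lemma pr_answer:
  assumes "pr f"
  shows "pr (\<lambda>Os x. answer Os i (f Os x))"
proof -
  have "pr (\<lambda>Os. answer Os i)" by (rule prI[of _ "Ask i"]) (simp add: implements_def ask)
  from pr_comp[OF this assms] show ?thesis .
qed

lemma pr_fst:
  assumes "pr f"
  shows "pr (\<lambda>Os x. pfst (f Os x))"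
proof -
  have "implements (\<lambda>Os. pfst) (Seq (unpack k) (clear (k + 1))) k" for k
    unfolding implements_def
    by (auto intro!: exec_eq[OF seq[OF exec_unpack exec_clear]] simp: pfst_def)
  then have "pr (\<lambda>Os. pfst)" by (rule prI)
  from pr_comp[OF this assms] show ?thesis .
qed

lemma pr_snd:
  assumes "pr f"
  shows "pr (\<lambda>Os x. psnd (f Os x))"
proof -
  have "implements (\<lambda>Os. psnd) (Seq (unpack k) (Seq (clear k) (move (k + 1) k))) k" for k
    unfolding implements_def
    by (auto intro!: exec_eq[OF seq[OF exec_unpack seq[OF exec_clear exec_move]]] simp: psnd_def)
  then have "pr (\<lambda>Os. psnd)" by (rule prI)
  from pr_comp[OF this assms] show ?thesis .
qed

lemma pr_pair:
  assumes "pr f" "pr g"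
  shows "pr (\<lambda>Os x. pair (f Os x) (g Os x))"
  unfolding pr_def
proof
  fix k
  obtain c d where c: "implements f c (k + 2)" and d: "implements g d (k + 1)"
    using assms unfolding pr_def by metis
  let ?p = "Seq (copy k (k + 1) (k + 2)) (Seq d (Seq (copy k (k + 2) (k + 3)) (Seq c (Seq (clear k) (pack k)))))"
  have "implements (\<lambda>Os x. pair (f Os x) (g Os x)) ?p k"
    unfolding implements_def
  proof (intro allI impI)
    fix Os and e :: "nat \<Rightarrow> nat"
    assume e: "\<forall>j>k. e j = 0"
    let ?x = "e k"
    let ?e1 = "e(k + 1 := ?x)"
    let ?e2 = "e(k + 1 := g Os ?x)"
    let ?e3 = "e(k + 1 := g Os ?x, k + 2 := ?x)"
    let ?e4 = "e(k + 1 := g Os ?x, k + 2 := f Os ?x)"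
    let ?e5 = "e(k := 0, k + 1 := g Os ?x, k + 2 := f Os ?x)"
    have "exec Os (copy k (k + 1) (k + 2)) e ?e1"
      by (rule exec_eq[OF exec_copy]) (use e in auto)
    moreover have "exec Os d ?e1 ?e2" by (rule implementsD[OF d]) (use e in auto)
    moreover have "exec Os (copy k (k + 2) (k + 3)) ?e2 ?e3"
      by (rule exec_eq[OF exec_copy]) (use e in auto)
    moreover have "exec Os c ?e3 ?e4" by (rule implementsD[OF c]) (use e in auto)
    moreover have "exec Os (clear k) ?e4 ?e5" by (rule exec_eq[OF exec_clear]) auto
    moreover have "exec Os (pack k) ?e5 (e(k := pair (f Os ?x) (g Os ?x)))"
      by (rule exec_eq[OF exec_pack]) (use e in \<open>auto simp: pair_def fun_eq_iff\<close>)
    ultimately show "exec Os ?p e (e(k := pair (f Os ?x) (g Os ?x)))"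
      by (intro seq)
  qed
  then show "\<exists>c. implements (\<lambda>Os x. pair (f Os x) (g Os x)) c k" by blast
qed

lemma pr_funpow:
  assumes "pr f"
  shows "pr (\<lambda>Os z. (f Os ^^ pfst z) (psnd z))"
  unfolding pr_def
proof
  fix k
  obtain c where c: "implements f c (k + 1)"
    using assms unfolding pr_def by metis
  let ?p = "Seq (unpack k) (Seq (While k (Seq (Dec k) c)) (move (k + 1) k))"
  have "implements (\<lambda>Os z. (f Os ^^ pfst z) (psnd z)) ?p k"
    unfolding implements_def
  proof (intro allI impI)
    fix Os and e :: "nat \<Rightarrow> nat"
    assume e: "\<forall>j>k. e j = 0"
    let ?n = "pfst (e k)" and ?v = "psnd (e k)"
    define G where "G i = e(k := ?n - i, k + 1 := (f Os ^^ i) ?v)" for i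
    have "exec Os (unpack k) e (G 0)"
      by (rule exec_eq[OF exec_unpack]) (use e in \<open>auto simp: G_def pfst_def psnd_def\<close>)
    moreover have "exec Os (While k (Seq (Dec k) c)) (G 0) (G ?n)"
    proof (rule exec_while)
      fix i assume i: "i < ?n"
      have "exec Os c ((G i)(k := G i k - 1)) (G (Suc i))"
        by (rule implementsD[OF c]) (use e in \<open>auto simp: G_def\<close>)
      then have "exec Os (Seq (Dec k) c) (G i) (G (Suc i))" by (rule seq[OF dec])
      then show "G i k \<noteq> 0 \<and> exec Os (Seq (Dec k) c) (G i) (G (Suc i))"
        using i by (simp add: G_def)
    qed (simp add: G_def)
    moreover have "exec Os (move (k + 1) k) (G ?n) (e(k := (f Os ^^ ?n) ?v))"
      by (rule exec_eq[OF exec_move]) (use e in \<open>auto simp: G_def\<close>)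
    ultimately show "exec Os ?p e (e(k := (f Os ^^ ?n) ?v))"
      by (intro seq)
  qed
  then show "\<exists>c. implements (\<lambda>Os z. (f Os ^^ pfst z) (psnd z)) c k" by blast
qed

lemma pr_iterate:
  assumes "pr n" "pr a" "pr f"
  shows "pr (\<lambda>Os x. (f Os ^^ n Os x) (a Os x))"
  using pr_comp[OF pr_funpow[OF assms(3)] pr_pair[OF assms(1,2)]] by simp

text \<open>The recursion is an iteration on \<open>pair x (pair k acc)\<close>. Here and in later
  closure rules a bound variable is handled by asking for computability of the body in one argument
  that pairs it with the outer \<open>x\<close>.\<close>

lemma pr_rec:
  assumes "pr n" "pr a" "pr (\<lambda>Os z. h Os (pfst z) (pfst (psnd z)) (psnd (psnd z)))"
  shows "pr (\<lambda>Os x. rec_nat (a Os x) (\<lambda>k acc. h Os x k acc) (n Os x))"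
proof -
  let ?s = "\<lambda>Os z. pair (pfst z) (pair (Suc (pfst (psnd z))) (h Os (pfst z) (pfst (psnd z)) (psnd (psnd z))))"
  have "((?s Os) ^^ m) (pair x (pair 0 (a Os x))) = pair x (pair m (rec_nat (a Os x) (\<lambda>k acc. h Os x k acc) m))"
    for Os x m
    by (induction m) auto
  then have *: "(\<lambda>Os x. rec_nat (a Os x) (\<lambda>k acc. h Os x k acc) (n Os x))
    = (\<lambda>Os x. psnd (psnd (((?s Os) ^^ n Os x) (pair x (pair 0 (a Os x))))))"
    by simp
  show ?thesis
    unfolding * by (intro pr_snd pr_iterate assms pr_pair pr_id pr_0 pr_fst pr_Suc)
qed

lemma pr_comp2:
  assumes "pr (\<lambda>Os z. f Os (pfst z) (psnd z))" "pr a" "pr b"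
  shows "pr (\<lambda>Os x. f Os (a Os x) (b Os x))"
  using pr_comp[OF assms(1) pr_pair[OF assms(2,3)]] by simp

lemma pr_comp3:
  assumes "pr (\<lambda>Os z. f Os (pfst z) (pfst (psnd z)) (psnd (psnd z)))" "pr a" "pr b" "pr c"
  shows "pr (\<lambda>Os x. f Os (a Os x) (b Os x) (c Os x))"
  using pr_comp[OF assms(1) pr_pair[OF assms(2) pr_pair[OF assms(3,4)]]] by simp

named_theorems pr_intros

declare pr_id [pr_intros] pr_const [pr_intros] pr_Suc [pr_intros] pr_answer [pr_intros]
  pr_fst [pr_intros] pr_snd [pr_intros] pr_pair [pr_intros]

lemma pr_add [pr_intros]:
  assumes "pr f" "pr g"
  shows "pr (\<lambda>Os x. f Os x + g Os x)"
proof -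
  have *: "a + b = rec_nat a (\<lambda>_ acc. Suc acc) b" for a b
    by (induction b) auto
  show ?thesis unfolding * by (intro pr_rec assms pr_intros)
qed

lemma pr_minus1:
  assumes "pr f"
  shows "pr (\<lambda>Os x. f Os x - 1)"
proof -
  have *: "a - 1 = rec_nat 0 (\<lambda>k _. k) a" for a :: nat
    by (cases a) auto
  show ?thesis unfolding * by (intro pr_rec assms pr_intros)
qed

lemma pr_minus [pr_intros]:
  assumes "pr f" "pr g"
  shows "pr (\<lambda>Os x. f Os x - g Os x)"
proof -
  have "a - b = rec_nat a (\<lambda>_ acc. acc - 1) b" for a b :: nat
    by (induction b) auto
  then have *: "f Os x - g Os x = rec_nat (f Os x) (\<lambda>_ acc. acc - 1) (g Os x)" for Os x .
  show ?thesis unfolding * by (intro pr_rec pr_minus1 assms pr_intros)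
qed

section \<open>Decidable predicates and bounded search\<close>

definition dec :: "((nat \<Rightarrow> nat) list \<Rightarrow> nat \<Rightarrow> bool) \<Rightarrow> bool" where
  "dec P \<longleftrightarrow> pr (\<lambda>Os x. of_bool (P Os x))"

lemma dec_eqI:
  assumes "pr f" "\<And>Os x. of_bool (P Os x) = f Os x"
  shows "dec P"
  using assms by (simp add: dec_def)

lemma dec_le [pr_intros]: "pr f \<Longrightarrow> pr g \<Longrightarrow> dec (\<lambda>Os x. f Os x \<le> g Os x)"
  by (rule dec_eqI[of "\<lambda>Os x. 1 - (f Os x - g Os x)"]) (intro pr_intros, auto)

lemma dec_less [pr_intros]: "pr f \<Longrightarrow> pr g \<Longrightarrow> dec (\<lambda>Os x. f Os x < g Os x)"
  unfolding less_eq_Suc_le by (intro pr_intros)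

lemma dec_not [pr_intros]: "dec P \<Longrightarrow> dec (\<lambda>Os x. \<not> P Os x)"
  by (rule dec_eqI[of "\<lambda>Os x. 1 - of_bool (P Os x)"]) (auto intro!: pr_intros simp: dec_def)

lemma dec_conj [pr_intros]: "dec P \<Longrightarrow> dec Q \<Longrightarrow> dec (\<lambda>Os x. P Os x \<and> Q Os x)"
  by (rule dec_eqI[of "\<lambda>Os x. (of_bool (P Os x) + of_bool (Q Os x)) - 1"])
    (auto intro!: pr_add pr_minus1 simp: dec_def simp del: One_nat_def)

lemma dec_disj [pr_intros]: "dec P \<Longrightarrow> dec Q \<Longrightarrow> dec (\<lambda>Os x. P Os x \<or> Q Os x)"
  using dec_not[OF dec_conj[OF dec_not dec_not]] by simp

lemma dec_eq [pr_intros]: "pr f \<Longrightarrow> pr g \<Longrightarrow> dec (\<lambda>Os x. f Os x = g Os x)"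
  unfolding eq_iff[of "_ :: nat"] by (intro pr_intros)

lemma pr_if [pr_intros]:
  assumes "dec P" "pr f" "pr g"
  shows "pr (\<lambda>Os x. if P Os x then f Os x else g Os x)"
proof -
  have *: "(if P Os x then f Os x else g Os x) =
      rec_nat (g Os x) (\<lambda>_ _. f Os x) (of_bool (P Os x))" for Os x
    by simp
  show ?thesis unfolding *
    by (intro pr_rec[where h = "\<lambda>Os x _ _. f Os x"] assms(1)[unfolded dec_def] assms(3)
        pr_comp[OF assms(2)] pr_intros)
qed

text \<open>The first nonzero value of \<open>P\<close> is returned, not its argument. It is stable
  under enlarging \<open>m\<close>, so that \<open>announced\<close> delivers a value that later
  moves cannot revise.\<close>

definition bfind :: "nat \<Rightarrow> (nat \<Rightarrow> nat) \<Rightarrow> nat" where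
  "bfind m P = rec_nat 0 (\<lambda>n acc. if acc \<noteq> 0 then acc else P n) m"

lemma bfind_0 [simp]: "bfind 0 P = 0"
  by (simp add: bfind_def)

lemma bfind_Suc [simp]: "bfind (Suc m) P = (if bfind m P \<noteq> 0 then bfind m P else P m)"
  by (simp add: bfind_def)

lemma bfind_nonzero: "bfind m P \<noteq> 0 \<longleftrightarrow> (\<exists>n<m. P n \<noteq> 0)"
  by (induction m) (auto simp: less_Suc_eq)

lemma bfind_SucD: "bfind m P = Suc v \<Longrightarrow> \<exists>n<m. P n = Suc v"
  by (induction m) (auto simp: less_Suc_eq split: if_splits)

lemma bfind_mono: "bfind m P \<noteq> 0 \<Longrightarrow> m \<le> m' \<Longrightarrow> bfind m' P = bfind m P"
  by (induction m') (auto simp: le_Suc_eq)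

lemma pr_bfind [pr_intros]:
  assumes "pr m" "pr (\<lambda>Os z. P Os (pfst z) (psnd z))"
  shows "pr (\<lambda>Os x. bfind (m Os x) (\<lambda>n. P Os x n))"
  unfolding bfind_def
  by (intro pr_rec assms pr_intros pr_comp2[where f = P, OF assms(2)])

lemma dec_ex [pr_intros]:
  assumes "pr m" "dec (\<lambda>Os z. P Os (pfst z) (psnd z))"
  shows "dec (\<lambda>Os x. \<exists>n<m Os x. P Os x n)"
proof -
  have *: "(\<exists>n<m Os x. P Os x n) \<longleftrightarrow> bfind (m Os x) (\<lambda>n. of_bool (P Os x n)) \<noteq> 0" for Os x
    unfolding bfind_nonzero by auto
  show ?thesis unfolding *
    by (intro pr_intros assms pr_bfind[where P = "\<lambda>Os x n. of_bool (P Os x n)"]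
        assms(2)[unfolded dec_def])
qed

lemma dec_all [pr_intros]:
  assumes "pr m" "dec (\<lambda>Os z. P Os (pfst z) (psnd z))"
  shows "dec (\<lambda>Os x. \<forall>n<m Os x. P Os x n)"
  using dec_not[OF dec_ex[OF assms(1) dec_not[OF assms(2)]]] by simp

lemma dec_even [pr_intros]:
  assumes "pr f"
  shows "dec (\<lambda>Os x. even (f Os x))"
proof -
  have "of_bool (even n) = rec_nat (1 :: nat) (\<lambda>_ acc. 1 - acc) n" for n :: nat
  proof (induction n)
    case (Suc n)
    have "rec_nat (1 :: nat) (\<lambda>_ acc. 1 - acc) (Suc n) = 1 - (of_bool (even n) :: nat)"
      unfolding Suc.IH by simp
    also have "\<dots> = of_bool (even (Suc n))" by (cases "even n") simp_all
    finally show ?case by (rule sym)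
  qed simp
  then show ?thesis unfolding dec_def by (simp only:) (intro pr_rec assms pr_intros)
qed

lemma pr_half [pr_intros]:
  assumes "pr f"
  shows "pr (\<lambda>Os x. f Os x div 2)"
proof -
  have *: "n div 2 = rec_nat 0 (\<lambda>k acc. if even k then acc else Suc acc) n" for n :: nat
    by (induction n) auto
  show ?thesis unfolding * by (intro pr_rec assms pr_intros)
qed

section \<open>Codes of lists\<close>

definition lcons :: "nat \<Rightarrow> nat \<Rightarrow> nat" where
  "lcons a l = Suc (pair a l)"

definition lhd :: "nat \<Rightarrow> nat" where
  "lhd l = pfst (l - 1)"

definition ltl :: "nat \<Rightarrow> nat" where
  "ltl l = psnd (l - 1)"

lemma list_decode_lcons [simp]: "list_decode (lcons a l) = a # list_decode l"
  by (simp add: lcons_def pair_def)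

lemma list_encode_Cons: "list_encode (a # xs) = lcons a (list_encode xs)"
  by (simp add: lcons_def pair_def)

lemma pair_0_0: "pair 0 0 = 0"
  by (simp add: pair_def prod_encode_def)

lemma pfst_0 [simp]: "pfst 0 = 0" and psnd_0 [simp]: "psnd 0 = 0"
  using pfst_pair[of 0 0] psnd_pair[of 0 0] unfolding pair_0_0 by auto

lemma lhd_lcons [simp]: "lhd (lcons a l) = a" and ltl_lcons [simp]: "ltl (lcons a l) = l"
  by (simp_all add: lcons_def lhd_def ltl_def)

lemma lhd_0 [simp]: "lhd 0 = 0" and ltl_0 [simp]: "ltl 0 = 0"
  by (simp_all add: lhd_def ltl_def)

lemma lcons_neq_0 [simp]: "lcons a l \<noteq> 0"
  by (simp add: lcons_def)

lemma list_code_cases: obtains "l = 0" | a l' where "l = lcons a l'"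
proof (cases l)
  case (Suc n)
  then have "l = lcons (pfst n) (psnd n)" by (simp add: lcons_def)
  then show ?thesis using that by blast
qed (use that in blast)

lemma list_decode_ltl: "list_decode (ltl l) = tl (list_decode l)"
  by (cases l rule: list_code_cases) auto

lemma list_decode_eq_Nil: "list_decode l = [] \<longleftrightarrow> l = 0"
  by (cases l rule: list_code_cases) auto

lemma list_decode_hd: "list_decode l \<noteq> [] \<Longrightarrow> hd (list_decode l) = lhd l"
  by (cases l rule: list_code_cases) auto

lemma length_list_decode: "length (list_decode l) \<le> l"
proof (induction l rule: less_induct)
  case (less l)
  show ?case
  proof (cases l rule: list_code_cases)
    case (2 a l')
    have "l' \<le> pair a l'" unfolding pair_def by (rule le_prod_encode_2)
    then have "l' < l" by (simp add: 2 lcons_def)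
    then show ?thesis using less[of l'] 2 by simp
  qed simp
qed

lemma pr_lcons [pr_intros]: "pr f \<Longrightarrow> pr g \<Longrightarrow> pr (\<lambda>Os x. lcons (f Os x) (g Os x))"
  unfolding lcons_def by (intro pr_intros)

lemma pr_lhd [pr_intros]: "pr f \<Longrightarrow> pr (\<lambda>Os x. lhd (f Os x))"
  unfolding lhd_def by (intro pr_intros)

lemma pr_ltl [pr_intros]: "pr f \<Longrightarrow> pr (\<lambda>Os x. ltl (f Os x))"
  unfolding ltl_def by (intro pr_intros)

lemma pr_fold [pr_intros]:
  assumes "pr l" "pr a" "pr (\<lambda>Os z. h Os (pfst z) (pfst (psnd z)) (psnd (psnd z)))"
  shows "pr (\<lambda>Os x. fold (\<lambda>b acc. h Os x b acc) (list_decode (l Os x)) (a Os x))"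
proof -
  \<comment> \<open>Each round pops one entry, and the state idles once the list is exhausted. A
    list is no longer than its code, so the code itself serves as the number of rounds.\<close>
  define s where "s g = (\<lambda>(_ :: nat) st. if pfst st = 0 then st
      else pair (ltl (pfst st)) (g (lhd (pfst st)) (psnd st)))" for g :: "nat \<Rightarrow> nat \<Rightarrow> nat"
  have s0: "rec_nat (pair 0 b) (s g) n = pair 0 b" for g n b
    by (induction n) (auto simp: s_def)
  have shift: "rec_nat st (s g) (Suc n) = rec_nat (s g 0 st) (s g) n" for g st n
    by (induction n) (auto simp: s_def)
  have s: "psnd (rec_nat (pair k b) (s g) n) = fold g (list_decode k) b"
    if "length (list_decode k) \<le> n" for g k b n
    using that
  proof (induction n arbitrary: k b)
    case 0
    then have "k = 0" by (simp add: list_decode_eq_Nil)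
    then show ?case by simp
  next
    case (Suc n)
    show ?case
    proof (cases k rule: list_code_cases)
      case 1
      then show ?thesis unfolding 1 s0 by simp
    next
      case (2 c k')
      then show ?thesis using Suc unfolding shift by (simp add: s_def)
    qed
  qed
  have *: "(\<lambda>Os x. fold (\<lambda>b acc. h Os x b acc) (list_decode (l Os x)) (a Os x)) =
    (\<lambda>Os x. psnd (rec_nat (pair (l Os x) (a Os x)) (s (\<lambda>b acc. h Os x b acc)) (l Os x)))"
    by (simp add: s length_list_decode)
  show ?thesis
    unfolding * unfolding s_def by (intro pr_intros pr_rec assms pr_comp3[where f = h, OF assms(3)])
qed

definition lrev :: "nat \<Rightarrow> nat" where
  "lrev l = list_encode (rev (list_decode l))"

lemma pr_lrev [pr_intros]:
  assumes "pr f"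
  shows "pr (\<lambda>Os x. lrev (f Os x))"
proof -
  have "fold lcons xs a = list_encode (rev xs @ list_decode a)" for xs a
    by (induction xs arbitrary: a) (simp_all add: list_encode_Cons)
  then have *: "lrev l = fold (\<lambda>b acc. lcons b acc) (list_decode l) 0" for l
    by (simp add: lrev_def)
  show ?thesis unfolding * by (intro pr_intros assms)
qed

lemma pr_foldr [pr_intros]:
  assumes "pr l" "pr a" "pr (\<lambda>Os z. h Os (pfst z) (pfst (psnd z)) (psnd (psnd z)))"
  shows "pr (\<lambda>Os x. foldr (\<lambda>b acc. h Os x b acc) (list_decode (l Os x)) (a Os x))"
proof -
  have *: "foldr g (list_decode k) = fold g (list_decode (lrev k))" for g :: "nat \<Rightarrow> nat \<Rightarrow> nat" and k
    by (simp add: lrev_def foldr_conv_fold)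
  show ?thesis unfolding * by (intro pr_intros assms)
qed

definition llen :: "nat \<Rightarrow> nat" where
  "llen l = length (list_decode l)"

lemma pr_llen [pr_intros]:
  assumes "pr f"
  shows "pr (\<lambda>Os x. llen (f Os x))"
proof -
  have *: "llen l = foldr (\<lambda>_ acc. Suc acc) (list_decode l) 0" for l
  proof -
    have "length xs = foldr (\<lambda>_ acc. Suc acc) xs 0" for xs :: "nat list"
      by (induction xs) auto
    then show ?thesis by (simp add: llen_def)
  qed
  show ?thesis unfolding * by (intro pr_intros assms)
qed

lemma list_decode_ltl_funpow: "list_decode ((ltl ^^ n) l) = drop n (list_decode l)"
  by (induction n) (auto simp: list_decode_ltl drop_Suc tl_drop)

lemma pr_ltl_funpow [pr_intros]: "pr n \<Longrightarrow> pr f \<Longrightarrow> pr (\<lambda>Os x. (ltl ^^ n Os x) (f Os x))"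
  by (intro pr_iterate pr_intros)

definition lnth :: "nat \<Rightarrow> nat \<Rightarrow> nat" where
  "lnth l n = lhd ((ltl ^^ n) l)"

lemma pr_lnth [pr_intros]: "pr f \<Longrightarrow> pr n \<Longrightarrow> pr (\<lambda>Os x. lnth (f Os x) (n Os x))"
  unfolding lnth_def by (intro pr_intros)

lemma lnth_eq: "lnth l n = (if n < llen l then list_decode l ! n else 0)"
proof (cases "n < llen l")
  case True
  then have "list_decode ((ltl ^^ n) l) \<noteq> []"
    by (simp add: list_decode_ltl_funpow llen_def)
  then show ?thesis
    using True list_decode_hd unfolding lnth_def list_decode_ltl_funpow
    by (metis hd_drop_conv_nth list_decode_ltl_funpow llen_def)
next
  case False
  then have "list_decode ((ltl ^^ n) l) = []"
    by (simp add: list_decode_ltl_funpow llen_def)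
  then show ?thesis using False by (simp add: lnth_def list_decode_eq_Nil)
qed

lemma halted_stays: "halted M c \<Longrightarrow> (step M Os ^^ k) c = c"
  by (induction k) (auto simp: step_def halted_def)

lemma halts_reaches:
  assumes "reaches M Os (initial_config i) c"
  shows "halts M Os i \<longleftrightarrow> (\<exists>s. halted M ((step M Os ^^ s) c))"
proof -
  obtain t where t: "(step M Os ^^ t) (initial_config i) = c"
    using assms by (auto simp: reaches_def)
  have plus: "(step M Os ^^ (s + t)) (initial_config i) = (step M Os ^^ s) c" for s
    using t by (simp add: funpow_add)
  show ?thesis
  proof
    assume "halts M Os i"
    then obtain s where s: "halted M ((step M Os ^^ s) (initial_config i))"
      by (auto simp: halts_def run_def)
    have "(step M Os ^^ (t + s)) (initial_config i) = (step M Os ^^ s) (initial_config i)"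
      using halted_stays[OF s] by (simp add: funpow_add)
    then show "\<exists>s. halted M ((step M Os ^^ s) c)"
      using s plus[of s] by (metis add.commute)
  next
    assume "\<exists>s. halted M ((step M Os ^^ s) c)"
    then show "halts M Os i" unfolding halts_def run_def using plus by metis
  qed
qed

lemma halted_no_state: "(\<And>ins. ins \<in> set M \<Longrightarrow> fst ins \<noteq> q) \<Longrightarrow> halted M (q, T)"
  by (force simp: halted_def next_instruction_def find_None_iff)

lemma represents_initial:
  "\<exists>T. initial_config n = (0, T) \<and> represents ((\<lambda>_. 0)(0 := n)) T"
proof -
  have "holds 0 ([], [])" using holds_unary[of 0] by (simp add: unary_tape_def)
  then show ?thesis by (auto simp: initial_config_def represents_def holds_unary)
qed

theorem computable_pr:
  assumes "pr F"
  shows "computable (F [])"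
proof -
  obtain c where c: "implements F c 0" using assms by (auto simp: pr_def)
  let ?M = "compile c 0"
  show ?thesis unfolding computable_def
  proof (intro exI[of _ ?M] allI)
    fix n
    obtain T where T: "initial_config n = (0, T)" "represents ((\<lambda>_. 0)(0 := n)) T"
      using represents_initial by blast
    have "exec [] c ((\<lambda>_. 0)(0 := n)) ((\<lambda>_. 0)(0 := F [] n))"
      by (rule implementsD[OF c]) auto
    from exec_compile[OF this _ T(2), of ?M 0]
    obtain T' where T': "reaches ?M [] (0, T) (0 + len c, T')"
        "represents ((\<lambda>_. 0)(0 := F [] n)) T'"
      by (auto simp: installed_def)
    obtain s where s: "run ?M [] n s = (len c, T')"
      using T'(1) T(1) by (auto simp: reaches_def run_def)
    have "halted ?M (len c, T')"
      using compile_states by (intro halted_no_state) fastforce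
    moreover have "tape_number (T' 0) = F [] n"
      using T'(2)[unfolded represents_def, rule_format, of 0] holds_number by simp
    ultimately show "\<exists>s. halted ?M (run ?M [] n s) \<and> tape_number (snd (run ?M [] n s) 0) = F [] n"
      by (intro exI[of _ s]) (simp add: s)
  qed
qed

section \<open>Parametrized search machines\<close>

fun action_code :: "action \<Rightarrow> nat" where
  "action_code MoveLeft = 0"
| "action_code MoveRight = 1"
| "action_code (Write b) = Suc (Suc (b + b))"
| "action_code (Query i) = Suc (Suc (Suc (i + i)))"

fun instruction_code :: "instruction \<Rightarrow> nat" where
  "instruction_code (q, t, a, act, q') = pair q (pair t (pair a (pair (action_code act) q')))"

lemma action_decode_code: "action_decode (action_code act) = act"
  by (cases act) auto

lemma instruction_decode_code: "instruction_decode (instruction_code ins) = ins"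
  by (cases ins) (simp add: instruction_decode_def pair_def action_decode_code)

lemma machine_decode_code: "machine_decode (list_encode (map instruction_code M)) = M"
  by (simp add: machine_decode_def comp_def instruction_decode_code)

primrec incs :: "nat \<Rightarrow> nat \<Rightarrow> machine" where
  "incs N 0 = []"
| "incs N (Suc c) = compile (Inc 1) (N + (c + c)) @ incs N c"

lemma incs_split:
  "j < c \<Longrightarrow> \<exists>A B. incs N c = A @ compile (Inc 1) (N + (j + j)) @ B \<and>
    (\<forall>ins\<in>set A. N + (j + j) + 2 \<le> fst ins) \<and> (\<forall>ins\<in>set B. N \<le> fst ins \<and> fst ins < N + (j + j))"
proof (induction c)
  case (Suc c)
  have low: "\<forall>ins\<in>set (incs N d). N \<le> fst ins \<and> fst ins < N + (d + d)" for d
    by (induction d) auto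
  show ?case
  proof (cases "j = c")
    case True
    then show ?thesis using low[of c] by (intro exI[of _ "[]"] exI[of _ "incs N c"]) simp
  next
    case False
    then obtain A B where "incs N c = A @ compile (Inc 1) (N + (j + j)) @ B"
      "\<forall>ins\<in>set A. N + (j + j) + 2 \<le> fst ins" "\<forall>ins\<in>set B. N \<le> fst ins \<and> fst ins < N + (j + j)"
      using Suc by auto
    then show ?thesis using False Suc.prems
      by (intro exI[of _ "compile (Inc 1) (N + (c + c)) @ A"] exI[of _ B]) auto
  qed
qed simp

text \<open>The s-m-n construction: \<open>c\<close> is built into the code as \<open>c\<close>
  increments of register 1. Tape 1 is blank at the start, so \<open>(0, 1, 0, Write 0, N)\<close>
  jumps from the fixed start state to the increments. State \<open>len p + 1\<close> is kept free of
  instructions so that \<open>p\<close> halts there, whence \<open>N = len p + 2\<close>.\<close>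

definition with_parameter :: "com \<Rightarrow> nat \<Rightarrow> machine" where
  "with_parameter p c = (let N = len p + 2 in
     incs N c @ branch (N + (c + c)) 1 1 1 @ (0, 1, 0, Write 0, N) # compile p 1)"

lemma pr_with_parameter:
  "pr (\<lambda>_ c. list_encode (map instruction_code (with_parameter p c)))"
proof -
  define N where "N = len p + 2"
  define K where "K = list_encode (map instruction_code ((0, 1, 0, Write 0, N) # compile p 1))"
  define i where "i q a act q' = pair q (pair 1 (pair a (pair (action_code act) q')))" for q a act q'
  have *: "list_encode (map instruction_code (with_parameter p c)) =
    rec_nat (lcons (i (N + (c + c)) 0 (Write 0) 1) (lcons (i (N + (c + c)) 1 (Write 1) 1) K))
      (\<lambda>j acc. lcons (i (N + (j + j)) 0 MoveLeft (N + (j + j) + 1))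
        (lcons (i (N + (j + j)) 1 MoveLeft (N + (j + j) + 1))
        (lcons (i (N + (j + j) + 1) 0 (Write 1) (N + (j + j) + 2)) acc))) c" for c
  proof -
    have incs: "list_encode (map instruction_code (incs N c @ M)) =
      rec_nat (list_encode (map instruction_code M))
      (\<lambda>j acc. lcons (i (N + (j + j)) 0 MoveLeft (N + (j + j) + 1))
        (lcons (i (N + (j + j)) 1 MoveLeft (N + (j + j) + 1))
        (lcons (i (N + (j + j) + 1) 0 (Write 1) (N + (j + j) + 2)) acc))) c" for M
      by (induction c) (simp_all add: list_encode_Cons i_def del: list_encode.simps)
    have "with_parameter p c = incs N c @ branch (N + (c + c)) 1 1 1 @ (0, 1, 0, Write 0, N) # compile p 1"
      by (simp add: with_parameter_def Let_def N_def)
    then show ?thesis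
      by (simp only: incs) (simp add: branch_def i_def list_encode_Cons K_def del: list_encode.simps)
  qed
  show ?thesis unfolding * i_def by (intro pr_rec pr_intros)
qed

lemma with_parameter_start:
  fixes p c
  defines "M \<equiv> with_parameter p c"
  shows "\<exists>T. reaches M Os (initial_config n) (1, T) \<and> represents ((\<lambda>_. 0)(0 := n, 1 := c)) T"
    and "installed M (compile p 1) 1 (1 + len p)"
    and "halted M (1 + len p, T)"
proof -
  define N where "N = len p + 2"
  have M: "M = incs N c @ branch (N + (c + c)) 1 1 1 @ (0, 1, 0, Write 0, N) # compile p 1"
    by (simp add: M_def with_parameter_def Let_def N_def)
  have inc_ge: "ins \<in> set (incs q d) \<Longrightarrow> q \<le> fst ins \<and> fst ins < q + (d + d)" for q d ins
    by (induction d) auto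
  have all: "installed M M 0 m" for m by (simp add: installed_def)
  show "halted M (1 + len p, T)"
  proof (rule halted_no_state)
    fix ins assume "ins \<in> set M"
    moreover have "1 + len p < N" by (simp add: N_def)
    ultimately show "fst ins \<noteq> 1 + len p"
      by (auto simp: M branch_def dest!: inc_ge compile_states)
  qed
  have "installed M ((incs N c @ branch (N + (c + c)) 1 1 1 @ [(0, 1, 0, Write 0, N)]) @ compile p 1 @ [])
      0 (1 + len p)"
    using all by (simp add: M)
  then show "installed M (compile p 1) 1 (1 + len p)"
    by (rule installed_sub) (auto simp: N_def branch_def dest!: inc_ge)
  obtain T0 where T0: "initial_config n = (0, T0)" "represents ((\<lambda>_. 0)(0 := n)) T0"
    using represents_initial by blast
  have i0: "installed M [(0, 1, 0, Write 0, N)] 0 1"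
  proof -
    have "installed M ((incs N c @ branch (N + (c + c)) 1 1 1) @ [(0, 1, 0, Write 0, N)] @ compile p 1) 0 1"
      using all by (simp add: M)
    then show ?thesis
      by (rule installed_sub) (auto simp: N_def branch_def dest!: inc_ge compile_states)
  qed
  have h1: "holds 0 (T0 1)" using T0(2)[unfolded represents_def, rule_format, of 1] by simp
  have "next_instruction M (0, T0) = Some (0, 1, 0, Write 0, N)"
    using scan_holds[OF h1] by (subst next_instruction_installed[OF i0]) (auto simp: next_instruction_def)
  then have s0: "step M Os (0, T0) = (N, T0(1 := write_symbol 0 (T0 1)))"
    by (simp add: step_def)
  have r0: "represents ((\<lambda>_. 0)(0 := n)) (T0(1 := write_symbol 0 (T0 1)))"
    using holds_write_scan[OF h1] by (intro represents_upd'[OF T0(2)]) simp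
  define R where "R j = ((\<lambda>_. 0 :: nat)(0 :: nat := n, 1 := j))" for j
  have "\<exists>T. reaches M Os (0, T0) (N + (j + j), T) \<and> represents ((\<lambda>_. 0)(0 := n, 1 := j)) T"
    if "j \<le> c" for j
    using that
  proof (induction j)
    case 0
    have "(\<lambda>_. 0)(0 := n) = ((\<lambda>_. 0)(0 := n, 1 := 0) :: nat \<Rightarrow> nat)" by auto
    then show ?case using reaches_step[OF s0] r0
      by (intro exI[of _ "T0(1 := write_symbol 0 (T0 1))"]) (simp only: add_0 add_0_right)
  next
    case (Suc j)
    obtain T where T: "reaches M Os (0, T0) (N + (j + j), T)"
      "represents ((\<lambda>_. 0)(0 := n, 1 := j)) T"
      using Suc.IH[OF Suc_leD[OF Suc.prems]] by blast
    obtain A B where AB: "incs N c = A @ compile (Inc 1) (N + (j + j)) @ B"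
      "\<forall>ins\<in>set A. N + (j + j) + 2 \<le> fst ins" "\<forall>ins\<in>set B. N \<le> fst ins \<and> fst ins < N + (j + j)"
      using incs_split[of j c N] Suc.prems by auto
    let ?R = "branch (N + (c + c)) 1 1 1 @ (0, 1, 0, Write 0, N) # compile p 1"
    have "installed M (A @ compile (Inc 1) (N + (j + j)) @ (B @ ?R)) 0 (N + (j + j) + len (Inc 1))"
      using all unfolding M AB(1) by simp
    then have "installed M (compile (Inc 1) (N + (j + j))) (N + (j + j)) (N + (j + j) + len (Inc 1))"
      by (rule installed_sub)
        (use Suc.prems AB(2,3) in \<open>auto simp: N_def branch_def dest!: compile_states\<close>)
    from exec_compile[OF inc this T(2)[folded R_def]] obtain T' where
      T': "reaches M Os (N + (j + j), T) (N + (j + j) + len (Inc 1), T')"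
      "represents ((R j)(1 := Suc (R j 1))) T'"
      by blast
    have "(R j)(1 := Suc (R j 1)) = R (Suc j)" by (simp add: R_def)
    then have r: "represents ((\<lambda>_. 0)(0 := n, 1 := Suc j)) T'"
      using T'(2) by (simp only: R_def)
    have "N + (j + j) + len (Inc 1) = N + (Suc j + Suc j)" by simp
    then show ?case using reaches_trans[OF T(1) T'(1)] r by metis
  qed
  then obtain T1 where T1: "reaches M Os (0, T0) (N + (c + c), T1)"
    "represents ((\<lambda>_. 0)(0 := n, 1 := c)) T1" by blast
  have "installed M (incs N c @ branch (N + (c + c)) 1 1 1 @ ((0, 1, 0, Write 0, N) # compile p 1))
      0 (Suc (N + (c + c)))"
    using all by (simp add: M)
  then have "installed M (branch (N + (c + c)) 1 1 1) (N + (c + c)) (Suc (N + (c + c)))"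
    by (rule installed_sub) (auto simp: N_def branch_def dest!: inc_ge compile_states)
  then obtain T2 where s2: "step M Os (N + (c + c), T1) = (if R c 1 = 0 then 1 else 1, T2)"
    and T2: "represents (R c) T2"
    by (rule step_branch[OF _ T1(2)[folded R_def]])
  have "reaches M Os (N + (c + c), T1) (1, T2)" using s2 by (intro reaches_step) simp
  then have "reaches M Os (initial_config n) (1, T2)"
    using reaches_trans[OF T1(1)] unfolding T0(1) by blast
  then show "\<exists>T. reaches M Os (initial_config n) (1, T) \<and> represents ((\<lambda>_. 0)(0 := n, 1 := c)) T"
    using T2 unfolding R_def by blast
qed

text \<open>Register 1 holds \<open>pair c (pair i n)\<close>, register 0 a flag that is cleared
  when the test \<open>P\<close> succeeds. The machines constructed for games and for recognition
  are all of this form: \<open>n\<close> carries whatever must be guessed, including step counts,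
  and \<open>g\<close> provides reductions.\<close>

theorem search_machine:
  assumes "dec P"
  shows "\<exists>g. computable g \<and>
    (\<forall>c Os i. halts (machine_decode (g c)) Os i \<longleftrightarrow> (\<exists>n. P Os (pair c (pair i n))))"
proof -
  define G where "G Os z = pair (pair (pfst z) (pair (pfst (psnd z)) (Suc (psnd (psnd z)))))
    (if P Os z then 0 else 1)" for Os z
  have "pr G" unfolding G_def by (intro pr_intros assms)
  then obtain gc where gc: "implements G gc 1" by (auto simp: pr_def)
  have "pr (\<lambda>_ z. pair (psnd z) (pair (pfst z) 0))" by (intro pr_intros)
  then obtain hc where hc: "implements (\<lambda>_ z. pair (psnd z) (pair (pfst z) 0)) hc 0"
    by (auto simp: pr_def)
  define init where "init = Seq (move 0 2) (Seq (pack 0) (Seq hc (Seq (move 0 1) (Inc 0))))"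
  define body where "body = Seq (Dec 0) (Seq gc (Seq (unpack 1) (move 2 0)))"
  define p where "p = Seq init (While 0 body)"
  define E where "E a z = (\<lambda>_. 0)(0 := a, Suc 0 := z)" for a z :: nat
  have init: "exec Os init (E i c) (E 1 (pair c (pair i 0)))" for Os i c
  proof -
    have "exec Os (move 0 2) (E i c) ((E 0 c)(2 := i))"
      by (rule exec_eq[OF exec_move]) (auto simp: E_def)
    moreover have "exec Os (pack 0) ((E 0 c)(2 := i)) (E (pair i c) 0)"
      by (rule exec_eq[OF exec_pack]) (auto simp: E_def pair_def fun_eq_iff)
    moreover have "exec Os hc (E (pair i c) 0) (E (pair c (pair i 0)) 0)"
      by (rule implementsD[OF hc]) (auto simp: E_def)
    moreover have "exec Os (move 0 1) (E (pair c (pair i 0)) 0) (E 0 (pair c (pair i 0)))"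
      by (rule exec_eq[OF exec_move]) (auto simp: E_def)
    moreover have "exec Os (Inc 0) (E 0 (pair c (pair i 0))) (E 1 (pair c (pair i 0)))"
      by (rule exec_eq[OF inc]) (auto simp: E_def)
    ultimately show ?thesis unfolding init_def by (intro seq)
  qed
  have body: "exec Os body (E 1 z) (E (psnd (G Os z)) (pfst (G Os z)))" for Os z
  proof -
    have "exec Os (Dec 0) (E 1 z) (E 0 z)"
      by (rule exec_eq[OF exec.dec]) (auto simp: E_def)
    moreover have "exec Os gc (E 0 z) (E 0 (G Os z))"
      by (rule implementsD[OF gc]) (auto simp: E_def)
    moreover have "exec Os (unpack 1) (E 0 (G Os z)) ((E 0 (pfst (G Os z)))(2 := psnd (G Os z)))"
      by (rule exec_eq[OF exec_unpack]) (auto simp: E_def pfst_def psnd_def fun_eq_iff)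
    moreover have "exec Os (move 2 0) ((E 0 (pfst (G Os z)))(2 := psnd (G Os z)))
        (E (psnd (G Os z)) (pfst (G Os z)))"
      by (rule exec_eq[OF exec_move]) (auto simp: E_def)
    ultimately show ?thesis unfolding body_def by (intro seq)
  qed
  define g where "g c = list_encode (map instruction_code (with_parameter p c))" for c
  have "computable g"
    using computable_pr[OF pr_with_parameter[of p]] by (simp add: g_def[abs_def])
  moreover have "halts (machine_decode (g c)) Os i \<longleftrightarrow> (\<exists>n. P Os (pair c (pair i n)))" for c Os i
  proof -
    define M where "M = with_parameter p c"
    have Mg: "machine_decode (g c) = M" by (simp add: g_def machine_decode_code M_def)
    obtain T where T: "reaches M Os (initial_config i) (1, T)" "represents (E i c) T"
      using with_parameter_start(1)[of p c Os i] by (auto simp: M_def E_def)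
    have inst: "installed M (compile p 1) 1 (1 + len p)"
      unfolding M_def by (rule with_parameter_start)
    note inst' = installed_Seq[OF inst[unfolded p_def]]
    obtain T1 where T1: "reaches M Os (1, T) (1 + len init, T1)"
      "represents (E 1 (pair c (pair i 0))) T1"
      using exec_compile[OF init inst'(1) T(2)] by blast
    have halts: "halts M Os i \<longleftrightarrow> (\<exists>s. halted M ((step M Os ^^ s) (1 + len init, T1)))"
      by (rule halts_reaches[OF reaches_trans[OF T(1) T1(1)]])
    show ?thesis unfolding Mg
    proof
      assume h: "halts M Os i"
      show "\<exists>n. P Os (pair c (pair i n))"
      proof (rule ccontr)
        assume no: "\<nexists>n. P Os (pair c (pair i n))"
        have "\<not> halted M ((step M Os ^^ s) (1 + len init, T1))" for s
        proof (rule while_diverges[where I = "\<lambda>e. \<exists>n. e = E 1 (pair c (pair i n))", OF inst'(2) _ _ T1(2)])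
          fix e assume "\<exists>n. e = E 1 (pair c (pair i n))"
          then obtain n where e: "e = E 1 (pair c (pair i n))" by blast
          have "exec Os body e (E 1 (pair c (pair i (Suc n))))"
            using body[of Os "pair c (pair i n)"] no by (simp add: e G_def)
          then show "e 0 \<noteq> 0 \<and> (\<exists>e'. exec Os body e e' \<and> (\<exists>n. e' = E 1 (pair c (pair i n))))"
            by (auto simp: e E_def)
        qed blast
        then show False using h halts by blast
      qed
    next
      assume "\<exists>n. P Os (pair c (pair i n))"
      then obtain n where n: "P Os (pair c (pair i n))" "\<And>m. m < n \<Longrightarrow> \<not> P Os (pair c (pair i m))"
        using exists_least_iff[of "\<lambda>n. P Os (pair c (pair i n))"] by blast
      \<comment> \<open>The counter is advanced also in the round in which the test succeeds, so the
        loop exits at \<open>Suc n\<close>.\<close>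
      define H where "H j = E (if j \<le> n then 1 else 0) (pair c (pair i j))" for j
      have "exec Os (While 0 body) (H 0) (H (Suc n))"
      proof (rule exec_while)
        fix j assume "j < Suc n"
        then have "exec Os body (H j) (H (Suc j))" "H j 0 \<noteq> 0"
          using body[of Os "pair c (pair i j)"] n by (auto simp: H_def G_def E_def less_Suc_eq)
        then show "H j 0 \<noteq> 0 \<and> exec Os body (H j) (H (Suc j))" by blast
      qed (simp add: H_def E_def)
      then have "exec Os (While 0 body) (E 1 (pair c (pair i 0))) (H (Suc n))"
        by (simp add: H_def)
      from exec_compile[OF this inst'(2) T1(2)]
      obtain T2 where "reaches M Os (1 + len init, T1) (1 + len init + len (While 0 body), T2)"
        by blast
      then have "reaches M Os (1 + len init, T1) (1 + len p, T2)"
        by (simp add: p_def)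
      moreover have "halted M (1 + len p, T2)" unfolding M_def by (rule with_parameter_start)
      ultimately show "halts M Os i" unfolding halts reaches_def by metis
    qed
  qed
  ultimately show ?thesis by blast
qed

section \<open>Universal step-bounded simulation\<close>

definition tape_of :: "nat \<Rightarrow> tape" where
  "tape_of tc = (list_decode (pfst tc), list_decode (psnd tc))"

definition cleft :: "nat \<Rightarrow> nat" where
  "cleft tc = pair (ltl (pfst tc)) (lcons (lhd (pfst tc)) (psnd tc))"

definition cright :: "nat \<Rightarrow> nat" where
  "cright tc = pair (lcons (lhd (psnd tc)) (pfst tc)) (ltl (psnd tc))"

definition cwrite :: "nat \<Rightarrow> nat \<Rightarrow> nat" where
  "cwrite b tc = pair (pfst tc) (lcons b (ltl (psnd tc)))"

definition cnum :: "nat \<Rightarrow> nat" where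
  "cnum tc = foldr (\<lambda>a acc. if a = 1 then Suc acc else 0) (list_decode (psnd tc)) 0"

definition cunary :: "nat \<Rightarrow> nat" where
  "cunary n = pair 0 (rec_nat 0 (\<lambda>_ acc. lcons 1 acc) n)"

lemma scan_tape_of: "scan (tape_of tc) = lhd (psnd tc)"
  unfolding tape_of_def by (cases "psnd tc" rule: list_code_cases) auto

lemma tape_of_cleft: "tape_of (cleft tc) = move_left (tape_of tc)"
  unfolding tape_of_def cleft_def by (cases "pfst tc" rule: list_code_cases) auto

lemma tape_of_cright: "tape_of (cright tc) = move_right (tape_of tc)"
  unfolding tape_of_def cright_def by (cases "psnd tc" rule: list_code_cases) auto

lemma tape_of_cwrite: "tape_of (cwrite b tc) = write_symbol b (tape_of tc)"
  unfolding tape_of_def cwrite_def by (simp add: list_decode_ltl)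

lemma cnum: "cnum tc = tape_number (tape_of tc)"
proof -
  have "foldr (\<lambda>a acc. if a = 1 then Suc acc else 0) xs 0 = length (takeWhile (\<lambda>a. a = 1) xs)"
    for xs :: "nat list"
    by (induction xs) auto
  then show ?thesis by (simp add: cnum_def tape_number_def tape_of_def)
qed

lemma tape_of_cunary: "tape_of (cunary n) = unary_tape n"
proof -
  have "list_decode (rec_nat 0 (\<lambda>_ acc. lcons 1 acc) n) = replicate n 1"
    by (induction n) auto
  then show ?thesis by (simp add: tape_of_def cunary_def unary_tape_def)
qed

text \<open>
  The tapes of a simulated configuration are kept in an association list whose first entry for a
  tape is the current one; a tape without entry is blank, because \<open>0\<close> codes the blank tape.
\<close>

definition lookup :: "nat \<Rightarrow> nat \<Rightarrow> nat" where
  "lookup al t = foldr (\<lambda>en acc. if pfst en = t then psnd en else acc) (list_decode al) 0"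

lemma lookup_0 [simp]: "lookup 0 t = 0"
  by (simp add: lookup_def)

lemma lookup_lcons [simp]:
  "lookup (lcons (pair t' tc) al) t = (if t' = t then tc else lookup al t)"
  by (simp add: lookup_def)

definition config_of :: "nat \<Rightarrow> config" where
  "config_of cc = (pfst cc, \<lambda>t. tape_of (lookup (psnd cc) t))"

text \<open>\<open>foldr\<close> lets earlier instructions override later ones, so the first
  applicable one fires; \<open>Suc\<close> separates an instruction code from the answer that there
  is none.\<close>

definition cnext :: "nat \<Rightarrow> nat \<Rightarrow> nat" where
  "cnext e cc = foldr (\<lambda>ins acc. if pfst ins = pfst cc \<and>
       pfst (psnd (psnd ins)) = lhd (psnd (lookup (psnd cc) (pfst (psnd ins))))
     then Suc ins else acc) (list_decode e) 0"

lemma instruction_decode_eq: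
  "instruction_decode ins = (pfst ins, pfst (psnd ins), pfst (psnd (psnd ins)),
     action_decode (pfst (psnd (psnd (psnd ins)))), psnd (psnd (psnd (psnd ins))))"
  by (simp add: instruction_decode_def pfst_def psnd_def split: prod.split)

lemma cnext:
  "next_instruction (machine_decode e) (config_of cc) =
     (if cnext e cc = 0 then None else Some (instruction_decode (cnext e cc - 1)))"
proof -
  have "find (\<lambda>(q, t, a, _, _). q = fst (config_of cc) \<and> a = scan (snd (config_of cc) t))
      (map instruction_decode xs) = (if F xs = 0 then None else Some (instruction_decode (F xs - 1)))"
    if "F = (\<lambda>xs. foldr (\<lambda>ins acc. if pfst ins = pfst cc \<and>
       pfst (psnd (psnd ins)) = lhd (psnd (lookup (psnd cc) (pfst (psnd ins))))
     then Suc ins else acc) xs 0)" for xs F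
    unfolding that
    by (induction xs) (auto simp: config_of_def instruction_decode_eq scan_tape_of)
  from this[OF refl] show ?thesis
    by (simp add: next_instruction_def machine_decode_def cnext_def)
qed

definition cperform :: "(nat \<Rightarrow> nat \<Rightarrow> nat) \<Rightarrow> nat \<Rightarrow> nat \<Rightarrow> nat" where
  "cperform h act tc =
     (if act = 0 then Suc (cleft tc) else if act = 1 then Suc (cright tc)
      else if even (act - 2) then Suc (cwrite ((act - 2) div 2) tc)
      else if h ((act - 2) div 2) (cnum tc) = 0 then 0
      else Suc (cunary (h ((act - 2) div 2) (cnum tc) - 1)))"

definition cexec :: "(nat \<Rightarrow> nat \<Rightarrow> nat) \<Rightarrow> nat \<Rightarrow> nat \<Rightarrow> nat" where
  "cexec h ins cc =
     (if cperform h (pfst (psnd (psnd (psnd ins)))) (lookup (psnd cc) (pfst (psnd ins))) = 0 then 0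
      else Suc (pair (psnd (psnd (psnd (psnd ins)))) (lcons (pair (pfst (psnd ins))
        (cperform h (pfst (psnd (psnd (psnd ins)))) (lookup (psnd cc) (pfst (psnd ins))) - 1)) (psnd cc))))"

definition cstep :: "(nat \<Rightarrow> nat \<Rightarrow> nat) \<Rightarrow> nat \<Rightarrow> nat \<Rightarrow> nat" where
  "cstep h e cc = (if cnext e cc = 0 then Suc cc else cexec h (cnext e cc - 1) cc)"

text \<open>
  Simulation with the partial oracle \<open>h\<close>, where \<open>h i k = 0\<close> means that the answer to query \<open>k\<close> of
  oracle \<open>i\<close> is not available and \<open>h i k = Suc v\<close> that it is \<open>v\<close>. The result is \<open>0\<close> if an unavailable
  answer was needed.
\<close>

definition crun :: "(nat \<Rightarrow> nat \<Rightarrow> nat) \<Rightarrow> nat \<Rightarrow> nat \<Rightarrow> nat \<Rightarrow> nat" where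
  "crun h e n s = rec_nat (Suc (pair 0 (lcons (pair 0 (cunary n)) 0)))
     (\<lambda>_ st. if st = 0 then 0 else cstep h e (st - 1)) s"

definition chalts :: "(nat \<Rightarrow> nat \<Rightarrow> nat) \<Rightarrow> nat \<Rightarrow> nat \<Rightarrow> nat \<Rightarrow> bool" where
  "chalts h e n s \<longleftrightarrow> crun h e n s \<noteq> 0 \<and> cnext e (crun h e n s - 1) = 0"

definition coutput :: "(nat \<Rightarrow> nat \<Rightarrow> nat) \<Rightarrow> nat \<Rightarrow> nat \<Rightarrow> nat \<Rightarrow> nat" where
  "coutput h e n s = cnum (lookup (psnd (crun h e n s - 1)) 0)"

lemma pr_lookup [pr_intros]: "pr al \<Longrightarrow> pr t \<Longrightarrow> pr (\<lambda>Os x. lookup (al Os x) (t Os x))"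
  unfolding lookup_def
  by (rule pr_comp2[where f = "\<lambda>Os al t. foldr (\<lambda>en acc. if pfst en = t then psnd en else acc) (list_decode al) 0"])
    (intro pr_intros)+

lemma pr_cnum [pr_intros]: "pr f \<Longrightarrow> pr (\<lambda>Os x. cnum (f Os x))"
  unfolding cnum_def by (intro pr_intros)

lemma pr_cunary [pr_intros]: "pr f \<Longrightarrow> pr (\<lambda>Os x. cunary (f Os x))"
  unfolding cunary_def by (intro pr_rec pr_intros)

lemma pr_cnext [pr_intros]:
  assumes "pr f" "pr g"
  shows "pr (\<lambda>Os x. cnext (f Os x) (g Os x))"
proof -
  have "pr (\<lambda>Os z. cnext (pfst z) (psnd z))"
    unfolding cnext_def by (intro pr_intros)
  from pr_comp2[where f = "\<lambda>_. cnext", OF this assms] show ?thesis .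
qed

lemma pr_cperform:
  assumes h: "pr (\<lambda>Os z. h Os (pfst z) (pfst (psnd z)) (psnd (psnd z)))" and "pr f" "pr g"
  shows "pr (\<lambda>Os x. cperform (h Os x) (f Os x) (g Os x))"
  unfolding cperform_def cleft_def cright_def cwrite_def
  by (intro pr_intros assms pr_comp3[where f = h, OF h])

lemma pr_cstep:
  assumes h: "pr (\<lambda>Os z. h Os (pfst z) (pfst (psnd z)) (psnd (psnd z)))" and "pr f" "pr g"
  shows "pr (\<lambda>Os x. cstep (h Os x) (f Os x) (g Os x))"
  unfolding cstep_def cexec_def
  by (intro pr_intros assms pr_cperform[where h = h, OF h])

lemma pr_crun [pr_intros]:
  assumes h: "pr (\<lambda>Os z. h Os (pfst z) (pfst (psnd z)) (psnd (psnd z)))"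
    and "pr e" "pr n" "pr s"
  shows "pr (\<lambda>Os x. crun (\<lambda>i k. h Os x i k) (e Os x) (n Os x) (s Os x))"
  unfolding crun_def
  by (intro pr_rec pr_intros pr_cstep[where h = "\<lambda>Os z. h Os (pfst z)"] assms
      pr_comp3[where f = h, OF h] pr_comp[OF assms(2)])

lemma dec_chalts [pr_intros]:
  assumes h: "pr (\<lambda>Os z. h Os (pfst z) (pfst (psnd z)) (psnd (psnd z)))"
    and "pr e" "pr n" "pr s"
  shows "dec (\<lambda>Os x. chalts (\<lambda>i k. h Os x i k) (e Os x) (n Os x) (s Os x))"
  unfolding chalts_def by (intro pr_intros assms)

lemma pr_coutput [pr_intros]:
  assumes h: "pr (\<lambda>Os z. h Os (pfst z) (pfst (psnd z)) (psnd (psnd z)))"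
    and "pr e" "pr n" "pr s"
  shows "pr (\<lambda>Os x. coutput (\<lambda>i k. h Os x i k) (e Os x) (n Os x) (s Os x))"
  unfolding coutput_def by (intro pr_intros assms)

text \<open>Only supplied answers have to be correct, so one \<open>h\<close> can be consistent with
  many oracles; runs on different oracles are compared in this way.\<close>

definition consistent :: "(nat \<Rightarrow> nat \<Rightarrow> nat) \<Rightarrow> (nat \<Rightarrow> nat) list \<Rightarrow> bool" where
  "consistent h Os \<longleftrightarrow> (\<forall>i k v. h i k = Suc v \<longrightarrow> v = answer Os i k)"

lemma perform_Query: "perform Os (Query i) tp = unary_tape (answer Os i (tape_number tp))"
  by (simp add: answer_def)

lemma action_decode_cases:
  "action_decode act = (if act = 0 then MoveLeft else if act = 1 then MoveRight
     else if even (act - 2) then Write ((act - 2) div 2) else Query ((act - 2) div 2))"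
  by (cases act rule: action_decode.cases) auto

lemma cperform_sound:
  assumes "consistent h Os" "cperform h act tc \<noteq> 0"
  shows "tape_of (cperform h act tc - 1) = perform Os (action_decode act) (tape_of tc)"
proof -
  have "h i k - 1 = answer Os i k" if "h i k \<noteq> 0" for i k
    using assms(1) that unfolding consistent_def by (cases "h i k") auto
  then show ?thesis
    using assms(2) unfolding cperform_def action_decode_cases
    by (auto simp: tape_of_cleft tape_of_cright tape_of_cwrite tape_of_cunary cnum perform_Query
        simp del: perform.simps(4))
qed

lemma cperform_0:
  assumes "cperform h act tc = 0"
  shows "\<exists>i. action_decode act = Query i \<and> h i (tape_number (tape_of tc)) = 0"
  using assms unfolding cperform_def action_decode_cases by (auto simp: cnum split: if_splits)

lemma cstep_sound:
  assumes "consistent h Os" "cstep h e cc \<noteq> 0"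
  shows "config_of (cstep h e cc - 1) = step (machine_decode e) Os (config_of cc)"
proof (cases "cnext e cc = 0")
  case True
  then show ?thesis by (simp add: cstep_def step_def cnext)
next
  case False
  let ?ins = "cnext e cc - 1"
  have "cperform h (pfst (psnd (psnd (psnd ?ins)))) (lookup (psnd cc) (pfst (psnd ?ins))) \<noteq> 0"
    using assms(2) False by (auto simp: cstep_def cexec_def split: if_splits)
  with cperform_sound[OF assms(1) this] False show ?thesis
    by (simp add: cstep_def cexec_def step_def cnext instruction_decode_eq)
      (auto simp: config_of_def fun_eq_iff)
qed

lemma cstep_0:
  assumes "cstep h e cc = 0"
  shows "\<exists>q t a i q'. next_instruction (machine_decode e) (config_of cc) = Some (q, t, a, Query i, q') \<and>
    h i (tape_number (snd (config_of cc) t)) = 0"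
proof -
  let ?ins = "cnext e cc - 1"
  have c: "cnext e cc \<noteq> 0"
    and "cperform h (pfst (psnd (psnd (psnd ?ins)))) (lookup (psnd cc) (pfst (psnd ?ins))) = 0"
    using assms by (auto simp: cstep_def cexec_def split: if_splits)
  from cperform_0[OF this(2)] obtain i where i:
    "action_decode (pfst (psnd (psnd (psnd ?ins)))) = Query i"
    "h i (tape_number (tape_of (lookup (psnd cc) (pfst (psnd ?ins))))) = 0" by blast
  have "next_instruction (machine_decode e) (config_of cc) =
      Some (pfst ?ins, pfst (psnd ?ins), pfst (psnd (psnd ?ins)), Query i, psnd (psnd (psnd (psnd ?ins))))"
    using c i(1) by (simp add: cnext instruction_decode_eq)
  moreover have "h i (tape_number (snd (config_of cc) (pfst (psnd ?ins)))) = 0"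
    using i(2) by (simp add: config_of_def)
  ultimately show ?thesis by blast
qed

lemma crun_0: "crun h e n 0 = Suc (pair 0 (lcons (pair 0 (cunary n)) 0))"
  by (simp add: crun_def)

lemma crun_Suc: "crun h e n (Suc s) = (if crun h e n s = 0 then 0 else cstep h e (crun h e n s - 1))"
  by (simp add: crun_def)

lemma run_0: "run M Os n 0 = initial_config n"
  by (simp add: run_def)

lemma run_Suc: "run M Os n (Suc s) = step M Os (run M Os n s)"
  by (simp add: run_def)

lemma crun_sound:
  assumes "consistent h Os" "crun h e n s \<noteq> 0"
  shows "config_of (crun h e n s - 1) = run (machine_decode e) Os n s"
  using assms(2)
proof (induction s)
  case 0
  have "tape_of 0 = ([], [])" by (simp add: tape_of_def)
  then show ?case
    by (auto simp: crun_0 run_0 config_of_def initial_config_def tape_of_cunary fun_eq_iff)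
next
  case (Suc s)
  then show ?case
    using cstep_sound[OF assms(1)] by (auto simp: crun_Suc run_Suc split: if_splits)
qed

text \<open>A run of \<open>s\<close> steps asks finitely many questions, each answered for all
  large \<open>m\<close>. The conclusion also speaks of all large \<open>m\<close>, so that the
  thresholds of successive steps combine by \<open>max\<close>.\<close>

lemma crun_complete:
  assumes "\<And>m. consistent (H m) Os" "\<And>i k. \<exists>m. \<forall>m'\<ge>m. H m' i k \<noteq> 0"
  shows "\<exists>m :: nat. \<forall>m'\<ge>m. crun (H m') e n s \<noteq> 0"
proof (induction s)
  case 0
  then show ?case by (simp add: crun_0)
next
  case (Suc s)
  let ?c = "run (machine_decode e) Os n s"
  obtain m where m: "\<And>m'. m' \<ge> m \<Longrightarrow> crun (H m') e n s \<noteq> 0" using Suc by blast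
  have conf: "config_of (crun (H m') e n s - 1) = ?c" if "m' \<ge> m" for m'
    using crun_sound[OF assms(1) m[OF that]] .
  show ?case
  proof (cases "\<exists>q t a i q'. next_instruction (machine_decode e) ?c = Some (q, t, a, Query i, q')")
    case True
    then obtain q t a i q' where i: "next_instruction (machine_decode e) ?c = Some (q, t, a, Query i, q')"
      by blast
    obtain m2 where m2: "\<And>m'. m' \<ge> m2 \<Longrightarrow> H m' i (tape_number (snd ?c t)) \<noteq> 0"
      using assms(2) by blast
    have "crun (H m') e n (Suc s) \<noteq> 0" if "m' \<ge> max m m2" for m'
    proof
      assume "crun (H m') e n (Suc s) = 0"
      then have "cstep (H m') e (crun (H m') e n s - 1) = 0"
        using m[of m'] that by (simp add: crun_Suc)
      from cstep_0[OF this] show False using m2[of m'] that i conf[of m'] by auto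
    qed
    then show ?thesis by blast
  next
    case False
    have "crun (H m') e n (Suc s) \<noteq> 0" if "m' \<ge> m" for m'
    proof
      assume "crun (H m') e n (Suc s) = 0"
      then have "cstep (H m') e (crun (H m') e n s - 1) = 0"
        using m[of m'] that by (simp add: crun_Suc)
      from cstep_0[OF this] show False using that False conf[of m'] by auto
    qed
    then show ?thesis by blast
  qed
qed

lemma chalts_iff:
  assumes "consistent h Os" "crun h e n s \<noteq> 0"
  shows "chalts h e n s \<longleftrightarrow> halted (machine_decode e) (run (machine_decode e) Os n s)"
  using assms(2) cnext[of e "crun h e n s - 1"] unfolding crun_sound[OF assms]
  by (auto simp: chalts_def halted_def)

lemma coutput_eq:
  assumes "consistent h Os" "crun h e n s \<noteq> 0"
  shows "coutput h e n s = tape_number (snd (run (machine_decode e) Os n s) 0)"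
  unfolding crun_sound[OF assms, symmetric] by (simp add: coutput_def cnum config_of_def)

lemma chalts_halts:
  assumes "consistent h Os" "chalts h e n s"
  shows "halts (machine_decode e) Os n"
  using assms chalts_iff[OF assms(1), of e n s] unfolding halts_def chalts_def by blast

lemma halts_chalts:
  assumes "\<And>m. consistent (H m) Os" "\<And>i k. \<exists>m. \<forall>m'\<ge>m. H m' i k \<noteq> 0"
    and "halts (machine_decode e) Os n"
  shows "\<exists>s m :: nat. \<forall>m'\<ge>m. chalts (H m') e n s"
proof -
  obtain s where s: "halted (machine_decode e) (run (machine_decode e) Os n s)"
    using assms(3) by (auto simp: halts_def)
  obtain m where "\<forall>m'\<ge>m. crun (H m') e n s \<noteq> 0" using crun_complete[OF assms(1,2)] by blast
  then show ?thesis using chalts_iff[OF assms(1)] s by metis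
qed

definition total_oracle :: "(nat \<Rightarrow> nat) list \<Rightarrow> nat \<Rightarrow> nat \<Rightarrow> nat" where
  "total_oracle Os i k = Suc (answer Os i k)"

lemma consistent_total: "consistent (total_oracle Os) Os"
  by (simp add: consistent_def total_oracle_def)

lemma crun_total: "crun (total_oracle Os) e n s \<noteq> 0"
  using crun_complete[of "\<lambda>_. total_oracle Os" Os e n s] consistent_total
  by (auto simp: total_oracle_def)

lemma halted_run_mono:
  assumes "halted M (run M Os n s)" "s \<le> s'"
  shows "run M Os n s' = run M Os n s"
  using assms(2)
proof (induction s' rule: dec_induct)
  case (step k)
  then show ?case using assms(1) by (simp add: run_Suc step_def halted_def)
qed simp

text \<open>The use principle. An oracle cut off at a suitable \<open>m\<close> suffices for the
  simulation and is consistent with every oracle agreeing below \<open>m\<close>, so one simulated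
  run describes all the actual ones.\<close>

lemma run_use:
  "\<exists>m. \<forall>Os'. (\<forall>i. \<forall>k<m. answer Os' i k = answer Os i k) \<longrightarrow> run M Os' n s = run M Os n s"
proof -
  obtain e where e: "machine_decode e = M" using surj_machine_decode by (metis surjD)
  define H where "H m i k = (if k < m then Suc (answer Os i k) else 0)" for m i k :: nat
  have c: "consistent (H m) Os" for m by (simp add: consistent_def H_def)
  have "\<exists>m. \<forall>m'\<ge>m. H m' i k \<noteq> 0" for i k
    by (rule exI[of _ "Suc k"]) (simp add: H_def)
  from crun_complete[of H, OF c this, of e n s] obtain m where m: "crun (H m) e n s \<noteq> 0" by blast
  have "run M Os' n s = run M Os n s" if "\<forall>i. \<forall>k<m. answer Os' i k = answer Os i k" for Os'
  proof -
    have "consistent (H m) Os'" using that by (simp add: consistent_def H_def)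
    then show ?thesis using crun_sound[OF _ m] c e by metis
  qed
  then show ?thesis by blast
qed

section \<open>Games\<close>

definition init :: "(nat \<Rightarrow> 'a) \<Rightarrow> nat \<Rightarrow> 'a list" where
  "init x n = map x [0..<n]"

lemma length_init [simp]: "length (init x n) = n"
  by (simp add: init_def)

lemma init_0 [simp]: "init x 0 = []"
  by (simp add: init_def)

lemma init_Suc: "init x (Suc n) = init x n @ [x n]"
  by (simp add: init_def)

lemma nth_init [simp]: "k < n \<Longrightarrow> init x n ! k = x k"
  by (simp add: init_def)

lemma take_init [simp]: "m \<le> n \<Longrightarrow> take m (init x n) = init x m"
  by (simp add: init_def take_map)

lemma init_eq_iff: "init x n = init y n \<longleftrightarrow> (\<forall>k<n. x k = y k)"
  by (auto simp: init_def)

lemma init_eq_mono: "init x n = init y n \<Longrightarrow> m \<le> n \<Longrightarrow> init x m = init y m"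
  by (auto simp: init_eq_iff)

lemma init_eq_iff_nth: "init x (length p) = p \<longleftrightarrow> (\<forall>k<length p. x k = p ! k)"
  by (auto simp: list_eq_iff_nth_eq)

text \<open>\<open>P\<close> selects the moves governed by \<open>\<sigma>\<close>:
  \<open>even\<close> for the first player, \<open>odd\<close> for the second. Parity is that of the
  absolute move number, also if \<open>p\<close> has odd length.\<close>

definition follows :: "(nat \<Rightarrow> bool) \<Rightarrow> ('a list \<Rightarrow> 'a) \<Rightarrow> 'a list \<Rightarrow> (nat \<Rightarrow> 'a) \<Rightarrow> bool" where
  "follows P \<sigma> p x \<longleftrightarrow>
     init x (length p) = p \<and> (\<forall>n\<ge>length p. P n \<longrightarrow> x n = \<sigma> (init x n))"

definition wins :: "(nat \<Rightarrow> 'a) set \<Rightarrow> 'a list \<Rightarrow> bool" where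
  "wins W p \<longleftrightarrow> (\<exists>\<sigma>. \<forall>x. follows even \<sigma> p x \<longrightarrow> x \<in> W)"

definition second_wins :: "(nat \<Rightarrow> 'a) set \<Rightarrow> 'a list \<Rightarrow> bool" where
  "second_wins W p \<longleftrightarrow> (\<exists>\<tau>. \<forall>x. follows odd \<tau> p x \<longrightarrow> x \<notin> W)"

lemma winning_position_wins: "winning_position W p = wins W p"
  by (simp add: winning_position_def wins_def follows_def init_def)

lemma play_exists: "\<exists>x. init x (length q) = q \<and> (\<forall>n\<ge>length q. x n = \<phi> (init x n))"
proof -
  define L where "L n = ((\<lambda>r. r @ [\<phi> r]) ^^ n) q" for n
  define x where "x n = (if n < length q then q ! n else \<phi> (L (n - length q)))" for n
  have L: "init x (length q + n) = L n" for n
  proof (induction n)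
    case 0
    show ?case by (auto simp: L_def init_eq_iff_nth x_def)
  next
    case (Suc n)
    then show ?case by (simp add: init_Suc) (simp add: L_def x_def)
  qed
  have "x n = \<phi> (init x n)" if "n \<ge> length q" for n
    using L[of "n - length q"] that by (simp add: x_def)
  moreover have "init x (length q) = q" using L[of 0] by (simp add: L_def)
  ultimately show ?thesis by blast
qed

lemma play_against:
  obtains x where "follows P \<sigma> p x" "\<And>n. n \<ge> length p \<Longrightarrow> \<not> P n \<Longrightarrow> x n = \<tau> (init x n)"
proof -
  obtain x where x: "init x (length p) = p"
    "\<forall>n\<ge>length p. x n = (if P (length (init x n)) then \<sigma> (init x n) else \<tau> (init x n))"
    using play_exists[of p "\<lambda>r. if P (length r) then \<sigma> r else \<tau> r"] by blast
  then show ?thesis by (intro that[of x]) (auto simp: follows_def)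
qed

section \<open>Determinacy for countable unions of closed sets\<close>

locale closed_union =
  fixes K :: "nat \<Rightarrow> (nat \<Rightarrow> 'a) set"
  assumes closed: "x \<notin> K i \<Longrightarrow> \<exists>n. \<forall>y. init y n = init x n \<longrightarrow> y \<notin> K i"
begin

definition T :: "nat \<Rightarrow> 'a list set" where
  "T i = {q. \<exists>x\<in>K i. init x (length q) = q}"

lemma T_init: "init x n \<in> T i \<Longrightarrow> m \<le> n \<Longrightarrow> init x m \<in> T i"
  unfolding T_def by (auto dest: init_eq_mono)

lemma in_K: "(\<And>n. n \<ge> n0 \<Longrightarrow> init x n \<in> T i) \<Longrightarrow> x \<in> K i"
proof (rule ccontr)
  assume T: "\<And>n. n \<ge> n0 \<Longrightarrow> init x n \<in> T i" and "x \<notin> K i"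
  then obtain n where n: "\<And>y. init y n = init x n \<Longrightarrow> y \<notin> K i" using closed by metis
  have "init x n \<in> T i" using T_init[OF T[of "max n n0"], of n] by simp
  then show False using n by (auto simp: T_def)
qed

abbreviation W :: "(nat \<Rightarrow> 'a) set" where
  "W \<equiv> \<Union>i. K i"

text \<open>
  The positions from which the second player can leave \<open>T i\<close>, never passing through a position
  won by the first player.
\<close>

inductive Z :: "nat \<Rightarrow> 'a list \<Rightarrow> bool" for i where
  leave: "\<not> wins W p \<Longrightarrow> p \<notin> T i \<Longrightarrow> Z i p"
| first: "\<not> wins W p \<Longrightarrow> even (length p) \<Longrightarrow> (\<And>k. Z i (p @ [k])) \<Longrightarrow> Z i p"
| second: "\<not> wins W p \<Longrightarrow> odd (length p) \<Longrightarrow> Z i (p @ [k]) \<Longrightarrow> Z i p"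

text \<open>
  Outside \<open>Z i\<close> the first player stays outside \<open>Z i\<close>, hence inside \<open>T i\<close>, until a position that he
  wins is reached, if ever.
\<close>

lemma wins_if_not_Z:
  assumes "\<not> Z i p"
  shows "wins W p"
proof -
  have "\<exists>s. \<forall>q. wins W q \<longrightarrow> (\<forall>x. follows even (s q) q x \<longrightarrow> x \<in> W)"
    unfolding wins_def by (rule choice) blast
  then obtain s where s: "\<And>q x. wins W q \<Longrightarrow> follows even (s q) q x \<Longrightarrow> x \<in> W" by blast
  define Q where "Q q n \<longleftrightarrow> length p \<le> n \<and> n \<le> length q \<and> wins W (take n q)" for q n
  \<comment> \<open>Taking the least winning prefix makes all later moves use the strategy of one
    and the same position.\<close>
  define \<sigma> where "\<sigma> q = (if \<exists>n. Q q n then s (take (LEAST n. Q q n) q) q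
    else SOME k. \<not> Z i (q @ [k]))" for q
  have "x \<in> W" if x: "follows even \<sigma> p x" for x
  proof (cases "\<exists>n\<ge>length p. wins W (init x n)")
    case True
    define n where "n = (LEAST n. length p \<le> n \<and> wins W (init x n))"
    have n: "length p \<le> n" "wins W (init x n)"
      using LeastI_ex[of "\<lambda>n. length p \<le> n \<and> wins W (init x n)"] True unfolding n_def by blast+
    have least: "n \<le> m" if "length p \<le> m" "wins W (init x m)" for m
      unfolding n_def by (rule Least_le) (use that in blast)
    have "x m = s (init x n) (init x m)" if m: "m \<ge> n" "even m" for m
    proof -
      have Qn: "Q (init x m) n" using n m by (simp add: Q_def)
      have "(LEAST k. Q (init x m) k) = n"
      proof (rule Least_equality)
        show "Q (init x m) n" by (rule Qn)
        show "n \<le> k" if "Q (init x m) k" for k using that least[of k] by (auto simp: Q_def)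
      qed
      then have "\<sigma> (init x m) = s (init x n) (init x m)"
        using Qn m by (auto simp: \<sigma>_def)
      then show ?thesis using x m n by (simp add: follows_def)
    qed
    then show ?thesis using s[OF n(2), of x] by (simp add: follows_def)
  next
    case False
    have "\<not> Z i (init x n)" if "n \<ge> length p" for n
      using that
    proof (induction n rule: dec_induct)
      case base
      then show ?case using x assms by (simp add: follows_def)
    next
      case (step n)
      have nw: "\<not> wins W (init x n)" using False step by blast
      show ?case
      proof (cases "even n")
        case True
        have "\<not> Q (init x n) m" for m using False by (auto simp: Q_def)
        then have "x n = (SOME k. \<not> Z i (init x n @ [k]))"
          using x step True by (simp add: follows_def \<sigma>_def)
        moreover have "\<exists>k. \<not> Z i (init x n @ [k])"
          using step.IH nw True first[of "init x n" i] by auto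
        ultimately show ?thesis unfolding init_Suc by (metis (mono_tags, lifting) someI_ex)
      next
        case odd: False
        then show ?thesis using step.IH nw second[of "init x n" i "x n"] by (auto simp: init_Suc)
      qed
    qed
    then have "init x n \<in> T i" if "n \<ge> length p" for n
      using leave[of "init x n" i] that False by blast
    then show ?thesis using in_K by blast
  qed
  then show ?thesis unfolding wins_def by blast
qed

text \<open>No position won by the first player may occur up to and including the point of leaving
  \<open>T i\<close>; otherwise the second player could not start afresh there with another
  index.\<close>

definition forces :: "nat \<Rightarrow> 'a list \<Rightarrow> ('a list \<Rightarrow> 'a) \<Rightarrow> bool" where
  "forces i p \<tau> \<longleftrightarrow> (\<forall>x. follows odd \<tau> p x \<longrightarrow>
     (\<exists>n\<ge>length p. init x n \<notin> T i \<and> (\<forall>m. length p \<le> m \<and> m \<le> n \<longrightarrow> \<not> wins W (init x m))))"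

lemma forces_if_Z: "Z i p \<Longrightarrow> \<exists>\<tau>. forces i p \<tau>"
proof (induction rule: Z.induct)
  case (leave p)
  then show ?case by (auto simp: forces_def follows_def intro!: exI[of _ "length p"])
next
  case (first p)
  then obtain t where t: "\<And>k. forces i (p @ [k]) (t k)" by metis
  \<comment> \<open>\<open>q ! length p\<close> is the move made by the first player at
    \<open>p\<close>; it selects the strategy to continue with.\<close>
  have "forces i p (\<lambda>q. t (q ! length p) q)"
    unfolding forces_def
  proof (intro allI impI)
    fix x assume x: "follows odd (\<lambda>q. t (q ! length p) q) p x"
    then have px: "init x (length p) = p" by (simp add: follows_def)
    have "follows odd (t (x (length p))) (p @ [x (length p)]) x"
      using x by (auto simp: follows_def init_Suc)
    then obtain n where n: "n \<ge> Suc (length p)" "init x n \<notin> T i"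
      "\<And>m. Suc (length p) \<le> m \<and> m \<le> n \<Longrightarrow> \<not> wins W (init x m)"
      using t unfolding forces_def by force
    have "\<not> wins W (init x m)" if "length p \<le> m" "m \<le> n" for m
      using n(3)[of m] that first(1) px by (cases "m = length p") auto
    then show "\<exists>n\<ge>length p. init x n \<notin> T i \<and> (\<forall>m. length p \<le> m \<and> m \<le> n \<longrightarrow> \<not> wins W (init x m))"
      using n by (intro exI[of _ n]) auto
  qed
  then show ?case by blast
next
  case (second p k)
  then obtain t where t: "forces i (p @ [k]) t" by blast
  have "forces i p (\<lambda>q. if length q = length p then k else t q)"
    unfolding forces_def
  proof (intro allI impI)
    fix x assume x: "follows odd (\<lambda>q. if length q = length p then k else t q) p x"
    then have px: "init x (length p) = p" by (simp add: follows_def)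
    have "x (length p) = k" using x second(2) by (simp add: follows_def)
    then have "follows odd t (p @ [k]) x"
      using x by (auto simp: follows_def init_Suc)
    then obtain n where n: "n \<ge> Suc (length p)" "init x n \<notin> T i"
      "\<And>m. Suc (length p) \<le> m \<and> m \<le> n \<Longrightarrow> \<not> wins W (init x m)"
      using t unfolding forces_def by force
    have "\<not> wins W (init x m)" if "length p \<le> m" "m \<le> n" for m
      using n(3)[of m] that second(1) px by (cases "m = length p") auto
    then show "\<exists>n\<ge>length p. init x n \<notin> T i \<and> (\<forall>m. length p \<le> m \<and> m \<le> n \<longrightarrow> \<not> wins W (init x m))"
      using n by (intro exI[of _ n]) auto
  qed
  then show ?case by blast
qed

text \<open>
  The second player always forces the play out of the first \<open>T i\<close> that it has not left yet,
  starting afresh whenever that index changes.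
\<close>

theorem determined: "wins W p \<or> second_wins W p"
proof (rule disjCI)
  assume "\<not> second_wins W p"
  show "wins W p"
  proof (rule ccontr)
    assume nw: "\<not> wins W p"
    have "\<forall>iq. \<exists>\<tau>. \<not> wins W (snd iq) \<longrightarrow> forces (fst iq) (snd iq) \<tau>"
      using wins_if_not_Z forces_if_Z by blast
    from choice[OF this] obtain f where "\<forall>iq. \<not> wins W (snd iq) \<longrightarrow> forces (fst iq) (snd iq) (f iq)"
      by blast
    then have f: "\<And>i q. \<not> wins W q \<Longrightarrow> forces i q (f (i, q))" by simp
    \<comment> \<open>Outside every \<open>T i\<close> this value is unspecified, but then no
      continuation of \<open>q\<close> lies in \<open>W\<close>.\<close>
    define \<iota> where "\<iota> q = (LEAST i. q \<in> T i)" for q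
    \<comment> \<open>Along a play the index never decreases, so the least such \<open>n\<close> is
      the time at which the current index was reached; the strategy chosen at that position is kept
      for the whole phase.\<close>
    define S where "S q n \<longleftrightarrow> length p \<le> n \<and> n \<le> length q \<and> \<iota> (take n q) = \<iota> q" for q n
    define \<tau> where "\<tau> q = f (\<iota> q, take (LEAST n. S q n) q) q" for q
    have "x \<notin> W" if x: "follows odd \<tau> p x" for x
    proof
      assume "x \<in> W"
      then obtain i0 where i0: "x \<in> K i0" by blast
      have px: "init x (length p) = p" using x by (simp add: follows_def)
      have T0: "init x n \<in> T i0" for n using i0 by (auto simp: T_def)
      have \<iota>T: "init x n \<in> T (\<iota> (init x n))" for n
        unfolding \<iota>_def by (rule LeastI[of "\<lambda>i. init x n \<in> T i"]) (rule T0)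
      have \<iota>le: "\<iota> (init x n) \<le> i0" for n unfolding \<iota>_def by (rule Least_le) (rule T0)
      have mono: "\<iota> (init x m) \<le> \<iota> (init x n)" if "m \<le> n" for m n
        unfolding \<iota>_def[of "init x m"] by (rule Least_le) (rule T_init[OF \<iota>T that])
      define start where "start n \<longleftrightarrow> length p \<le> n \<and>
        (\<forall>m. length p \<le> m \<and> m < n \<longrightarrow> \<iota> (init x m) \<noteq> \<iota> (init x n)) \<and> \<not> wins W (init x n)" for n
      have step: "\<exists>n1. start n1 \<and> \<iota> (init x n0) < \<iota> (init x n1)" if n0: "start n0" for n0
      proof -
        define i where "i = \<iota> (init x n0)"
        define t where "t = f (i, init x n0)"
        have t: "forces i (init x n0) t" unfolding t_def by (rule f) (use n0 in \<open>simp add: start_def\<close>)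
        have n0p: "length p \<le> n0" using n0 by (simp add: start_def)
        have xt: "x m = t (init x m)" if m: "n0 \<le> m" "odd m" "\<iota> (init x m) = i" for m
        proof -
          have "(LEAST n. S (init x m) n) = n0"
          proof (rule Least_equality)
            show "S (init x m) n0" using m n0p by (simp add: S_def i_def)
            fix n assume n: "S (init x m) n"
            then have "\<iota> (init x n) = i" "length p \<le> n" using m by (auto simp: S_def)
            then show "n0 \<le> n" using n0 unfolding start_def i_def by (metis not_le)
          qed
          then have "\<tau> (init x m) = t (init x m)" using m by (simp add: \<tau>_def t_def)
          then show ?thesis using x m n0p by (simp add: follows_def)
        qed
        have "\<exists>n\<ge>n0. \<iota> (init x n) \<noteq> i"
        proof (rule ccontr)
          assume "\<not> (\<exists>n\<ge>n0. \<iota> (init x n) \<noteq> i)"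
          then have c: "\<And>n. n \<ge> n0 \<Longrightarrow> \<iota> (init x n) = i" by blast
          then have "follows odd t (init x n0) x" using xt by (simp add: follows_def)
          then obtain n where "n \<ge> n0" "init x n \<notin> T i" using t unfolding forces_def by auto
          then show False using c \<iota>T by metis
        qed
        then obtain n1 where n1: "n1 \<ge> n0" "\<iota> (init x n1) \<noteq> i"
          "\<And>m. m < n1 \<Longrightarrow> \<not> (m \<ge> n0 \<and> \<iota> (init x m) \<noteq> i)"
          using exists_least_iff[of "\<lambda>n. n \<ge> n0 \<and> \<iota> (init x n) \<noteq> i"] by blast
        have less: "i < \<iota> (init x n1)" using mono[OF n1(1)] n1(2) by (simp add: i_def)
        \<comment> \<open>The play \<open>x\<close> is known to follow \<open>t\<close> only before
          \<open>n1\<close>. Prolonging its prefix by \<open>t\<close> gives a play \<open>y\<close>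
          that leaves \<open>T i\<close>, and not before \<open>n1\<close>; hence the position at
          \<open>n1\<close> is not won by the first player and can serve as a new start.\<close>
        obtain y where y: "init y n1 = init x n1" "\<And>n. n \<ge> n1 \<Longrightarrow> y n = t (init y n)"
          using play_exists[of "init x n1" t] by auto
        have yx: "init y m = init x m" if "m \<le> n1" for m
          using init_eq_mono[OF y(1) that] .
        have "y m = t (init y m)" if m: "n0 \<le> m" "odd m" for m
        proof (cases "m < n1")
          case True
          then have "y m = x m" using y(1) by (simp add: init_eq_iff)
          then show ?thesis using xt[OF m] n1(3)[OF True] m True yx[of m] by simp
        qed (use y in simp)
        then have "follows odd t (init x n0) y" using yx n1(1) by (simp add: follows_def)
        then obtain n where n: "n \<ge> n0" "init y n \<notin> T i"
          "\<And>m. n0 \<le> m \<Longrightarrow> m \<le> n \<Longrightarrow> \<not> wins W (init y m)"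
          using t unfolding forces_def by auto
        have "n1 \<le> n"
        proof (rule ccontr)
          assume "\<not> n1 \<le> n"
          then have "init y n = init x n" "\<iota> (init x n) = i" using yx n1(3) n(1) by auto
          then show False using \<iota>T n(2) by metis
        qed
        then have "\<not> wins W (init x n1)" using n(3)[of n1] n1(1) yx by simp
        moreover have "\<iota> (init x m) \<noteq> \<iota> (init x n1)" if m: "m < n1" for m
        proof (cases "m < n0")
          case True
          then show ?thesis using mono[of m n0] less by (simp add: i_def)
        qed (use n1(3)[OF m] less in auto)
        ultimately show ?thesis using less n0p n1(1) unfolding start_def i_def
          by (intro exI[of _ n1]) auto
      qed
      have "\<exists>n. start n \<and> k \<le> \<iota> (init x n)" for k
      proof (induction k)
        case 0
        have "start (length p)" using nw px by (simp add: start_def)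
        then show ?case by blast
      next
        case (Suc k)
        then obtain n where n: "start n" "k \<le> \<iota> (init x n)" by blast
        obtain n1 where "start n1" "\<iota> (init x n) < \<iota> (init x n1)" using step[OF n(1)] by blast
        then show ?case using n(2) by (intro exI[of _ n1]) simp
      qed
      from this[of "Suc i0"] show False using \<iota>le by (meson not_less_eq_eq)
    qed
    then have "second_wins W p" unfolding second_wins_def by blast
    then show False using \<open>\<not> second_wins W p\<close> by contradiction
  qed
qed

end

section \<open>Finitely branching trees\<close>

primrec level :: "('a list \<Rightarrow> 'a set) \<Rightarrow> nat \<Rightarrow> 'a list set" where
  "level mv 0 = {[]}"
| "level mv (Suc n) = (\<Union>p\<in>level mv n. (\<lambda>k. p @ [k]) ` mv p)"

lemma in_level: "q \<in> level mv n \<longleftrightarrow> length q = n \<and> (\<forall>j<n. q ! j \<in> mv (take j q))"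
proof (induction n arbitrary: q)
  case (Suc n)
  show ?case
  proof (cases q rule: rev_cases)
    case (snoc p k)
    have "q \<in> level mv (Suc n) \<longleftrightarrow> p \<in> level mv n \<and> k \<in> mv p"
      by (auto simp: snoc)
    then show ?thesis using Suc[of p] snoc by (auto simp: nth_append less_Suc_eq)
  qed auto
qed auto

lemma finite_level: "(\<And>p. finite (mv p)) \<Longrightarrow> finite (level mv n)"
  by (induction n) auto

theorem koenig:
  assumes fin: "\<And>p. finite (mv p)" and ne: "\<And>n. level mv n \<noteq> {}"
  shows "\<exists>x. \<forall>n. x n \<in> mv (init x n)"
proof -
  define good where "good p \<longleftrightarrow> (\<forall>m. \<exists>q\<in>level mv (length p + m). take (length p) q = p)" for p
  have ext: "\<exists>k\<in>mv p. good (p @ [k])" if "good p" for p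
  proof (rule ccontr)
    assume "\<not> ?thesis"
    then have "\<forall>k\<in>mv p. \<exists>m. \<forall>q\<in>level mv (Suc (length p) + m). take (Suc (length p)) q \<noteq> p @ [k]"
      unfolding good_def by auto
    then obtain b where b: "\<And>k q. k \<in> mv p \<Longrightarrow> q \<in> level mv (Suc (length p) + b k) \<Longrightarrow>
        take (Suc (length p)) q \<noteq> p @ [k]"
      by metis
    \<comment> \<open>The sum bounds all \<open>b k\<close> with \<open>k\<close> in the finite set
      \<open>mv p\<close>, so one length contradicts every successor.\<close>
    define B where "B = (\<Sum>k\<in>mv p. b k)"
    obtain q where q: "q \<in> level mv (length p + Suc B)" "take (length p) q = p"
      using \<open>good p\<close> unfolding good_def by blast
    define k where "k = q ! length p"
    have len: "length q = length p + Suc B" using q(1)[unfolded in_level] by blast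
    have "q ! length p \<in> mv (take (length p) q)" using q(1) unfolding in_level by simp
    then have k: "k \<in> mv p" by (simp only: q(2) k_def)
    have "b k \<le> B" unfolding B_def by (rule member_le_sum[OF k]) (use fin in auto)
    then have "take (Suc (length p) + b k) q \<in> level mv (Suc (length p) + b k)"
      using q(1) unfolding in_level by (auto simp: min_def)
    moreover have "take (Suc (length p)) (take (Suc (length p) + b k) q) = p @ [k]"
      using q(2) len by (simp add: take_Suc_conv_app_nth k_def)
    ultimately show False using b[OF k] by blast
  qed
  define \<phi> where "\<phi> p = (SOME k. k \<in> mv p \<and> good (p @ [k]))" for p
  have \<phi>: "\<phi> p \<in> mv p \<and> good (p @ [\<phi> p])" if "good p" for p
    unfolding \<phi>_def by (rule someI_ex) (use ext[OF that] in blast)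
  obtain x where x: "\<And>n. x n = \<phi> (init x n)" using play_exists[of "[]" \<phi>] by auto
  have "good (init x n)" for n
  proof (induction n)
    case 0
    then show ?case using ne by (auto simp: good_def)
  next
    case (Suc n)
    then show ?case using \<phi> x unfolding init_Suc by metis
  qed
  then show ?thesis using \<phi> x by metis
qed

section \<open>Changing the starting position\<close>

text \<open>If \<open>p\<close> has odd length, then the second player is to move at
  \<open>p\<close>, while \<open>y 0\<close> belongs to the first; that move is discarded, which
  keeps the parity of the others right.\<close>

definition continue :: "'a list \<Rightarrow> (nat \<Rightarrow> 'a) \<Rightarrow> nat \<Rightarrow> 'a" where
  "continue p y n = (if n < length p then p ! n else y (n - length p + length p mod 2))"

lemma wins_continue: "wins W p \<longleftrightarrow> wins {y. continue p y \<in> W} []"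
proof
  let ?r = "length p mod 2"
  assume "wins W p"
  then obtain \<sigma> where \<sigma>: "\<And>x. follows even \<sigma> p x \<Longrightarrow> x \<in> W" by (auto simp: wins_def)
  have "continue p y \<in> W" if y: "follows even (\<lambda>q. \<sigma> (p @ drop ?r q)) [] y" for y
  proof (rule \<sigma>)
    have "continue p y n = \<sigma> (init (continue p y) n)" if n: "n \<ge> length p" "even n" for n
    proof -
      have e: "even (n - length p + ?r)"
        using n by (cases "even (length p)") (auto simp: odd_iff_mod_2_eq_one)
      have "init (continue p y) n = p @ drop ?r (init y (n - length p + ?r))"
        using n by (auto simp: list_eq_iff_nth_eq nth_append continue_def add.commute)
      then show ?thesis using y e n by (simp add: follows_def continue_def)
    qed
    then show "follows even \<sigma> p (continue p y)"
      by (simp add: follows_def init_eq_iff_nth) (simp add: continue_def)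
  qed
  then show "wins {y. continue p y \<in> W} []" unfolding wins_def by blast
next
  let ?r = "length p mod 2"
  assume "wins {y. continue p y \<in> W} []"
  then obtain \<sigma> where \<sigma>: "\<And>y. follows even \<sigma> [] y \<Longrightarrow> continue p y \<in> W" by (auto simp: wins_def)
  have "x \<in> W" if x: "follows even (\<lambda>q. \<sigma> (replicate ?r (\<sigma> []) @ drop (length p) q)) p x" for x
  proof -
    \<comment> \<open>The discarded opening move, present if \<open>p\<close> has odd length, is
      filled in by \<open>\<sigma> []\<close>.\<close>
    define y where "y k = (if k < ?r then \<sigma> [] else x (k - ?r + length p))" for k
    have "continue p y = x"
      using x by (auto simp: fun_eq_iff continue_def y_def follows_def init_eq_iff_nth)
    moreover have "follows even \<sigma> [] y"
    proof -
      have "y n = \<sigma> (init y n)" if n: "even n" for n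
      proof (cases "n < ?r")
        case True
        then have "n = 0" by (simp add: mod2_eq_if split: if_splits)
        then show ?thesis using True by (simp add: y_def)
      next
        case False
        have e: "even (n - ?r + length p)"
          using n False by (cases "even (length p)") (auto simp: odd_iff_mod_2_eq_one)
        have "init y n = replicate ?r (\<sigma> []) @ drop (length p) (init x (n - ?r + length p))"
          using False by (auto simp: list_eq_iff_nth_eq nth_append y_def add.commute)
        then show ?thesis using x e False by (simp add: follows_def y_def)
      qed
      then show ?thesis by (simp add: follows_def)
    qed
    ultimately show ?thesis using \<sigma> by metis
  qed
  then show "wins W p" unfolding wins_def by blast
qed

lemma init_comp: "init (f \<circ> x) n = map f (init x n)"
  by (simp add: init_def)

lemma wins_bij_imp:
  assumes "bij f" "wins {x. f \<circ> x \<in> W} p"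
  shows "wins W (map f p)"
proof -
  obtain \<sigma> where \<sigma>: "\<And>x. follows even \<sigma> p x \<Longrightarrow> f \<circ> x \<in> W" using assms(2) by (auto simp: wins_def)
  have inv: "inv f \<circ> f = id" "f \<circ> inv f = id"
    using bij_is_inj[OF assms(1)] bij_is_surj[OF assms(1)] by (simp_all flip: surj_iff)
  have "y \<in> W" if y: "follows even (\<lambda>q. f (\<sigma> (map (inv f) q))) (map f p) y" for y
  proof -
    have "follows even \<sigma> p (inv f \<circ> y)"
      using y inv(1) unfolding follows_def init_comp
      by (auto simp: map_idI o_def fun_eq_iff bij_is_inj[OF assms(1)])
    moreover have "f \<circ> (inv f \<circ> y) = y" using inv(2) by (simp add: o_assoc)
    ultimately show ?thesis using \<sigma> by metis
  qed
  then show ?thesis unfolding wins_def by blast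
qed

lemma wins_bij:
  assumes "bij f"
  shows "wins {x. f \<circ> x \<in> W} p \<longleftrightarrow> wins W (map f p)"
proof
  have inv: "inv f \<circ> f = id" "f \<circ> inv f = id"
    using bij_is_inj[OF assms] bij_is_surj[OF assms] by (simp_all flip: surj_iff)
  assume "wins W (map f p)"
  moreover have "W = {y. inv f \<circ> y \<in> {x. f \<circ> x \<in> W}}"
    by (simp add: o_assoc inv(2))
  ultimately have "wins {y. inv f \<circ> y \<in> {x. f \<circ> x \<in> W}} (map f p)" by (simp only:)
  then have "wins {x. f \<circ> x \<in> W} (map (inv f) (map f p))"
    by (rule wins_bij_imp[OF bij_imp_bij_inv[OF assms]])
  then show "wins {x. f \<circ> x \<in> W} p" using inv(1) by simp
qed (rule wins_bij_imp[OF assms])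

section \<open>Games on codes\<close>

definition N :: "nat \<Rightarrow> (nat \<Rightarrow> nat) set" where
  "N e = {y. \<exists>i. \<not> halts (machine_decode e) [y] i}"

lemma Sigma02_set_N: "Sigma02_set e = {x. int_encode \<circ> x \<in> N e}"
  by (simp add: Sigma02_set_def N_def halts_def)

lemma wins_Sigma02_set: "winning_position (Sigma02_set e) p \<longleftrightarrow> wins (N e) (map int_encode p)"
  unfolding winning_position_wins Sigma02_set_N by (rule wins_bij[OF bij_int_encode])

lemma quantifier_iff: "e \<in> Sigma02_game_quantifier \<longleftrightarrow> wins (N e) []"
  by (simp add: Sigma02_game_quantifier_def first_player_wins_def wins_Sigma02_set)

lemma winning_position_codes_iff:
  "n \<in> winning_position_codes (Sigma02_set e) \<longleftrightarrow> wins (N e) (list_decode n)"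
proof
  assume "wins (N e) (list_decode n)"
  then have "winning_position (Sigma02_set e) (map int_decode (list_decode n))"
    by (simp add: wins_Sigma02_set o_def)
  moreover have "n = list_encode (map int_encode (map int_decode (list_decode n)))"
    by (simp add: o_def)
  ultimately show "n \<in> winning_position_codes (Sigma02_set e)"
    unfolding winning_position_codes_def by blast
qed (auto simp: winning_position_codes_def wins_Sigma02_set)

lemma answer_single: "answer [y] i k = (if i = 0 then y k else 0)"
  by (simp add: answer_def)

lemma N_determined: "wins (N e) p \<or> second_wins (N e) p"
proof -
  interpret closed_union "\<lambda>i. {y. \<not> halts (machine_decode e) [y] i}"
  proof
    fix y i
    let ?M = "machine_decode e"
    assume "y \<notin> {y. \<not> halts ?M [y] i}"
    then obtain s where s: "halted ?M (run ?M [y] i s)" by (auto simp: halts_def)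
    obtain m where m: "\<And>Os. \<forall>i. \<forall>k<m. answer Os i k = answer [y] i k \<Longrightarrow> run ?M Os i s = run ?M [y] i s"
      using run_use by blast
    have "halts ?M [y'] i" if "init y' m = init y m" for y'
      unfolding halts_def by (rule exI[of _ s])
        (use m[of "[y']"] that s in \<open>auto simp: answer_single init_eq_iff\<close>)
    then show "\<exists>n. \<forall>y'. init y' n = init y n \<longrightarrow> y' \<notin> {y. \<not> halts ?M [y] i}" by blast
  qed
  have "(\<Union>i. {y. \<not> halts (machine_decode e) [y] i}) = N e" by (auto simp: N_def)
  then show ?thesis using determined[of p] by simp
qed

lemma halts_total: "halts (machine_decode e) Os i \<longleftrightarrow> (\<exists>s. chalts (total_oracle Os) e i s)"
  using chalts_iff[OF consistent_total crun_total] by (simp add: halts_def)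

lemma total_oracle_single: "total_oracle [y] = (\<lambda>i k. if i = 0 then Suc (y k) else 1)"
  by (auto simp: total_oracle_def answer_single fun_eq_iff)

lemma total_oracle_Nil: "total_oracle [] = (\<lambda>_ _. 1)"
  by (auto simp: total_oracle_def answer_def fun_eq_iff)

text \<open>A computable reduction enters a primitive recursive predicate as a simulation with a
  guessed step count; any count at which the machine has halted yields the same output. The constant
  oracle 1 is \<open>total_oracle []\<close>, all queries being answered by 0.\<close>

lemma computable_code:
  assumes "computable g"
  obtains e where "\<And>n. \<exists>s. chalts (\<lambda>_ _. 1) e n s"
    "\<And>n s. chalts (\<lambda>_ _. 1) e n s \<Longrightarrow> coutput (\<lambda>_ _. 1) e n s = g n"
proof -
  obtain M where M: "\<And>n. \<exists>s. halted M (run M [] n s) \<and> tape_number (snd (run M [] n s) 0) = g n"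
    using assms by (auto simp: computable_def)
  obtain e where e: "machine_decode e = M" using surj_machine_decode by (metis surjD)
  have iff: "chalts (\<lambda>_ _. 1) e n s \<longleftrightarrow> halted M (run M [] n s)" for n s
    using chalts_iff[OF consistent_total crun_total, of "[]" e n s] by (simp add: total_oracle_Nil e)
  have out: "coutput (\<lambda>_ _. 1) e n s = tape_number (snd (run M [] n s) 0)" for n s
    using coutput_eq[OF consistent_total crun_total, of "[]" e n s] by (simp add: total_oracle_Nil e)
  show ?thesis
  proof (rule that)
    show "\<exists>s. chalts (\<lambda>_ _. 1) e n s" for n using M[of n] iff by blast
    show "coutput (\<lambda>_ _. 1) e n s = g n" if h: "chalts (\<lambda>_ _. 1) e n s" for n s
    proof -
      obtain s0 where s0: "halted M (run M [] n s0)" "tape_number (snd (run M [] n s0) 0) = g n"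
        using M by blast
      have "run M [] n s = run M [] n s0"
        using halted_run_mono[OF s0(1), of s] halted_run_mono[of M "[]" n s s0] h[unfolded iff]
        by (metis nat_le_linear)
      then show ?thesis using s0 out by simp
    qed
  qed
qed

text \<open>One payoff set serves all \<open>n\<close>: a play starts with a move naming
  \<open>n\<close> and an ignored move of the second player, and continues as the game coded by
  \<open>g n\<close>. The position \<open>[n, 0]\<close> is equivalent to that game.\<close>

theorem reducible_to_positions:
  assumes "L \<le>\<^sub>m Sigma02_game_quantifier"
  shows "\<exists>W. lightface_Sigma02 W \<and> L \<le>\<^sub>m winning_position_codes W"
proof -
  obtain g where g: "computable g" "\<And>n. n \<in> L \<longleftrightarrow> wins (N (g n)) []"
    using assms by (auto simp: many_one_reducible_def quantifier_iff)
  obtain eg where eg: "\<And>n. \<exists>s. chalts (\<lambda>_ _. 1) eg n s"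
    "\<And>n s. chalts (\<lambda>_ _. 1) eg n s \<Longrightarrow> coutput (\<lambda>_ _. 1) eg n s = g n"
    using computable_code[OF g(1)] by blast
  define P where "P Os z \<longleftrightarrow> chalts (\<lambda>_ _. 1) eg (answer Os 0 0) (pfst (psnd (psnd z))) \<and>
    chalts (\<lambda>i k. if i = 0 then Suc (answer Os 0 (k + 2)) else 1)
      (coutput (\<lambda>_ _. 1) eg (answer Os 0 0) (pfst (psnd (psnd z)))) (pfst (psnd z))
      (psnd (psnd (psnd z)))" for Os z
  have "dec P" unfolding P_def by (intro pr_intros)
  from search_machine[OF this] obtain G where
    G: "\<And>c Os i. halts (machine_decode (G c)) Os i \<longleftrightarrow> (\<exists>n. P Os (pair c (pair i n)))" by blast
  define e where "e = G 0"
  have e: "halts (machine_decode e) [y] i \<longleftrightarrow> halts (machine_decode (g (y 0))) [\<lambda>k. y (k + 2)] i"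
    (is "?l \<longleftrightarrow> ?r") for y i
  proof
    assume ?l
    then obtain m where m: "P [y] (pair 0 (pair i m))" unfolding e_def G by blast
    note m = m[unfolded P_def pfst_pair psnd_pair answer_single simp_thms if_True]
    show ?r
      using m unfolding halts_total total_oracle_single eg(2)[OF conjunct1[OF m]] by blast
  next
    assume ?r
    then obtain s2 where s2: "chalts (total_oracle [\<lambda>k. y (k + 2)]) (g (y 0)) i s2"
      by (auto simp: halts_total)
    obtain s1 where s1: "chalts (\<lambda>_ _. 1) eg (y 0) s1" using eg(1) by blast
    have "P [y] (pair 0 (pair i (pair s1 s2)))"
      using s1 s2 unfolding P_def pfst_pair psnd_pair answer_single simp_thms if_True eg(2)[OF s1]
        total_oracle_single by blast
    then show ?l unfolding e_def G by blast
  qed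
  have "continue [n, 0] y (k + 2) = y k" for n k and y :: "nat \<Rightarrow> nat"
    by (simp add: continue_def)
  moreover have "continue [n, 0] y 0 = n" for n and y :: "nat \<Rightarrow> nat"
    by (simp add: continue_def)
  ultimately have "wins (N e) [n, 0] \<longleftrightarrow> wins (N (g n)) []" for n
    unfolding wins_continue[of _ "[n, 0]"] by (simp add: N_def e)
  then have "n \<in> L \<longleftrightarrow> lcons n (lcons 0 0) \<in> winning_position_codes (Sigma02_set e)" for n
    by (simp add: winning_position_codes_iff g(2))
  moreover have "computable (\<lambda>n. lcons n (lcons 0 0))"
    by (rule computable_pr[where F = "\<lambda>_ n. lcons n (lcons 0 0)"]) (intro pr_intros)
  ultimately have "L \<le>\<^sub>m winning_position_codes (Sigma02_set e)"
    unfolding many_one_reducible_def by blast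
  then show ?thesis unfolding lightface_Sigma02_def by blast
qed

text \<open>The game from the position coded by \<open>g n\<close> becomes a game from the start
  when \<open>continue\<close> is built into the oracle; the code of the new payoff is computable
  from \<open>n\<close>.\<close>

theorem positions_reducible:
  assumes "lightface_Sigma02 W" "L \<le>\<^sub>m winning_position_codes W"
  shows "L \<le>\<^sub>m Sigma02_game_quantifier"
proof -
  obtain e where e: "W = Sigma02_set e" using assms(1) by (auto simp: lightface_Sigma02_def)
  obtain g where g: "computable g" "\<And>n. n \<in> L \<longleftrightarrow> wins (N e) (list_decode (g n))"
    using assms(2) by (auto simp: many_one_reducible_def winning_position_codes_iff e)
  obtain eg where eg: "\<And>n. \<exists>s. chalts (\<lambda>_ _. 1) eg n s"
    "\<And>n s. chalts (\<lambda>_ _. 1) eg n s \<Longrightarrow> coutput (\<lambda>_ _. 1) eg n s = g n"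
    using computable_code[OF g(1)] by blast
  define c where "c Os p k = (if k < llen p then lnth p k
    else answer Os 0 (k - llen p + (if even (llen p) then 0 else 1)))" for Os p k
  have c: "c [y] p = continue (list_decode p) y" for y p
    by (auto simp: c_def continue_def fun_eq_iff lnth_eq llen_def answer_single mod2_eq_if)
  define P where "P Os z \<longleftrightarrow> chalts (\<lambda>_ _. 1) eg (pfst z) (pfst (psnd (psnd z))) \<and>
    chalts (\<lambda>i k. if i = 0 then Suc (c Os (coutput (\<lambda>_ _. 1) eg (pfst z) (pfst (psnd (psnd z)))) k) else 1)
      e (pfst (psnd z)) (psnd (psnd (psnd z)))" for Os z
  have "dec P" unfolding P_def c_def by (intro pr_intros)
  from search_machine[OF this] obtain G where G: "computable G"
    "\<And>c Os i. halts (machine_decode (G c)) Os i \<longleftrightarrow> (\<exists>n. P Os (pair c (pair i n)))" by blast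
  have "halts (machine_decode (G n)) [y] i \<longleftrightarrow>
      halts (machine_decode e) [continue (list_decode (g n)) y] i" (is "?l \<longleftrightarrow> ?r") for n y i
  proof
    assume ?l
    then obtain m where m: "P [y] (pair n (pair i m))" unfolding G by blast
    note m = m[unfolded P_def pfst_pair psnd_pair c]
    show ?r
      using m unfolding halts_total total_oracle_single eg(2)[OF conjunct1[OF m]] by blast
  next
    assume ?r
    then obtain s2 where s2: "chalts (total_oracle [continue (list_decode (g n)) y]) e i s2"
      by (auto simp: halts_total)
    obtain s1 where s1: "chalts (\<lambda>_ _. 1) eg n s1" using eg(1) by blast
    have "P [y] (pair n (pair i (pair s1 s2)))"
      using s1 s2 unfolding P_def pfst_pair psnd_pair c eg(2)[OF s1] total_oracle_single by blast
    then show ?l unfolding G by blast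
  qed
  then have "N (G n) = {y. continue (list_decode (g n)) y \<in> N e}" for n
    by (simp add: N_def)
  then have "n \<in> L \<longleftrightarrow> G n \<in> Sigma02_game_quantifier" for n
    by (simp add: quantifier_iff g(2) wins_continue[of _ "list_decode (g n)"])
  then show ?thesis unfolding many_one_reducible_def using G(1) by blast
qed

section \<open>From recognizability to games\<close>

lemma recognizes_2:
  "recognizes 2 T f L \<longleftrightarrow> (\<forall>A1 A2 S. (\<forall>n. A1 n > f (\<lambda>_. 0) n) \<longrightarrow> (\<forall>n. A2 n > f A1 n) \<longrightarrow>
     (halts T [A1, A2] S \<longleftrightarrow> S \<in> L))"
proof -
  have m: "map A [1..<Suc 2] = [A 1, A 2]" for A :: "nat \<Rightarrow> nat \<Rightarrow> nat"
    by (simp add: upt_rec numeral_2_eq_2)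
  have all2: "(\<forall>i<2. Q i) \<longleftrightarrow> Q 0 \<and> Q 1" for Q :: "nat \<Rightarrow> bool"
    by (auto simp: less_2_cases_iff)
  have fg: "fast_growing_sequence 2 f A \<longleftrightarrow>
      A 0 = (\<lambda>_. 0) \<and> (\<forall>n. A 1 n > f (A 0) n) \<and> (\<forall>n. A 2 n > f (A 1) n)" for A
    unfolding fast_growing_sequence_def all2 by (simp add: numeral_2_eq_2)
  show ?thesis
  proof
    assume r: "recognizes 2 T f L"
    show "\<forall>A1 A2 S. (\<forall>n. A1 n > f (\<lambda>_. 0) n) \<longrightarrow> (\<forall>n. A2 n > f A1 n) \<longrightarrow>
     (halts T [A1, A2] S \<longleftrightarrow> S \<in> L)"
    proof (intro allI impI)
      fix A1 A2 S
      assume A: "\<forall>n. A1 n > f (\<lambda>_. 0) n" "\<forall>n. A2 n > f A1 n"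
      define A where "A i = (if i = 0 then \<lambda>_. 0 else if i = 1 then A1 else A2)" for i :: nat
      have "fast_growing_sequence 2 f A" unfolding fg using A by (simp add: A_def)
      then have "halts T (map A [1..<Suc 2]) S \<longleftrightarrow> S \<in> L" using r by (simp add: recognizes_def)
      then show "halts T [A1, A2] S \<longleftrightarrow> S \<in> L" unfolding m by (simp add: A_def)
    qed
  next
    assume h: "\<forall>A1 A2 S. (\<forall>n. A1 n > f (\<lambda>_. 0) n) \<longrightarrow> (\<forall>n. A2 n > f A1 n) \<longrightarrow>
     (halts T [A1, A2] S \<longleftrightarrow> S \<in> L)"
    show "recognizes 2 T f L" unfolding recognizes_def fg m
    proof (intro allI impI, elim conjE)
      fix A S
      assume "A 0 = (\<lambda>_. 0)" "\<forall>n. A 1 n > f (A 0) n" "\<forall>n. A 2 n > f (A 1) n"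
      then show "halts T [A 1, A 2] S \<longleftrightarrow> S \<in> L"
        using h[rule_format, of "A 1" "A 2" S] by simp
    qed
  qed
qed

text \<open>
  In the game for input \<open>S\<close>, the first player's \<open>n\<close>-th move is a lower bound for the value of the
  first oracle at \<open>n\<close>. The second player's \<open>n\<close>-th move \<open>pair a w\<close> fixes that value by adding
  \<open>Suc a\<close> to the bound; if \<open>w = Suc (pair k v)\<close>, then it also announces that all second oracles
  above \<open>v\<close> at \<open>k\<close> are to be considered. The first player wins if some announcement is never made,
  or if the machine halts for some second oracle above the announced values.
\<close>

definition first_oracle :: "(nat \<Rightarrow> nat) \<Rightarrow> nat \<Rightarrow> nat" where
  "first_oracle y n = Suc (y (n + n) + pfst (y (Suc (n + n))))"

definition announced :: "(nat \<Rightarrow> nat) \<Rightarrow> nat \<Rightarrow> nat \<Rightarrow> nat" where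
  "announced y m k = bfind m (\<lambda>n.
     if psnd (y (Suc (n + n))) \<noteq> 0 \<and> pfst (psnd (y (Suc (n + n))) - 1) = k
     then Suc (psnd (psnd (y (Suc (n + n))) - 1)) else 0)"

text \<open>The earliest announcement for \<open>k\<close> counts; if there is none, the value is
  0.\<close>

definition bound :: "(nat \<Rightarrow> nat) \<Rightarrow> nat \<Rightarrow> nat" where
  "bound y k = announced y (LEAST m. announced y m k \<noteq> 0) k - 1"

text \<open>The second oracle at \<open>k\<close> is the announced bound plus 1 plus the excess
  listed in \<open>l\<close>, and is available only if \<open>k\<close> is announced within the
  first \<open>m\<close> moves of the second player. One \<open>Suc\<close> for strictness is
  already part of \<open>announced\<close>; the other marks availability.\<close>

definition play_oracle :: "(nat \<Rightarrow> nat) \<Rightarrow> nat \<Rightarrow> nat \<Rightarrow> nat \<Rightarrow> nat \<Rightarrow> nat" where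
  "play_oracle y l m = (\<lambda>j k. if j = 0 then Suc (first_oracle y k)
     else if j = 1 then if announced y m k = 0 then 0 else Suc (announced y m k + lnth l k)
     else 1)"

lemma announced_bound: "announced y m k \<noteq> 0 \<Longrightarrow> announced y m k = Suc (bound y k)"
proof -
  assume a: "announced y m k \<noteq> 0"
  let ?m = "LEAST m. announced y m k \<noteq> 0"
  have 1: "announced y ?m k \<noteq> 0" by (rule LeastI[of "\<lambda>m. announced y m k \<noteq> 0"]) (rule a)
  have "?m \<le> m" by (rule Least_le) (rule a)
  then have "announced y m k = announced y ?m k"
    using 1 unfolding announced_def by (intro bfind_mono) auto
  then show ?thesis using 1 unfolding bound_def by simp
qed

lemma consistent_play_oracle:
  "consistent (play_oracle y l m) [first_oracle y, \<lambda>k. Suc (bound y k + lnth l k)]"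
  unfolding consistent_def
proof (intro allI impI)
  fix j k v
  assume "play_oracle y l m j k = Suc v"
  then show "v = answer [first_oracle y, \<lambda>k. Suc (bound y k + lnth l k)] j k"
    using announced_bound[of y m k]
    by (auto simp: play_oracle_def answer_def less_Suc_eq nth_Cons' split: if_splits)
qed

theorem nonlocally_recognizable_reducible:
  assumes "nonlocally_recognizable 2 L"
  shows "L \<le>\<^sub>m Sigma02_game_quantifier"
proof -
  obtain T f where "recognizes 2 T f L" using assms by (auto simp: nonlocally_recognizable_def)
  then have rec: "halts T [A1, A2] S \<longleftrightarrow> S \<in> L"
    if "\<And>n. A1 n > f (\<lambda>_. 0) n" "\<And>n. A2 n > f A1 n" for A1 A2 S
    unfolding recognizes_2 using that by blast
  define f0 where "f0 = f (\<lambda>_. 0)"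
  obtain e where e: "machine_decode e = T" using surj_machine_decode by (metis surjD)
  \<comment> \<open>An input \<open>i = pair l s\<close> guesses a list of excesses and a step
    count; \<open>m\<close> says how many moves to inspect. The search succeeds if the announcements
    required for \<open>s\<close> steps appear and the run has not halted by then. Divergence thus
    means a missing announcement or a halting run.\<close>
  define P where "P Os z \<longleftrightarrow>
    crun (play_oracle (answer Os 0) (pfst (pfst (psnd z))) (psnd (psnd z))) e (pfst z) (psnd (pfst (psnd z))) \<noteq> 0 \<and>
    \<not> chalts (play_oracle (answer Os 0) (pfst (pfst (psnd z))) (psnd (psnd z))) e (pfst z) (psnd (pfst (psnd z)))"
    for Os z
  have "dec P" unfolding P_def play_oracle_def first_oracle_def announced_def by (intro pr_intros)
  from search_machine[OF this] obtain G where G: "computable G"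
    "\<And>c Os i. halts (machine_decode (G c)) Os i \<longleftrightarrow> (\<exists>n. P Os (pair c (pair i n)))" by blast
  have ans: "answer [y] 0 = y" for y by (simp add: fun_eq_iff answer_single)
  have GP: "halts (machine_decode (G S)) [y] i \<longleftrightarrow> (\<exists>m. crun (play_oracle y (pfst i) m) e S (psnd i) \<noteq> 0 \<and>
      \<not> halted T (run T [first_oracle y, \<lambda>k. Suc (bound y k + lnth (pfst i) k)] S (psnd i)))" for S y i
    unfolding G P_def pfst_pair psnd_pair ans
    using chalts_iff[OF consistent_play_oracle, where e = e, unfolded e] by blast
  have "S \<in> L \<longleftrightarrow> wins (N (G S)) []" for S
  proof
    assume "wins (N (G S)) []"
    then obtain \<sigma> where \<sigma>: "\<And>y. follows even \<sigma> [] y \<Longrightarrow> y \<in> N (G S)" by (auto simp: wins_def)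
    show "S \<in> L"
    proof (rule ccontr)
      assume S: "S \<notin> L"
      \<comment> \<open>\<open>Pl n\<close> contains all plays of length \<open>2 n\<close> against \<open>\<sigma>\<close> in which the second player produces
        \<open>A1\<close> below \<open>n\<close> and delays announcements until the announced number is at most the time.\<close>
      define a where "a P n = Suc (f0 n + (\<Sum>p\<in>P. \<sigma> p))" for P n
      \<comment> \<open>Time \<open>n\<close> is reserved for the argument \<open>pfst n\<close> and
        for values at most \<open>n\<close>. These are finitely many moves whatever \<open>B\<close>
        is, so \<open>A1\<close> can be fixed before \<open>B\<close>.\<close>
      define Wn where "Wn n = insert 0 ((\<lambda>v. Suc (pair (pfst n) v)) ` {..n})" for n
      define Pl where "Pl = rec_nat {[]} (\<lambda>n P. \<Union>p\<in>P. (\<lambda>w. p @ [\<sigma> p, pair (a P n - Suc (\<sigma> p)) w]) ` Wn n)"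
      define A1 where "A1 n = a (Pl n) n" for n
      have Pl_Suc: "Pl (Suc n) = (\<Union>p\<in>Pl n. (\<lambda>w. p @ [\<sigma> p, pair (A1 n - Suc (\<sigma> p)) w]) ` Wn n)" for n
        by (simp add: Pl_def A1_def)
      have fin: "finite (Pl n)" for n
        by (induction n) (auto simp: Pl_Suc Wn_def, simp add: Pl_def)
      \<comment> \<open>All of \<open>A1\<close> is available here, so no circularity arises even if
        \<open>f\<close> looks at infinitely many of its values.\<close>
      define B where "B = f A1"
      define w where "w n = (if B (pfst n) \<le> n then Suc (pair (pfst n) (B (pfst n))) else 0)" for n
      have wW: "w n \<in> Wn n" for n by (auto simp: w_def Wn_def)
      obtain y where y: "follows even \<sigma> [] y"
        "\<And>n. odd n \<Longrightarrow> y n = pair (A1 (n div 2) - Suc (last (init y n))) (w (n div 2))"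
        using play_against[where p = "[]" and P = even and \<sigma> = \<sigma> and \<tau> = "\<lambda>q. pair (A1 (length q div 2) - Suc (last q)) (w (length q div 2))"]
        by (metis length_init list.size(3) le0)
      have y0: "y (n + n) = \<sigma> (init y (n + n))" for n
        using y(1) by (simp add: follows_def)
      have y1: "y (Suc (n + n)) = pair (A1 n - Suc (y (n + n))) (w n)" for n
        using y(2)[of "Suc (n + n)"] by (simp add: init_Suc)
      have Pl: "init y (n + n) \<in> Pl n" for n
      proof (induction n)
        case 0
        then show ?case by (simp add: Pl_def)
      next
        case (Suc n)
        have "init y (Suc n + Suc n) = init y (n + n) @
            [\<sigma> (init y (n + n)), pair (A1 n - Suc (\<sigma> (init y (n + n)))) (w n)]"
          by (simp add: init_Suc y1 y0[symmetric])
        then show ?case unfolding Pl_Suc using Suc wW by blast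
      qed
      have le: "Suc (y (n + n)) \<le> A1 n" for n
      proof -
        have "\<sigma> (init y (n + n)) \<le> (\<Sum>p\<in>Pl n. \<sigma> p)"
          by (rule member_le_sum[OF Pl]) (use fin in auto)
        then show ?thesis by (simp add: y0 A1_def a_def)
      qed
      have fo: "first_oracle y = A1"
      proof
        show "first_oracle y n = A1 n" for n using le[of n] by (simp add: first_oracle_def y1)
      qed
      \<comment> \<open>Every \<open>k\<close> is \<open>pfst\<close> of infinitely many times;
        \<open>pair k (B k)\<close> is one that is late enough to announce
        \<open>B k\<close>.\<close>
      have ann: "announced y m k \<noteq> 0" if "m > pair k (B k)" for m k
      proof -
        let ?n = "pair k (B k)"
        have "B k \<le> ?n" unfolding pair_def by (rule le_prod_encode_2)
        then have "w ?n = Suc (pair k (B k))" by (simp add: w_def)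
        then show ?thesis
          unfolding announced_def bfind_nonzero using that by (intro exI[of _ ?n]) (simp add: y1)
      qed
      have bd: "bound y k = B k" for k
      proof -
        have "announced y (Suc (pair k (B k))) k = Suc (bound y k)"
          by (rule announced_bound) (use ann in simp)
        from bfind_SucD[OF this[unfolded announced_def]] obtain n where
          "psnd (y (Suc (n + n))) \<noteq> 0 \<and> pfst (psnd (y (Suc (n + n))) - 1) = k"
          "psnd (psnd (y (Suc (n + n))) - 1) = bound y k"
          by (auto split: if_splits)
        then show ?thesis by (auto simp: y1 w_def split: if_splits)
      qed
      have "halts (machine_decode (G S)) [y] i" for i
      proof -
        let ?l = "pfst i"
        have "\<exists>m. \<forall>m'\<ge>m. play_oracle y ?l m' j k \<noteq> 0" for j k
          by (rule exI[of _ "Suc (pair k (B k))"]) (auto simp: play_oracle_def ann)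
        from crun_complete[OF consistent_play_oracle this, of e S "psnd i"]
        obtain m where m: "crun (play_oracle y ?l m) e S (psnd i) \<noteq> 0" by blast
        have "\<not> halts T [A1, \<lambda>k. Suc (B k + lnth ?l k)] S"
          by (subst rec) (use S in \<open>auto simp: A1_def a_def f0_def B_def less_Suc_eq_le\<close>)
        then show ?thesis unfolding GP fo bd using m by (auto simp: halts_def)
      qed
      then show False using \<sigma>[OF y(1)] by (simp add: N_def)
    qed
  next
    assume S: "S \<in> L"
    show "wins (N (G S)) []"
    proof (rule ccontr)
      assume "\<not> wins (N (G S)) []"
      then obtain \<tau> where \<tau>: "\<And>y. follows odd \<tau> [] y \<Longrightarrow> y \<notin> N (G S)"
        using N_determined[of "G S" "[]"] unfolding second_wins_def by blast
      \<comment> \<open>Bids of \<open>f0\<close> keep the first oracle above \<open>f0\<close>,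
        whatever the second player does.\<close>
      obtain y where y: "follows odd \<tau> [] y" "\<And>n. even n \<Longrightarrow> y n = f0 (n div 2)"
        using play_against[where p = "[]" and P = odd and \<sigma> = \<tau> and \<tau> = "\<lambda>q. f0 (length q div 2)"]
        by (metis length_init list.size(3) le0)
      define A1 where "A1 = first_oracle y"
      define A2 where "A2 k = Suc (bound y k + f A1 k)" for k
      have "halts T [A1, A2] S"
        by (subst rec) (use S in \<open>auto simp: A1_def A2_def first_oracle_def y(2) f0_def less_Suc_eq_le\<close>)
      then obtain s where s: "halted T (run T [A1, A2] S s)" by (auto simp: halts_def)
      obtain m0 where m0: "\<And>Os. \<forall>i. \<forall>k<m0. answer Os i k = answer [A1, A2] i k \<Longrightarrow>
          run T Os S s = run T [A1, A2] S s"
        using run_use by blast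
      \<comment> \<open>The halting run reads the oracles only below \<open>m0\<close>, so a finite
        list can stand in for the excess \<open>f A1\<close>.\<close>
      define l where "l = list_encode (map (f A1) [0..<m0])"
      have "lnth l k = f A1 k" if "k < m0" for k
        using that by (simp add: lnth_eq llen_def l_def)
      then have "run T [first_oracle y, \<lambda>k. Suc (bound y k + lnth l k)] S s = run T [A1, A2] S s"
        by (intro m0) (auto simp: answer_def A1_def A2_def less_Suc_eq nth_Cons')
      moreover have "halts (machine_decode (G S)) [y] (pair l s)"
        using \<tau>[OF y(1)] by (auto simp: N_def)
      ultimately show False using s unfolding GP pfst_pair psnd_pair by simp
    qed
  qed
  then show ?thesis unfolding many_one_reducible_def quantifier_iff using G(1) by blast
qed

section \<open>From games to recognizability\<close>

text \<open>Positions are coded latest move first, so that extending a position is a single \<open>lcons\<close>.\<close>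

definition pos :: "nat list \<Rightarrow> nat" where
  "pos p = list_encode (rev p)"

lemma pos_snoc: "pos (p @ [k]) = lcons k (pos p)"
  by (simp add: pos_def list_encode_Cons del: list_encode.simps)

lemma llen_pos [simp]: "llen (pos p) = length p"
  by (simp add: llen_def pos_def)

lemma pos_rev_decode: "pos (rev (list_decode n)) = n"
  by (simp add: pos_def)

lemma rev_decode_pos [simp]: "rev (list_decode (pos p)) = p"
  by (simp add: pos_def)

lemma pos_eq_iff [simp]: "pos p = pos q \<longleftrightarrow> p = q"
  by (metis rev_decode_pos)

lemma ltl_funpow_pos: "(ltl ^^ m) (pos p) = pos (take (length p - m) p)"
proof -
  have "list_decode ((ltl ^^ m) (pos p)) = list_decode (pos (take (length p - m) p))"
    by (simp add: list_decode_ltl_funpow pos_def drop_rev)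
  then show ?thesis by (metis list_decode_inverse)
qed

definition history :: "nat \<Rightarrow> nat \<Rightarrow> nat \<Rightarrow> nat" where
  "history r = (\<lambda>j k. if j = 0 then if k < llen r then Suc (lnth r (llen r - 1 - k)) else 0 else 1)"

lemma history_pos:
  "history (pos p) = (\<lambda>j k. if j = 0 then if k < length p then Suc (p ! k) else 0 else 1)"
proof (intro ext)
  fix j k
  have "lnth (pos p) (length p - 1 - k) = p ! k" if "k < length p"
  proof -
    have "length p - 1 - k < length p" using that by linarith
    then show ?thesis using that by (simp add: lnth_eq) (simp add: pos_def rev_nth)
  qed
  then show "history (pos p) j k = (if j = 0 then if k < length p then Suc (p ! k) else 0 else 1)"
    by (simp add: history_def)
qed

text \<open>All prefixes are tried, not only the position itself, which makes the notion monotone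
  along a play; bounding the steps by the length makes it decidable.\<close>

definition seen_halting :: "nat \<Rightarrow> nat \<Rightarrow> nat \<Rightarrow> bool" where
  "seen_halting e i r \<longleftrightarrow> (\<exists>m<Suc (llen r). \<exists>s<Suc (llen r). chalts (history ((ltl ^^ m) r)) e i s)"

lemma seen_halting_pos:
  "seen_halting e i (pos p) \<longleftrightarrow> (\<exists>n\<le>length p. \<exists>s\<le>length p. chalts (history (pos (take n p))) e i s)"
proof
  assume "seen_halting e i (pos p)"
  then obtain m s where "m \<le> length p" "s \<le> length p"
    "chalts (history (pos (take (length p - m) p))) e i s"
    by (auto simp: seen_halting_def ltl_funpow_pos less_Suc_eq_le)
  then show "\<exists>n\<le>length p. \<exists>s\<le>length p. chalts (history (pos (take n p))) e i s"
    by (intro exI[of _ "length p - m"]) auto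
next
  assume "\<exists>n\<le>length p. \<exists>s\<le>length p. chalts (history (pos (take n p))) e i s"
  then obtain n s where "n \<le> length p" "s \<le> length p" "chalts (history (pos (take n p))) e i s"
    by blast
  then have "chalts (history ((ltl ^^ (length p - n)) (pos p))) e i s" "length p - n < Suc (length p)"
    "s < Suc (length p)"
    by (simp_all add: ltl_funpow_pos)
  then show "seen_halting e i (pos p)" unfolding seen_halting_def llen_pos by blast
qed

lemma seen_halting_mono: "seen_halting e i (pos (take k p)) \<Longrightarrow> seen_halting e i (pos p)"
proof (cases "k \<le> length p")
  case True
  assume "seen_halting e i (pos (take k p))"
  then obtain n s where "n \<le> k" "s \<le> k" "chalts (history (pos (take n (take k p)))) e i s"
    unfolding seen_halting_pos using True by auto
  then show ?thesis unfolding seen_halting_pos using True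
    by (intro exI[of _ n] conjI exI[of _ s]) (auto simp: min_def)
qed simp

lemma consistent_history: "consistent (history (pos (init x n))) [x]"
  by (auto simp: consistent_def history_pos answer_single split: if_splits)

lemma seen_halting_halts: "seen_halting e i (pos (init x n)) \<Longrightarrow> halts (machine_decode e) [x] i"
  unfolding seen_halting_pos using chalts_halts[OF consistent_history] by fastforce

lemma halts_seen_halting:
  assumes "halts (machine_decode e) [x] i"
  shows "\<exists>n. seen_halting e i (pos (init x n))"
proof -
  have "\<exists>m. \<forall>m'\<ge>m. history (pos (init x m')) j k \<noteq> 0" for j k
    by (rule exI[of _ "Suc k"]) (simp add: history_pos)
  from halts_chalts[OF consistent_history this assms] obtain s m where
    "\<forall>m'\<ge>m. chalts (history (pos (init x m'))) e i s" by blast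
  then have "chalts (history (pos (init x (max s m)))) e i s" by simp
  then have "seen_halting e i (pos (init x (max s m)))"
    unfolding seen_halting_pos by (intro exI[of _ "max s m"] conjI exI[of _ s]) auto
  then show ?thesis by blast
qed

text \<open>
  The bounded game for \<open>e\<close>: in position \<open>p\<close> the first player moves at most \<open>A1 (pair e (pos p))\<close>,
  the second at most \<open>A2 (pair e (pos p))\<close>, and machine \<open>e\<close> must be seen to halt on \<open>i\<close> by time
  \<open>A2 (pair e i)\<close>. A certificate is a finite set of positions showing that the first player can
  make the second miss a deadline.
\<close>

definition overdue :: "(nat \<Rightarrow> nat) \<Rightarrow> nat \<Rightarrow> nat \<Rightarrow> bool" where
  "overdue A2 e r \<longleftrightarrow> (\<exists>i<llen r. A2 (pair e i) \<le> llen r \<and> \<not> seen_halting e i r)"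

definition member :: "nat \<Rightarrow> nat \<Rightarrow> bool" where
  "member r C \<longleftrightarrow> (\<exists>j<llen C. lnth C j = r)"

definition certificate :: "(nat \<Rightarrow> nat) \<Rightarrow> (nat \<Rightarrow> nat) \<Rightarrow> nat \<Rightarrow> nat \<Rightarrow> bool" where
  "certificate A1 A2 e C \<longleftrightarrow> member 0 C \<and> (\<forall>j<llen C. overdue A2 e (lnth C j) \<or>
     (even (llen (lnth C j)) \<and> (\<exists>k<Suc (A1 (pair e (lnth C j))). member (lcons k (lnth C j)) C)) \<or>
     (\<not> even (llen (lnth C j)) \<and> (\<forall>k<Suc (A2 (pair e (lnth C j))). member (lcons k (lnth C j)) C)))"

lemma member_iff: "member r C \<longleftrightarrow> r \<in> set (list_decode C)"
  by (auto simp: member_def lnth_eq llen_def in_set_conv_nth)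

lemma certificate_iff:
  "certificate A1 A2 e C \<longleftrightarrow> member (pos []) C \<and> (\<forall>p. member (pos p) C \<longrightarrow> overdue A2 e (pos p) \<or>
     (even (length p) \<and> (\<exists>k\<le>A1 (pair e (pos p)). member (pos (p @ [k])) C)) \<or>
     (odd (length p) \<and> (\<forall>k\<le>A2 (pair e (pos p)). member (pos (p @ [k])) C)))"
proof -
  define R where "R r \<longleftrightarrow> overdue A2 e r \<or>
     (even (llen r) \<and> (\<exists>k<Suc (A1 (pair e r)). member (lcons k r) C)) \<or>
     (\<not> even (llen r) \<and> (\<forall>k<Suc (A2 (pair e r)). member (lcons k r) C))" for r
  have "(\<forall>j<llen C. R (lnth C j)) \<longleftrightarrow> (\<forall>p. member (pos p) C \<longrightarrow> R (pos p))"
    unfolding member_def by (metis pos_rev_decode)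
  moreover have "pos [] = 0" by (simp add: pos_def)
  moreover have "certificate A1 A2 e C \<longleftrightarrow> member 0 C \<and> (\<forall>j<llen C. R (lnth C j))"
    by (simp add: certificate_def R_def)
  moreover have "R (pos p) \<longleftrightarrow> overdue A2 e (pos p) \<or>
     (even (length p) \<and> (\<exists>k\<le>A1 (pair e (pos p)). member (pos (p @ [k])) C)) \<or>
     (odd (length p) \<and> (\<forall>k\<le>A2 (pair e (pos p)). member (pos (p @ [k])) C))" for p
    by (simp add: R_def less_Suc_eq_le pos_snoc)
  ultimately show ?thesis by simp
qed

theorem reducible_recognizable:
  assumes "L \<le>\<^sub>m Sigma02_game_quantifier"
  shows "recognizable 2 L"
proof -
  obtain g where g: "computable g" "\<And>n. n \<in> L \<longleftrightarrow> wins (N (g n)) []"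
    using assms by (auto simp: many_one_reducible_def quantifier_iff)
  obtain eg where eg: "\<And>n. \<exists>s. chalts (\<lambda>_ _. 1) eg n s"
    "\<And>n s. chalts (\<lambda>_ _. 1) eg n s \<Longrightarrow> coutput (\<lambda>_ _. 1) eg n s = g n"
    using computable_code[OF g(1)] by blast
  define P where "P Os z \<longleftrightarrow> chalts (\<lambda>_ _. 1) eg (pfst (psnd z)) (pfst (psnd (psnd z))) \<and>
    certificate (\<lambda>n. answer Os 0 n) (\<lambda>n. answer Os 1 n)
      (coutput (\<lambda>_ _. 1) eg (pfst (psnd z)) (pfst (psnd (psnd z)))) (psnd (psnd (psnd z)))" for Os z
  have "dec P"
    unfolding P_def certificate_def overdue_def member_def seen_halting_def history_def
    by (intro pr_intros)
  from search_machine[OF this] obtain G where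
    G: "\<And>c Os i. halts (machine_decode (G c)) Os i \<longleftrightarrow> (\<exists>n. P Os (pair c (pair i n)))" by blast
  define T where "T = machine_decode (G 0)"
  have T: "halts T [A1, A2] S \<longleftrightarrow> (\<exists>C. certificate A1 A2 (g S) C)" for A1 A2 S
  proof
    have a: "(\<lambda>n. answer [A1, A2] 0 n) = A1" "(\<lambda>n. answer [A1, A2] 1 n) = A2"
      by (simp_all add: answer_def)
    {
      assume "halts T [A1, A2] S"
      then obtain n where n: "P [A1, A2] (pair 0 (pair S n))" unfolding T_def G by blast
      note n = n[unfolded P_def pfst_pair psnd_pair a]
      show "\<exists>C. certificate A1 A2 (g S) C"
        using n unfolding eg(2)[OF conjunct1[OF n]] by blast
    next
      assume "\<exists>C. certificate A1 A2 (g S) C"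
      then obtain C where C: "certificate A1 A2 (g S) C" by blast
      obtain s where s: "chalts (\<lambda>_ _. 1) eg S s" using eg(1) by blast
      have "P [A1, A2] (pair 0 (pair S (pair s C)))"
        using C s unfolding P_def pfst_pair psnd_pair a eg(2)[OF s] by blast
      then show "halts T [A1, A2] S" unfolding T_def G by blast
    }
  qed
  have "\<forall>e. \<exists>\<sigma>. wins (N e) [] \<longrightarrow> (\<forall>x. follows even \<sigma> [] x \<longrightarrow> x \<in> N e)"
    unfolding wins_def by blast
  from choice[OF this] obtain \<sigma> where
    \<sigma>: "\<And>e x. wins (N e) [] \<Longrightarrow> follows even (\<sigma> e) [] x \<Longrightarrow> x \<in> N e" by blast
  have "\<forall>e. \<exists>\<tau>. second_wins (N e) [] \<longrightarrow> (\<forall>x. follows odd \<tau> [] x \<longrightarrow> x \<notin> N e)"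
    unfolding second_wins_def by blast
  from choice[OF this] obtain \<tau> where
    \<tau>: "\<And>e x. second_wins (N e) [] \<Longrightarrow> follows odd (\<tau> e) [] x \<Longrightarrow> x \<notin> N e" by blast
  \<comment> \<open>For the deadlines, the second player follows \<open>\<tau> e\<close> against all
    moves permitted by \<open>A\<close>; \<open>mv\<close> prunes this tree where the machine is
    seen to halt on \<open>i\<close>.\<close>
  define mv0 where "mv0 A e p = (if odd (length p) then {\<tau> e p} else {..A (pair e (pos p))})"
    for A e p
  define mv where "mv A e i p = (if seen_halting e i (pos p) then {} else mv0 A e p)" for A e i p
  have fin: "finite (mv A e i p)" for A e i p by (simp add: mv_def mv0_def)
  \<comment> \<open>An infinite branch would be a play won by \<open>\<tau> e\<close>, so machine
    \<open>e\<close> would halt on \<open>i\<close> and the branch would have been pruned.\<close>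
  have ex: "\<exists>n. level (mv A e i) n = {}" if "second_wins (N e) []" for A e i
  proof (rule ccontr)
    assume "\<not> ?thesis"
    then obtain x where x: "\<And>n. x n \<in> mv A e i (init x n)"
      using koenig[of "mv A e i"] fin by blast
    have "x n = \<tau> e (init x n)" if "odd n" for n
      using x[of n] that by (simp add: mv_def mv0_def split: if_splits)
    then have "follows odd (\<tau> e) [] x" by (simp add: follows_def)
    then have "halts (machine_decode e) [x] i"
      using \<tau>[OF that] by (auto simp: N_def)
    then obtain n where "seen_halting e i (pos (init x n))" using halts_seen_halting by blast
    then show False using x[of n] by (simp add: mv_def)
  qed
  define deadline where "deadline A e i =
    (if second_wins (N e) [] then LEAST n. level (mv A e i) n = {} else 0)" for A e i
  define c where "c n = \<sigma> (pfst n) (rev (list_decode (psnd n))) + \<tau> (pfst n) (rev (list_decode (psnd n)))" for n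
  \<comment> \<open>The argument \<open>n\<close> is read both as game and position, for the
    strategy values, and as game and index \<open>i\<close>, for the deadline; the sum dominates all
    of them.\<close>
  define f where "f A n = c n + deadline A (pfst n) (psnd n)" for A n
  have "\<exists>m. \<forall>A'. (\<forall>j<m. A' j = A j) \<longrightarrow> f A' n = f A n" for A n
  proof (cases "second_wins (N (pfst n)) []")
    case True
    define e i where "e = pfst n" and "i = psnd n"
    have w: "second_wins (N e) []" using True by (simp add: e_def)
    \<comment> \<open>A level depends on \<open>A\<close> only at the finitely many positions of the
      preceding ones. Finitely many values of \<open>A\<close> thus determine the levels up to the
      first empty one.\<close>
    have "\<exists>m. \<forall>A'. (\<forall>j<m. A' j = A j) \<longrightarrow> (\<forall>k\<le>n. level (mv A' e i) k = level (mv A e i) k)" for n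
    proof (induction n)
      case (Suc n)
      then obtain m where m: "\<And>A'. \<forall>j<m. A' j = A j \<Longrightarrow> \<forall>k\<le>n. level (mv A' e i) k = level (mv A e i) k"
        by blast
      have "finite ((\<lambda>p. pair e (pos p)) ` level (mv A e i) n)"
        using finite_level[of "mv A e i", OF fin] by blast
      from iffD1[OF finite_nat_set_iff_bounded this]
      obtain b where "\<forall>r\<in>(\<lambda>p. pair e (pos p)) ` level (mv A e i) n. r < b" ..
      then have b: "pair e (pos p) < b" if "p \<in> level (mv A e i) n" for p
        using that by simp
      have "\<forall>k\<le>Suc n. level (mv A' e i) k = level (mv A e i) k" if A': "\<forall>j<max m b. A' j = A j" for A'
      proof -
        have le: "\<forall>k\<le>n. level (mv A' e i) k = level (mv A e i) k"
          by (rule m) (use A' in simp)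
        have "mv A' e i p = mv A e i p" if "p \<in> level (mv A e i) n" for p
          using A' b[OF that] by (simp add: mv_def mv0_def)
        then have "level (mv A' e i) (Suc n) = level (mv A e i) (Suc n)" using le by simp
        then show ?thesis using le by (auto simp: le_Suc_eq)
      qed
      then show ?case by blast
    qed auto
    from this[of "LEAST n. level (mv A e i) n = {}"] obtain m where
      m: "\<And>A'. \<forall>j<m. A' j = A j \<Longrightarrow> \<forall>k\<le>(LEAST n. level (mv A e i) n = {}). level (mv A' e i) k = level (mv A e i) k"
      by blast
    have "f A' n = f A n" if "\<forall>j<m. A' j = A j" for A'
    proof -
      have "(LEAST n. level (mv A' e i) n = {}) = (LEAST n. level (mv A e i) n = {})" (is "_ = ?k")
      proof (rule Least_equality)
        show "level (mv A' e i) ?k = {}"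
          using m[OF that] LeastI_ex[OF ex[OF w, of A i]] by simp
        fix k assume k: "level (mv A' e i) k = {}"
        show "?k \<le> k"
        proof (rule ccontr)
          assume "\<not> ?k \<le> k"
          then have "level (mv A e i) k = {}" using m[OF that] k by auto
          then show False using Least_le[of "\<lambda>n. level (mv A e i) n = {}" k] \<open>\<not> ?k \<le> k\<close> by simp
        qed
      qed
      then show ?thesis by (simp add: f_def deadline_def e_def i_def)
    qed
    then show ?thesis by blast
  qed (simp add: f_def deadline_def)
  then have "local_functional f" unfolding local_functional_def by blast
  moreover have "recognizes 2 T f L"
    unfolding recognizes_2 T g(2)
  proof (intro allI impI)
    fix A1 A2 :: "nat \<Rightarrow> nat" and S
    assume A1: "\<forall>n. A1 n > f (\<lambda>_. 0) n" and A2: "\<forall>n. A2 n > f A1 n"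
    define e where "e = g S"
    have \<sigma>A1: "\<sigma> e p \<le> A1 (pair e (pos p))" for p
      using A1[rule_format, of "pair e (pos p)"] by (simp add: f_def c_def)
    have \<tau>A2: "\<tau> e p \<le> A2 (pair e (pos p))" for p
      using A2[rule_format, of "pair e (pos p)"] by (simp add: f_def c_def)
    have dA2: "deadline A1 e i \<le> A2 (pair e i)" for i
      using A2[rule_format, of "pair e i"] by (simp add: f_def)
    show "(\<exists>C. certificate A1 A2 (g S) C) \<longleftrightarrow> wins (N (g S)) []"
      unfolding e_def[symmetric]
    proof
      assume w: "wins (N e) []"
      \<comment> \<open>The first player follows his winning strategy, legal by
        \<open>\<sigma>A1\<close>; the second makes any move permitted by \<open>A2\<close>.
        Branches end at a missed deadline, and the nodes of the resulting finite tree form the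
        certificate.\<close>
      define mw where "mw p = (if overdue A2 e (pos p) then {} else if even (length p) then {\<sigma> e p}
        else {..A2 (pair e (pos p))})" for p
      have finw: "finite (mw p)" for p by (simp add: mw_def)
      have "\<exists>n. level mw n = {}"
      proof (rule ccontr)
        assume "\<not> ?thesis"
        then obtain x where x: "\<And>n. x n \<in> mw (init x n)" using koenig[of mw] finw by blast
        have "x n = \<sigma> e (init x n)" if "even n" for n
          using x[of n] that by (simp add: mw_def split: if_splits)
        then have "follows even (\<sigma> e) [] x" by (simp add: follows_def)
        then obtain i where i: "\<not> halts (machine_decode e) [x] i"
          using \<sigma>[OF w] by (auto simp: N_def)
        \<comment> \<open>At this length \<open>i\<close> is in the range inspected by
          \<open>overdue\<close> and its deadline has passed.\<close>
        let ?n = "max (Suc i) (A2 (pair e i))"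
        have "overdue A2 e (pos (init x ?n))"
          unfolding overdue_def using i seen_halting_halts by (intro exI[of _ i]) auto
        then show False using x[of ?n] by (simp add: mw_def)
      qed
      then obtain n0 where n0: "level mw n0 = {}" by blast
      define X where "X = (\<Union>n<n0. level mw n)"
      have "finite X" unfolding X_def using finite_level[of mw, OF finw] by blast
      then obtain xs where xs: "set xs = X" using finite_list by blast
      define C where "C = list_encode (map pos xs)"
      have C: "member (pos p) C \<longleftrightarrow> p \<in> X" for p
        by (auto simp: member_iff C_def xs[symmetric])
      have "n0 \<noteq> 0" using n0 by (cases n0) auto
      then have nil: "[] \<in> X" unfolding X_def by (intro UN_I[of 0]) auto
      have ext: "p @ [k] \<in> X" if "p \<in> X" "k \<in> mw p" for p k
      proof -
        obtain n where n: "n < n0" "p \<in> level mw n" using \<open>p \<in> X\<close> by (auto simp: X_def)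
        then have "p @ [k] \<in> level mw (Suc n)" using that(2) by auto
        moreover from this n0 n(1) have "Suc n < n0" by (cases "Suc n = n0") auto
        ultimately show ?thesis unfolding X_def by blast
      qed
      have "certificate A1 A2 e C"
        unfolding certificate_iff C
      proof (intro conjI allI impI)
        fix p assume p: "p \<in> X"
        show "overdue A2 e (pos p) \<or>
          even (length p) \<and> (\<exists>k\<le>A1 (pair e (pos p)). p @ [k] \<in> X) \<or>
          odd (length p) \<and> (\<forall>k\<le>A2 (pair e (pos p)). p @ [k] \<in> X)"
        proof (cases "overdue A2 e (pos p)")
          case False
          then show ?thesis
          proof (cases "even (length p)")
            case True
            have "\<sigma> e p \<in> mw p" using False True by (simp add: mw_def)
            then show ?thesis using ext[OF p] \<sigma>A1[of p] True by blast
          next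
            case odd: False
            have "k \<in> mw p" if "k \<le> A2 (pair e (pos p))" for k
              using False odd that by (simp add: mw_def)
            then show ?thesis using ext[OF p] odd by blast
          qed
        qed simp
      qed (rule nil)
      then show "\<exists>C. certificate A1 A2 e C" by blast
    next
      assume "\<exists>C. certificate A1 A2 e C"
      then obtain C where C: "certificate A1 A2 e C" by blast
      show "wins (N e) []"
      proof (rule ccontr)
        assume "\<not> wins (N e) []"
        then have w: "second_wins (N e) []" using N_determined by blast
        \<comment> \<open>Positions of the certificate reachable against \<open>\<tau> e\<close>
          with the first player's moves permitted by \<open>A1\<close>. A longest one is not
          overdue, so the certificate supplies a longer one, a contradiction.\<close>
        define X where "X = {p. member (pos p) C \<and> p \<in> level (mv0 A1 e) (length p)}"
        have "pos ` X \<subseteq> set (list_decode C)" by (auto simp: X_def member_iff)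
        then have "finite (pos ` X)" by (rule finite_subset) simp
        then have finX: "finite X" by (rule finite_imageD) (simp add: inj_on_def)
        have nilX: "[] \<in> X" using C by (simp add: X_def certificate_iff)
        have "Max (length ` X) \<in> length ` X" by (rule Max_in) (use finX nilX in auto)
        then obtain p where p: "p \<in> X" "length p = Max (length ` X)" by auto
        have longest: "length q \<le> length p" if "q \<in> X" for q
          unfolding p(2) by (rule Max_ge) (use finX that in auto)
        have path: "\<forall>j<length p. p ! j \<in> mv0 A1 e (take j p)"
          using p(1) by (simp add: X_def in_level)
        have "\<not> overdue A2 e (pos p)"
        proof
          assume "overdue A2 e (pos p)"
          then obtain i where i: "A2 (pair e i) \<le> length p" "\<not> seen_halting e i (pos p)"
            by (auto simp: overdue_def)
          let ?d = "deadline A1 e i"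
          have d: "?d \<le> length p" using dA2[of i] i(1) by simp
          \<comment> \<open>Since halting on \<open>i\<close> has not been seen, this prefix
            survives the pruning, although level \<open>?d\<close> of the pruned tree is
            empty.\<close>
          have "take ?d p \<in> level (mv A1 e i) ?d"
            unfolding in_level
          proof (intro conjI allI impI)
            fix j assume j: "j < ?d"
            have "\<not> seen_halting e i (pos (take j p))" using i(2) seen_halting_mono by blast
            then show "take ?d p ! j \<in> mv A1 e i (take j (take ?d p))"
              using path j d by (simp add: mv_def min_def)
          qed (use d in simp)
          moreover have "level (mv A1 e i) ?d = {}"
            using LeastI_ex[OF ex[OF w, of A1 i]] w by (simp add: deadline_def)
          ultimately show False by blast
        qed
        moreover have "member (pos p) C" using p(1) by (simp add: X_def)
        ultimately have "(even (length p) \<and> (\<exists>k\<le>A1 (pair e (pos p)). member (pos (p @ [k])) C)) \<or>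
            (odd (length p) \<and> (\<forall>k\<le>A2 (pair e (pos p)). member (pos (p @ [k])) C))"
          using C unfolding certificate_iff by blast
        \<comment> \<open>By \<open>\<tau>A2\<close> the second player's strategy move is among
          those that the certificate covers.\<close>
        then have "\<exists>k. member (pos (p @ [k])) C \<and> k \<in> mv0 A1 e p"
          using \<tau>A2[of p] by (auto simp: mv0_def)
        then obtain k where k: "member (pos (p @ [k])) C" "k \<in> mv0 A1 e p" by blast
        have "p @ [k] \<in> level (mv0 A1 e) (Suc (length p))"
          using p(1) k(2) by (auto simp: X_def)
        then have "p @ [k] \<in> X" using k(1) by (simp only: X_def mem_Collect_eq length_append_singleton)
        from longest[OF this] show False by simp
      qed
    qed
  qed
  ultimately show ?thesis unfolding recognizable_def by blast
qed

theorem theorem3p2: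
  fixes L :: "nat set"
  shows "(recognizable 2 L \<longleftrightarrow> L \<le>\<^sub>m Sigma02_game_quantifier)
    \<and> (nonlocally_recognizable 2 L \<longleftrightarrow> L \<le>\<^sub>m Sigma02_game_quantifier)
    \<and> (L \<le>\<^sub>m Sigma02_game_quantifier \<longleftrightarrow>
         (\<exists>W. lightface_Sigma02 W \<and> L \<le>\<^sub>m winning_position_codes W))"
proof -
  have "recognizable 2 L \<Longrightarrow> nonlocally_recognizable 2 L"
    by (auto simp: recognizable_def nonlocally_recognizable_def)
  then show ?thesis
    using nonlocally_recognizable_reducible reducible_recognizable reducible_to_positions
      positions_reducible by blast
qed

end
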